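(* Let $n\ge4$ and $\lambda,\beta\in\mathbb{C}$. In $\mathfrak{D}_{\lambda,\beta}(\mathfrak{sl}_n)$ set, for $1\le i\le n-1$, $$X_{i,0}^{\pm}=X_i^{\pm},\quad H_{i,0}=H_i,\quad X_{i,1}^{\pm}=P(X_i^{\pm})-\lambda\omega_i^{\pm},\quad H_{i,1}=P(H_i)-\lambda\nu_i .$$ These elements satisfy the following defining relations of the Yangian $Y(\mathfrak{sl}_n)$, for all $1\le i,j\le n-1$: $$[H_{i,r},H_{j,s}]=0,\quad [H_{i,0},X_{j,s}^{\pm}]=\pm c_{ij}X_{j,s}^{\pm}\qquad\text{for all } r,s\in\{0,1\},$$ $$[X_{i,1}^{\pm},X_{j,0}^{\pm}]-[X_{i,0}^{\pm},X_{j,1}^{\pm}]=\pm\frac{\lambda c_{ij}}{2}S(X_{i,0}^{\pm},X_{j,0}^{\pm}),\qquad [H_{i,1},X_{j,0}^{\pm}]-[H_{i,0},X_{j,1}^{\pm}]=\pm\frac{\lambda c_{ij}}{2}S(H_{i,0},X_{j,0}^{\pm}),$$ $$[X_{i,r}^+,X_{j,s}^-]=\delta_{ij}H_{i,r+s}\ \text{ for } r+s\in\{0,1\},\qquad \big[[X_{i,1}^+,X_{i,1}^-],H_{i,1}\big]=0,$$ $$\mathrm{ad}(X_{i,0}^{\pm})^{1-c_{ij}}(X_{j,0}^{\pm})=0\quad (i\neq j).$$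
   Context: $E_{ij}$ are the elementary $n\times n$ matrices, $S(a,b)=ab+ba$. $\{\epsilon_1,\dots,\epsilon_n\}$ is the standard orthonormal basis of $\mathbb{C}^n$ with inner product $(\cdot,\cdot)$, $\epsilon_{ij}=\epsilon_i-\epsilon_j$. The roots of $\mathfrak{sl}_n$ are $\epsilon_{ij}$, $i\ne j$; the positive ones $\Delta^+$ are those with $i<j$; simple roots $\alpha_i=\epsilon_{i,i+1}$; for $\alpha=\epsilon_{ij}$ with $i<j$, $X_\alpha^+=E_{ij}$, $X_\alpha^-=E_{ji}$; $X_i^+=E_{i,i+1}$, $X_i^-=E_{i+1,i}$, $H_i=E_{ii}-E_{i+1,i+1}$. $(c_{ij})_{1\le i,j\le n-1}$ is the Cartan matrix of $\mathfrak{sl}_n$. In the enveloping algebra $\mathfrak{U}(\mathfrak{sl}_n)$ (mapped to $\mathfrak{D}_{\lambda,\beta}(\mathfrak{sl}_n)$ by $X\mapsto X$) set $$\omega_i^{\pm}=\pm\tfrac14\sum_{\alpha\in\Delta^+}S([X_i^{\pm},X_\alpha^{\pm}],X_\alpha^{\mp})-\tfrac14S(X_i^{\pm},H_i),\qquad \nu_i=[\omega_i^+,X_i^-]=\tfrac14\sum_{\alpha\in\Delta^+}(\alpha_i,\alpha)S(X_\alpha^+,X_\alpha^-)-\tfrac12H_i^2 .$$ $\mathfrak{D}_{\lambda,\beta}(\mathfrak{sl}_n)$ is the $\mathbb{C}$-algebra generated by $X,K(X),Q(X),P(X)$ for $X\in\mathfrak{sl}_n$ subject to: $X\mapsto X$,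 $X\otimes v\mapsto K(X)$ (resp. $X\mapsto X$, $X\otimes u\mapsto Q(X)$) extends to an algebra homomorphism $\mathfrak{U}(\mathfrak{sl}_n[v])\to\mathfrak{D}_{\lambda,\beta}(\mathfrak{sl}_n)$ (resp. $\mathfrak{U}(\mathfrak{sl}_n[u])\to\mathfrak{D}_{\lambda,\beta}(\mathfrak{sl}_n)$), where $\mathfrak{sl}_n[u]=\mathfrak{sl}_n\otimes\mathbb{C}[u]$; $P(X)$ is linear in $X$ and $[P(X),X']=P([X,X'])$ for all $X,X'\in\mathfrak{sl}_n$; and for $a\ne b$, $c\ne d$, $(a,b)\ne(d,c)$, $$[K(E_{ab}),Q(E_{cd})]=P([E_{ab},E_{cd}])+\left(\beta-\tfrac{\lambda}{2}\right)(\delta_{bc}E_{ad}+\delta_{ad}E_{cb})-\tfrac{\lambda}{4}(\epsilon_{ab},\epsilon_{cd})S(E_{ab},E_{cd})+\tfrac{\lambda}{4}\sum_{1\le i\ne j\le n}S([E_{ab},E_{ij}],[E_{ji},E_{cd}]).$$ *)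

theory Defs
  imports
    Complex_Main
    "HOL-Library.Poly_Mapping"
    "HOL-Algebra.QuotRing"
    "HOL-Computational_Algebra.Polynomial"
    "Jordan_Normal_Form.Matrix"
begin

section \<open>Complex algebras given by generators and relations\<close>

text \<open>
  A unital associative complex algebra is a record of type \<open>(complex, 'a) module\<close>: the ring
  operations (including the multiplication) together with the scalar action \<open>\<odot>\<close>.  The free
  algebra on \<open>G\<close> consists of the finitely supported functions on the free monoid of words over \<open>G\<close>,
  with the convolution product of \<^theory>\<open>HOL-Library.Poly_Mapping\<close>; that theory writes the
  monoid operation additively, hence the wrapper type for words.
\<close>

datatype 'g word = Word (letters: "'g list")

instantiation word :: (type) monoid_add
begin

definition zero_word :: "'a word" where
  "0 = Word []"

definition plus_word :: "'a word \<Rightarrow> 'a word \<Rightarrow> 'a word" where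
  "u + v = Word (letters u @ letters v)"

instance
  by standard (simp_all add: zero_word_def plus_word_def)

end

definition free_algebra :: "'g set \<Rightarrow> (complex, 'g word \<Rightarrow>\<^sub>0 complex) module" where
  "free_algebra G =
    \<lparr>carrier = {p. \<forall>w \<in> Poly_Mapping.keys p. set (letters w) \<subseteq> G},
     monoid.mult = (*), one = 1, zero = 0, add = (+),
     smult = (\<lambda>c p. Poly_Mapping.single 0 c * p)\<rparr>"

definition free_gen :: "'g \<Rightarrow> ('g word \<Rightarrow>\<^sub>0 complex)" where
  "free_gen g = Poly_Mapping.single (Word [g]) 1"

definition quot_algebra ::
    "(complex, 'a, 'm) module_scheme \<Rightarrow> 'a set \<Rightarrow> (complex, 'a set) module" where
  "quot_algebra A I =
    ring.extend (A Quot I) (module.fields (\<lambda>c C. \<Union>x\<in>C. I +>\<^bsub>A\<^esub> (c \<odot>\<^bsub>A\<^esub> x)))"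

definition alg_hom ::
    "(complex, 'a, 'm) module_scheme \<Rightarrow> (complex, 'b, 'k) module_scheme \<Rightarrow> ('a \<Rightarrow> 'b) set" where
  "alg_hom A B =
    {h \<in> Ring.ring_hom A B. \<forall>c. \<forall>x \<in> carrier A. h (c \<odot>\<^bsub>A\<^esub> x) = c \<odot>\<^bsub>B\<^esub> h x}"

definition commutator :: "('a, 'm) ring_scheme \<Rightarrow> 'a \<Rightarrow> 'a \<Rightarrow> 'a" where
  "commutator A x y = (x \<otimes>\<^bsub>A\<^esub> y) \<ominus>\<^bsub>A\<^esub> (y \<otimes>\<^bsub>A\<^esub> x)"

text \<open>\<open>S(x, y) = xy + yx\<close>.\<close>

definition symm :: "('a, 'm) ring_scheme \<Rightarrow> 'a \<Rightarrow> 'a \<Rightarrow> 'a" where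
  "symm A x y = (x \<otimes>\<^bsub>A\<^esub> y) \<oplus>\<^bsub>A\<^esub> (y \<otimes>\<^bsub>A\<^esub> x)"


section \<open>The Lie algebras \<open>sl\<^sub>n\<close> and \<open>sl\<^sub>n[u]\<close>\<close>

definition sl :: "nat \<Rightarrow> 'a::comm_ring_1 mat set" where
  "sl n = {X \<in> carrier_mat n n. (\<Sum>i<n. X $$ (i, i)) = 0}"

definition mat_bracket :: "'a::comm_ring_1 mat \<Rightarrow> 'a mat \<Rightarrow> 'a mat" where
  "mat_bracket X Y = X * Y - Y * X"

text \<open>
  \<open>sl\<^sub>n[u] = sl\<^sub>n \<otimes> \<complex>[u]\<close> is identified with the trace-zero matrices over \<open>\<complex>[u]\<close>, so
  that \<open>X \<otimes> u\<^sup>k\<close> is the matrix with entries \<open>X\<^sub>i\<^sub>j u\<^sup>k\<close>.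
  As \<open>u\<close> and \<open>v\<close> are only names of the variable, \<open>sl\<^sub>n[v]\<close> is the same Lie algebra.
\<close>

definition loop_elem :: "complex mat \<Rightarrow> nat \<Rightarrow> complex poly mat" where
  "loop_elem X k = map_mat (\<lambda>c. monom c k) X"

abbreviation sl_poly :: "nat \<Rightarrow> complex poly mat set" where
  "sl_poly n \<equiv> sl n"

definition env_relators :: "nat \<Rightarrow> (complex poly mat word \<Rightarrow>\<^sub>0 complex) set" where
  "env_relators n =
    {free_gen (X + Y) - (free_gen X + free_gen Y) | X Y. X \<in> sl_poly n \<and> Y \<in> sl_poly n} \<union>
    {free_gen ([:c:] \<cdot>\<^sub>m X) - Poly_Mapping.single 0 c * free_gen X | c X. X \<in> sl_poly n} \<union>
    {free_gen (mat_bracket X Y) - (free_gen X * free_gen Y - free_gen Y * free_gen X) | X Y.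
       X \<in> sl_poly n \<and> Y \<in> sl_poly n}"

definition env_ideal :: "nat \<Rightarrow> (complex poly mat word \<Rightarrow>\<^sub>0 complex) set" where
  "env_ideal n = Idl\<^bsub>free_algebra (sl_poly n)\<^esub> (env_relators n)"

text \<open>The enveloping algebra of \<open>sl\<^sub>n[u]\<close> and the canonical map of \<open>sl\<^sub>n[u]\<close> into it.\<close>

definition env_sl_poly :: "nat \<Rightarrow> (complex, (complex poly mat word \<Rightarrow>\<^sub>0 complex) set) module" where
  "env_sl_poly n = quot_algebra (free_algebra (sl_poly n)) (env_ideal n)"

definition env_incl :: "nat \<Rightarrow> complex poly mat \<Rightarrow> (complex poly mat word \<Rightarrow>\<^sub>0 complex) set" where
  "env_incl n X = env_ideal n +>\<^bsub>free_algebra (sl_poly n)\<^esub> free_gen X"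


section \<open>Root data; indices of matrices and of the standard basis are 1-based\<close>

definition Emat :: "nat \<Rightarrow> nat \<Rightarrow> nat \<Rightarrow> complex mat" where
  "Emat n i j = mat n n (\<lambda>(r, s). if r + 1 = i \<and> s + 1 = j then 1 else 0)"

definition eps :: "nat \<Rightarrow> nat \<Rightarrow> nat \<Rightarrow> complex vec" where
  "eps n i j = unit_vec n (i - 1) - unit_vec n (j - 1)"

definition cartan :: "nat \<Rightarrow> nat \<Rightarrow> int" where
  "cartan i j = (if i = j then 2 else if i = j + 1 \<or> j = i + 1 then -1 else 0)"

datatype sign = Plus | Minus

fun sgn_val :: "sign \<Rightarrow> complex" where
  "sgn_val Plus = 1"
| "sgn_val Minus = -1"

fun opp :: "sign \<Rightarrow> sign" where
  "opp Plus = Minus"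
| "opp Minus = Plus"

text \<open>\<open>X\<^sub>\<alpha>\<^sup>\<plusminus>\<close> for the positive root \<open>\<alpha> = \<epsilon>\<^sub>i\<^sub>j\<close>, \<open>i < j\<close>.\<close>

fun root_vec :: "nat \<Rightarrow> sign \<Rightarrow> nat \<times> nat \<Rightarrow> complex mat" where
  "root_vec n Plus (i, j) = Emat n i j"
| "root_vec n Minus (i, j) = Emat n j i"

definition pos_roots :: "nat \<Rightarrow> (nat \<times> nat) set" where
  "pos_roots n = {(i, j). 1 \<le> i \<and> i < j \<and> j \<le> n}"

definition simple_vec :: "nat \<Rightarrow> sign \<Rightarrow> nat \<Rightarrow> complex mat" where
  "simple_vec n \<sigma> i = root_vec n \<sigma> (i, i + 1)"

definition coroot :: "nat \<Rightarrow> nat \<Rightarrow> complex mat" where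
  "coroot n i = Emat n i i - Emat n (i + 1) (i + 1)"

text \<open>
  The images of \<open>\<omega>\<^sub>i\<^sup>\<plusminus>\<close> and \<open>\<nu>\<^sub>i\<close> in an algebra \<open>A\<close> under the extension to the enveloping
  algebra of \<open>sl\<^sub>n\<close> of a Lie algebra homomorphism \<open>\<iota>\<close> from \<open>sl\<^sub>n\<close> to \<open>A\<close>.
\<close>

definition omega ::
    "(complex, 'a, 'm) module_scheme \<Rightarrow> (complex mat \<Rightarrow> 'a) \<Rightarrow> nat \<Rightarrow> sign \<Rightarrow> nat \<Rightarrow> 'a" where
  "omega A \<iota> n \<sigma> i =
    (sgn_val \<sigma> / 4) \<odot>\<^bsub>A\<^esub>
      (\<Oplus>\<^bsub>A\<^esub>\<alpha>\<in>pos_roots n.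
        symm A (\<iota> (mat_bracket (simple_vec n \<sigma> i) (root_vec n \<sigma> \<alpha>))) (\<iota> (root_vec n (opp \<sigma>) \<alpha>)))
    \<ominus>\<^bsub>A\<^esub> (1 / 4) \<odot>\<^bsub>A\<^esub> symm A (\<iota> (simple_vec n \<sigma> i)) (\<iota> (coroot n i))"

definition nu ::
    "(complex, 'a, 'm) module_scheme \<Rightarrow> (complex mat \<Rightarrow> 'a) \<Rightarrow> nat \<Rightarrow> nat \<Rightarrow> 'a" where
  "nu A \<iota> n i = commutator A (omega A \<iota> n Plus i) (\<iota> (simple_vec n Minus i))"


section \<open>The deformed double current algebra of \<open>sl\<^sub>n\<close>\<close>

text \<open>The generators \<open>X\<close>, \<open>K(X)\<close>, \<open>Q(X)\<close>, \<open>P(X)\<close> for \<open>X \<in> sl\<^sub>n\<close>.\<close>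

datatype ddca_gen =
    GenX "complex mat" | GenK "complex mat" | GenQ "complex mat" | GenP "complex mat"

definition ddca_gens :: "nat \<Rightarrow> ddca_gen set" where
  "ddca_gens n = GenX ` sl n \<union> GenK ` sl n \<union> GenQ ` sl n \<union> GenP ` sl n"

text \<open>
  The defining relations, for the interpretation \<open>g\<close> of the generators in an algebra \<open>A\<close>.  In the
  last one, the matrix \<open>\<delta>\<^sub>b\<^sub>c E\<^sub>a\<^sub>d + \<delta>\<^sub>a\<^sub>d E\<^sub>c\<^sub>b\<close> lies in \<open>sl\<^sub>n\<close> because \<open>(a, b) \<noteq> (d, c)\<close>.
\<close>

definition ddca_relations ::
    "nat \<Rightarrow> complex \<Rightarrow> complex \<Rightarrow> (complex, 'a, 'm) module_scheme \<Rightarrow> (ddca_gen \<Rightarrow> 'a) \<Rightarrow> bool" where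
  "ddca_relations n lam bet A g \<longleftrightarrow>
    (\<exists>\<phi> \<in> alg_hom (env_sl_poly n) A. \<forall>X \<in> sl n.
       \<phi> (env_incl n (loop_elem X 0)) = g (GenX X) \<and>
       \<phi> (env_incl n (loop_elem X 1)) = g (GenK X)) \<and>
    (\<exists>\<phi> \<in> alg_hom (env_sl_poly n) A. \<forall>X \<in> sl n.
       \<phi> (env_incl n (loop_elem X 0)) = g (GenX X) \<and>
       \<phi> (env_incl n (loop_elem X 1)) = g (GenQ X)) \<and>
    (\<forall>X \<in> sl n. \<forall>Y \<in> sl n. g (GenP (X + Y)) = g (GenP X) \<oplus>\<^bsub>A\<^esub> g (GenP Y)) \<and>
    (\<forall>c. \<forall>X \<in> sl n. g (GenP (c \<cdot>\<^sub>m X)) = c \<odot>\<^bsub>A\<^esub> g (GenP X)) \<and>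
    (\<forall>X \<in> sl n. \<forall>Y \<in> sl n.
       commutator A (g (GenP X)) (g (GenX Y)) = g (GenP (mat_bracket X Y))) \<and>
    (\<forall>a \<in> {1..n}. \<forall>b \<in> {1..n}. \<forall>c \<in> {1..n}. \<forall>d \<in> {1..n}.
       a \<noteq> b \<longrightarrow> c \<noteq> d \<longrightarrow> (a, b) \<noteq> (d, c) \<longrightarrow>
       commutator A (g (GenK (Emat n a b))) (g (GenQ (Emat n c d))) =
         g (GenP (mat_bracket (Emat n a b) (Emat n c d)))
         \<oplus>\<^bsub>A\<^esub> (bet - lam / 2) \<odot>\<^bsub>A\<^esub>
              g (GenX (of_bool (b = c) \<cdot>\<^sub>m Emat n a d + of_bool (a = d) \<cdot>\<^sub>m Emat n c b))
         \<ominus>\<^bsub>A\<^esub> (lam / 4 * (eps n a b \<bullet>c eps n c d)) \<odot>\<^bsub>A\<^esub>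
              symm A (g (GenX (Emat n a b))) (g (GenX (Emat n c d)))
         \<oplus>\<^bsub>A\<^esub> (lam / 4) \<odot>\<^bsub>A\<^esub>
              (\<Oplus>\<^bsub>A\<^esub>p\<in>{(i, j). i \<in> {1..n} \<and> j \<in> {1..n} \<and> i \<noteq> j}.
                 symm A
                   (g (GenX (mat_bracket (Emat n a b) (Emat n (fst p) (snd p)))))
                   (g (GenX (mat_bracket (Emat n (snd p) (fst p)) (Emat n c d))))))"

abbreviation ddca_free :: "nat \<Rightarrow> (complex, ddca_gen word \<Rightarrow>\<^sub>0 complex) module" where
  "ddca_free n \<equiv> free_algebra (ddca_gens n)"

text \<open>
  The smallest two-sided ideal of the free algebra modulo which the relations hold.  The relations
  are stable under intersections of ideals, the existence of the two homomorphisms included: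
  for \<open>n \<ge> 2\<close>, \<open>sl\<^sub>n[u]\<close> is generated by \<open>sl\<^sub>n\<close> and \<open>sl\<^sub>n \<otimes> u\<close>, so that these homomorphisms are unique
  and have image in the subalgebra generated by the \<open>X\<close> and \<open>K(X)\<close> (or \<open>Q(X)\<close>).
\<close>

definition ddca_ideal :: "nat \<Rightarrow> complex \<Rightarrow> complex \<Rightarrow> (ddca_gen word \<Rightarrow>\<^sub>0 complex) set" where
  "ddca_ideal n lam bet =
    \<Inter>{I. ideal I (ddca_free n) \<and>
         ddca_relations n lam bet (quot_algebra (ddca_free n) I)
           (\<lambda>x. I +>\<^bsub>ddca_free n\<^esub> free_gen x)}"

definition ddca ::
    "nat \<Rightarrow> complex \<Rightarrow> complex \<Rightarrow> (complex, (ddca_gen word \<Rightarrow>\<^sub>0 complex) set) module" where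
  "ddca n lam bet = quot_algebra (ddca_free n) (ddca_ideal n lam bet)"

definition ddca_elem ::
    "nat \<Rightarrow> complex \<Rightarrow> complex \<Rightarrow> ddca_gen \<Rightarrow> (ddca_gen word \<Rightarrow>\<^sub>0 complex) set" where
  "ddca_elem n lam bet x = ddca_ideal n lam bet +>\<^bsub>ddca_free n\<^esub> free_gen x"

end

theory Submission
  imports Defs
begin

text \<open>
  The argument is a computation with brackets.  Write \<open>E\<^sub>a\<^sub>b\<close>, \<open>K\<^sub>a\<^sub>b\<close>, \<open>Q\<^sub>a\<^sub>b\<close>, \<open>P\<^sub>a\<^sub>b\<close> for
  the images of the matrix units made traceless, and put
  \<open>G\<^sub>a\<^sub>b = P\<^sub>a\<^sub>b + (\<beta> - \<lambda>/2) E\<^sub>a\<^sub>b + \<lambda>/4 \<Sum>\<^sub>j S(E\<^sub>a\<^sub>j, E\<^sub>j\<^sub>b)\<close>.  The elements \<open>G\<close> transform under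
  \<open>sl\<^sub>n\<close> like matrix units, and the defining relation between \<open>K\<close> and \<open>Q\<close> collapses to
  \<open>[K\<^sub>a\<^sub>b, Q\<^sub>c\<^sub>d] = \<delta>\<^sub>b\<^sub>c G\<^sub>a\<^sub>d - \<lambda> E\<^sub>a\<^sub>d E\<^sub>c\<^sub>b\<close> for \<open>a \<noteq> b\<close>,
  \<open>c \<noteq> d\<close>, \<open>a \<noteq> d\<close> (lemma \<open>K_Q\<close>).  Expanding one \<open>G\<close> as such
  a bracket through an auxiliary index gives first \<open>[Q, G]\<close> and \<open>[K, G]\<close> and then, for
  distinct indices, the commutation relation of the second-level generators in the RTT
  presentation of the Yangian of \<open>gl\<^sub>n\<close>: \<open>[G\<^sub>a\<^sub>b, G\<^sub>c\<^sub>d] = \<lambda> (E\<^sub>c\<^sub>b G\<^sub>a\<^sub>d - E\<^sub>a\<^sub>d G\<^sub>c\<^sub>b)\<close> (lemma \<open>G_G\<close>).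
  Four indices are needed here, which is where \<open>n \<ge> 4\<close> enters.

  Bracketing this relation with \<open>E\<^sub>b\<^sub>a\<close> and \<open>E\<^sub>d\<^sub>c\<close> carries it to the diagonal elements
  \<open>G\<^sub>a\<^sub>a\<close>.  These need not commute, but differences of the elements
  \<open>\<tau>\<^sub>a = G\<^sub>a\<^sub>a - \<lambda> \<Sum>\<^sub>b\<^sub>>\<^sub>a E\<^sub>b\<^sub>a E\<^sub>a\<^sub>b - \<lambda>/2 E\<^sub>a\<^sub>a\<^sup>2\<close> do (lemma \<open>tau_commute\<close>): the sums being subtracted are, up to
  Cartan terms and a factor, differences of Casimir elements of the chain of subalgebras \<open>gl\<close> on the indices
  \<open>\<ge> a\<close>, hence commute among themselves.  For a simple root \<open>i\<close> the element
  \<open>h\<^sub>i = \<tau>\<^sub>i - \<tau>\<^sub>i\<^sub>+\<^sub>1 - \<gamma>\<^sub>i H\<^sub>i\<close>, with a suitable scalar \<open>\<gamma>\<^sub>i\<close>, satisfies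
  \<open>[h\<^sub>i, X\<^sub>j\<^sub>,\<^sub>0\<^sup>\<plusminus>] = \<plusminus>c\<^sub>i\<^sub>j X\<^sub>j\<^sub>,\<^sub>1\<^sup>\<plusminus>\<close> and \<open>H\<^sub>i\<^sub>,\<^sub>1 = h\<^sub>i + \<lambda>/2 H\<^sub>i\<^sup>2\<close>.  So the \<open>h\<^sub>i\<close> are commuting
  derivations that raise the level, and the relations of total level at most one, as well as
  \<open>[H\<^sub>i\<^sub>,\<^sub>1, H\<^sub>j\<^sub>,\<^sub>1] = 0\<close>, follow by applying them.  The remaining relation
  \<open>[[X\<^sub>i\<^sub>,\<^sub>1\<^sup>+, X\<^sub>i\<^sub>,\<^sub>1\<^sup>-], H\<^sub>i\<^sub>,\<^sub>1] = 0\<close> is then a consequence in rank two: for adjacent \<open>i\<close>, \<open>j\<close> the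
  brackets \<open>u = [h\<^sub>i, H\<^sub>j\<^sub>,\<^sub>2]\<close> and \<open>v = [h\<^sub>j, H\<^sub>i\<^sub>,\<^sub>2]\<close>, where
  \<open>H\<^sub>i\<^sub>,\<^sub>2 = [X\<^sub>i\<^sub>,\<^sub>1\<^sup>+, X\<^sub>i\<^sub>,\<^sub>1\<^sup>-]\<close>, satisfy \<open>- v = 2u\<close> and \<open>- u = 2v\<close>
  (lemma \<open>level_two_exchange\<close>).

  The computation takes place in a type class of complex algebras, where rewriting needs no
  carrier conditions.  The transfer rests on two observations.  The product of all algebra
  structures on a fixed type is an instance of the class, and every algebra embeds into it as a
  factor.  And since the ideal of relations is an intersection, an identity between two
  polynomials in the generators holds in the quotient as soon as it holds modulo every member of
  the intersection; there the two homomorphisms from the enveloping algebra can be used.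
\<close>

section \<open>Complex algebras as a type class\<close>

text \<open>
  The class is one of rings without unit: the algebras below are embedded as factors of a larger
  product, and such an embedding does not preserve the unit.
\<close>

class complex_algebra = ring +
  fixes scaleC :: "complex \<Rightarrow> 'a \<Rightarrow> 'a" (infixr "*\<^sub>C" 75)
  assumes scaleC_add_right: "c *\<^sub>C (x + y) = c *\<^sub>C x + c *\<^sub>C y"
    and scaleC_add_left: "(c + d) *\<^sub>C x = c *\<^sub>C x + d *\<^sub>C x"
    and scaleC_scaleC [simp]: "c *\<^sub>C d *\<^sub>C x = (c * d) *\<^sub>C x"
    and scaleC_one [simp]: "1 *\<^sub>C x = x"
    and mult_scaleC_left [simp]: "(c *\<^sub>C x) * y = c *\<^sub>C (x * y)"
    and mult_scaleC_right [simp]: "x * (c *\<^sub>C y) = c *\<^sub>C (x * y)"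
begin

lemma scaleC_zero_right [simp]: "c *\<^sub>C 0 = 0"
  using scaleC_add_right[of c 0 0] by simp

lemma scaleC_zero_left [simp]: "0 *\<^sub>C x = 0"
  using scaleC_add_left[of 0 0 x] by simp

lemma scaleC_minus_right [simp]: "c *\<^sub>C (- x) = - (c *\<^sub>C x)"
  using scaleC_add_right[of c x "- x"] by (simp add: eq_neg_iff_add_eq_0 add.commute)

lemma scaleC_minus_left [simp]: "(- c) *\<^sub>C x = - (c *\<^sub>C x)"
  using scaleC_add_left[of c "- c" x] by (simp add: eq_neg_iff_add_eq_0 add.commute)

lemma scaleC_diff_right: "c *\<^sub>C (x - y) = c *\<^sub>C x - c *\<^sub>C y"
  using scaleC_add_right[of c x "- y"] by simp

lemma scaleC_diff_left: "(c - d) *\<^sub>C x = c *\<^sub>C x - d *\<^sub>C x"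
  using scaleC_add_left[of c "- d" x] by simp

lemma scaleC_sum_right: "c *\<^sub>C sum f S = (\<Sum>i\<in>S. c *\<^sub>C f i)"
  by (induction S rule: infinite_finite_induct) (simp_all add: scaleC_add_right)

lemmas scaleC_simps = scaleC_add_right scaleC_add_left scaleC_diff_right scaleC_diff_left

lemma scaleC_2: "2 *\<^sub>C x = x + x"
  using scaleC_add_left[of 1 1 x] by simp

lemma scaleC_cancel: "c \<noteq> 0 \<Longrightarrow> c *\<^sub>C x = c *\<^sub>C y \<longleftrightarrow> x = y"
  by (metis scaleC_scaleC scaleC_one left_inverse)

lemma scaleC_2_cancel: "2 *\<^sub>C x = 2 *\<^sub>C y \<longleftrightarrow> x = y"
  by (simp add: scaleC_cancel)

end

definition lie :: "'a::ring \<Rightarrow> 'a \<Rightarrow> 'a" where "lie x y = x * y - y * x"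

definition acomm :: "'a::ring \<Rightarrow> 'a \<Rightarrow> 'a" where "acomm x y = x * y + y * x"

lemma lie_bilinear [simp]:
  "lie (x + y) z = lie x z + lie y z" "lie x (y + z) = lie x y + lie x z"
  "lie (x - y) z = lie x z - lie y z" "lie x (y - z) = lie x y - lie x z"
  "lie (- x) z = - lie x z" "lie x (- z) = - lie x z"
  "lie 0 x = 0" "lie x 0 = 0" "lie x x = 0"
  by (simp_all add: lie_def algebra_simps)

lemma acomm_bilinear [simp]:
  "acomm (x + y) z = acomm x z + acomm y z" "acomm x (y + z) = acomm x y + acomm x z"
  "acomm (x - y) z = acomm x z - acomm y z" "acomm x (y - z) = acomm x y - acomm x z"
  "acomm (- x) z = - acomm x z" "acomm x (- z) = - acomm x z"
  "acomm 0 x = 0" "acomm x 0 = 0"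
  by (simp_all add: acomm_def algebra_simps)

lemma lie_scaleC [simp]:
  fixes x y :: "'a::complex_algebra"
  shows "lie (c *\<^sub>C x) y = c *\<^sub>C lie x y" "lie x (c *\<^sub>C y) = c *\<^sub>C lie x y"
  by (simp_all add: lie_def scaleC_diff_right)

lemma acomm_scaleC [simp]:
  fixes x y :: "'a::complex_algebra"
  shows "acomm (c *\<^sub>C x) y = c *\<^sub>C acomm x y" "acomm x (c *\<^sub>C y) = c *\<^sub>C acomm x y"
  by (simp_all add: acomm_def scaleC_add_right)

lemma lie_mult: "lie x (y * z) = lie x y * z + y * lie x z" "lie (x * y) z = x * lie y z + lie x z * y"
  by (simp_all add: lie_def algebra_simps)

lemma lie_acomm: "lie x (acomm y z) = acomm (lie x y) z + acomm y (lie x z)"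
    "lie (acomm y z) x = acomm (lie y x) z + acomm y (lie z x)"
  by (simp_all add: lie_def acomm_def algebra_simps)

lemma lie_swap: "lie x y = - lie y x"
  by (simp add: lie_def)

lemma lie_jacobi: "lie x (lie y z) = lie (lie x y) z + lie y (lie x z)"
  by (simp add: lie_def algebra_simps)

lemma lie_sum: "lie (sum f S) x = (\<Sum>i\<in>S. lie (f i) x)" "lie x (sum f S) = (\<Sum>i\<in>S. lie x (f i))"
  by (simp_all add: lie_def sum_distrib_left sum_distrib_right sum_subtractf)

section \<open>Adjacent simple roots and the relation of level two\<close>

text \<open>
  The data at two adjacent simple roots.  Here \<open>x\<close>, \<open>x'\<close> and \<open>y\<close>, \<open>y'\<close> are the raising and
  lowering elements of the two roots at level zero, \<open>x1\<close>, \<open>x1'\<close>, \<open>y1\<close>, \<open>y1'\<close> those at level one,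
  and \<open>h\<close>, \<open>g\<close> are commuting elements whose brackets raise the level.  The configuration is
  symmetric under exchange of the two roots, which halves the final argument.
\<close>

locale adjacent_simple_roots =
  fixes lam :: complex and h g x y x' y' x1 y1 x1' y1' :: "'a::complex_algebra"
  assumes h_g: "lie h g = 0"
    and h_x: "lie h x = 2 *\<^sub>C x1" and g_x: "lie g x = - x1"
    and h_y: "lie h y = - y1" and g_y: "lie g y = 2 *\<^sub>C y1"
    and h_x': "lie h x' = - (2 *\<^sub>C x1')" and g_x': "lie g x' = x1'"
    and h_y': "lie h y' = y1'" and g_y': "lie g y' = - (2 *\<^sub>C y1')"
    and x_y': "lie x y' = 0" and y_x': "lie y x' = 0"
    and weight_k_x: "lie (lie x x') x = 2 *\<^sub>C x" and weight_k_x': "lie (lie x x') x' = - (2 *\<^sub>C x')"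
    and weight_l_y: "lie (lie y y') y = 2 *\<^sub>C y" and weight_l_y': "lie (lie y y') y' = - (2 *\<^sub>C y')"
    and weight_k_y: "lie (lie x x') y = - y" and weight_k_y': "lie (lie x x') y' = y'"
    and weight_l_x: "lie (lie y y') x = - x" and weight_l_x': "lie (lie y y') x' = x'"
    and h_k: "lie h (lie x x') = 0" and g_k: "lie g (lie x x') = 0"
    and h_l: "lie h (lie y y') = 0" and g_l: "lie g (lie y y') = 0"
    and k1: "lie x1 x' = h + (lam / 2) *\<^sub>C (lie x x' * lie x x')"
    and l1: "lie y1 y' = g + (lam / 2) *\<^sub>C (lie y y' * lie y y')"
    and level_one_plus: "lie x1 y - lie x y1 = - ((lam / 2) *\<^sub>C acomm x y)"
    and level_one_minus: "lie x1' y' - lie x' y1' = (lam / 2) *\<^sub>C acomm x' y'"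
begin

lemma swapped: "adjacent_simple_roots lam g h y x y' x' y1 x1 y1' x1'"
proof -
  have "lie y1 x - lie y x1 = lie x1 y - lie x y1" "lie y1' x' - lie y' x1' = lie x1' y' - lie x' y1'"
    by (simp_all add: lie_def)
  moreover have "acomm y x = acomm x y" "acomm y' x' = acomm x' y'"
    by (simp_all add: acomm_def add.commute)
  ultimately show ?thesis
    using level_one_plus level_one_minus h_g h_x g_x h_y g_y h_x' g_x' h_y' g_y' x_y' y_x' weight_k_x weight_k_x' weight_l_y weight_l_y' weight_k_y weight_k_y'
      weight_l_x weight_l_x' h_k g_k h_l g_l k1 l1
    by unfold_locales (simp_all add: lie_swap[of g h])
qed

text \<open>
  Bracketing with an element that commutes with \<open>w\<close> preserves the eigenvalue of \<open>w\<close>; this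
  propagates weights from level zero to all levels.
\<close>

lemma weight_of_lie:
  assumes "lie d w = 0" "lie w z = c *\<^sub>C z" "lie d z = r *\<^sub>C z'" "r \<noteq> 0"
  shows "lie w z' = c *\<^sub>C z'"
proof -
  have "r *\<^sub>C lie w z' = lie w (lie d z)" by (simp add: assms)
  also have "\<dots> = c *\<^sub>C lie d z"
    using assms(1,2) lie_swap[of w d] by (simp add: lie_jacobi[of w])
  finally have "r *\<^sub>C lie w z' = r *\<^sub>C (c *\<^sub>C z')" by (simp add: assms mult.commute)
  thus ?thesis using assms by (subst (asm) scaleC_cancel)
qed

lemma h_g_commute: "lie h (lie g z) = lie g (lie h z)"
  by (simp add: lie_jacobi[of h g] h_g)

definition "x2 = - lie g x1"
definition "y2 = - lie h y1"
definition "x2' = lie g x1'"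
definition "y2' = lie h y1'"

lemma level_two:
  "lie g x1 = - x2" "lie h x1 = 2 *\<^sub>C x2" "lie h y1 = - y2" "lie g y1 = 2 *\<^sub>C y2"
  "lie g x1' = x2'" "lie h x1' = - (2 *\<^sub>C x2')" "lie h y1' = y2'" "lie g y1' = - (2 *\<^sub>C y2')"
proof -
  show "lie g x1 = - x2" "lie h y1 = - y2" "lie g x1' = x2'" "lie h y1' = y2'"
    by (simp_all add: x2_def y2_def x2'_def y2'_def)
  have "- lie h x1 = - (2 *\<^sub>C x2)" using h_g_commute[of x] by (simp add: g_x h_x x2_def)
  thus "lie h x1 = 2 *\<^sub>C x2" by (simp only: neg_equal_iff_equal)
  have "- lie g y1 = - (2 *\<^sub>C y2)" using h_g_commute[of y] by (simp add: g_y h_y y2_def)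
  thus "lie g y1 = 2 *\<^sub>C y2" by (simp only: neg_equal_iff_equal)
  show "lie h x1' = - (2 *\<^sub>C x2')" using h_g_commute[of x'] by (simp add: g_x' h_x' x2'_def)
  show "lie g y1' = - (2 *\<^sub>C y2')" using h_g_commute[of y'] by (simp add: g_y' h_y' y2'_def)
qed

text \<open>
  The Cartan matrix of two adjacent roots is invertible.  Applying both \<open>h\<close> and \<open>g\<close> to an identity
  that pairs the two roots therefore yields two separate identities of one level higher; all
  propagation from level to level rests on this.
\<close>

lemma two_equations:
  fixes a b :: 'a
  assumes "2 *\<^sub>C a + b = 0" "- a = 2 *\<^sub>C b"
  shows "a = 0" "b = 0"
proof -
  have b: "b = - (2 *\<^sub>C a)" using assms(1) by (simp add: eq_neg_iff_add_eq_0 add.commute)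
  have "(4 - 1) *\<^sub>C a = 0" unfolding scaleC_diff_left using assms(2) by (simp add: b)
  hence "3 *\<^sub>C a = 3 *\<^sub>C 0" by simp
  thus "a = 0" by (subst (asm) scaleC_cancel) auto
  thus "b = 0" using b by simp
qed

lemma orthogonal_level_one:
  "lie x1 y' = 0" "lie x y1' = 0" "lie y1 x' = 0" "lie y x1' = 0"
proof -
  have "2 *\<^sub>C lie x1 y' + lie x y1' = 0" "- lie x1 y' = 2 *\<^sub>C lie x y1'"
    using lie_jacobi[of h x y'] lie_jacobi[of g x y'] by (simp_all add: x_y' h_x h_y' g_x g_y')
  thus "lie x1 y' = 0" "lie x y1' = 0" by (rule two_equations)+
  have "2 *\<^sub>C lie y1 x' + lie y x1' = 0" "- lie y1 x' = 2 *\<^sub>C lie y x1'"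
    using lie_jacobi[of g y x'] lie_jacobi[of h y x'] by (simp_all add: y_x' h_y h_x' g_y g_x')
  thus "lie y1 x' = 0" "lie y x1' = 0" by (rule two_equations)+
qed

lemma orthogonal_level_two:
  "lie x1 y1' = 0" "lie y2 x' = 0" "lie y1 x1' = 0"
proof -
  have "2 *\<^sub>C lie x2 y' + lie x1 y1' = 0" "- lie x2 y' = 2 *\<^sub>C lie x1 y1'"
    using lie_jacobi[of h x1 y'] lie_jacobi[of g x1 y'] by (simp_all add: orthogonal_level_one level_two h_y' g_y')
  thus "lie x1 y1' = 0" by (rule two_equations)
  have "2 *\<^sub>C lie y2 x' + lie y1 x1' = 0" "- lie y2 x' = 2 *\<^sub>C lie y1 x1'"
    using lie_jacobi[of g y1 x'] lie_jacobi[of h y1 x'] by (simp_all add: orthogonal_level_one level_two h_x' g_x')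
  thus "lie y2 x' = 0" "lie y1 x1' = 0" by (rule two_equations)+
qed

lemma orthogonal_level_three: "lie y2 x1' = 0"
proof -
  have "2 *\<^sub>C lie y2 x1' + lie y1 x2' = 0" "- lie y2 x1' = 2 *\<^sub>C lie y1 x2'"
    using lie_jacobi[of g y1 x1'] lie_jacobi[of h y1 x1'] by (simp_all add: orthogonal_level_two level_two)
  thus ?thesis by (rule two_equations)
qed

text \<open>
  The relation of level one, raised by one level at the second root.
\<close>

lemma level_one_shifted: "lie x1 y1 - lie x y2 = - ((lam / 2) *\<^sub>C acomm x y1)"
proof -
  define a where "a = lie x2 y - lie x1 y1 + (lam / 2) *\<^sub>C acomm x1 y"
  define b where "b = lie x1 y1 - lie x y2 + (lam / 2) *\<^sub>C acomm x y1"
  have "lie h (lie x1 y - lie x y1 + (lam / 2) *\<^sub>C acomm x y) = 2 *\<^sub>C a - b"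
    by (simp add: a_def b_def lie_jacobi[of h] lie_acomm h_x h_y level_two scaleC_simps)
  moreover have "lie g (lie x1 y - lie x y1 + (lam / 2) *\<^sub>C acomm x y) = 2 *\<^sub>C b - a"
    by (simp add: a_def b_def lie_jacobi[of g] lie_acomm g_x g_y level_two scaleC_simps)
  ultimately have "2 *\<^sub>C a + - b = 0" "- a = 2 *\<^sub>C (- b)"
    using level_one_plus by simp_all
  hence "b = 0" using two_equations(2)[of a "- b"] by simp
  moreover have "lie x1 y1 - lie x y2 = b - (lam / 2) *\<^sub>C acomm x y1"
    by (simp add: b_def)
  ultimately show ?thesis by simp
qed

lemma K_symmetric: "lie x x1' = lie x1 x'"
  using g_k by (simp add: lie_jacobi[of g] g_x g_x')

lemma g_commutes_l1: "lie g (lie y1 y') = 0"  "lie h (lie y1 y') = 0"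
  by (simp_all add: l1 lie_mult g_l h_l h_g)

lemma L_two: "lie y2 y' = lie y1 y1'"
  using g_commutes_l1(2) by (simp add: lie_jacobi[of h] h_y' level_two)

text \<open>
  Bracketing the relation between the two raising elements with a lowering element of the first
  root turns it into a relation for the Cartan elements of that root, because the lowering element
  does not see the second root.
\<close>

lemma contract_plus:
  assumes "lie p q - lie r s = - ((lam / 2) *\<^sub>C acomm r q)" "lie q z = 0" "lie s z = 0"
  shows "lie (lie p z) q = lie (lie r z) s - (lam / 2) *\<^sub>C acomm (lie r z) q"
proof -
  have "lie (lie p q - lie r s) z = lie (lie p z) q - lie (lie r z) s"
    using assms(2,3) lie_jacobi[of z p q] lie_jacobi[of z r s] by (simp add: lie_swap[of _ z])
  moreover have "lie (acomm r q) z = acomm (lie r z) q"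
    using assms(2) by (simp add: lie_acomm)
  ultimately show ?thesis using assms(1) by (simp add: algebra_simps)
qed

lemma contract_minus:
  assumes "lie p q - lie r s = (lam / 2) *\<^sub>C acomm r q" "lie z q = 0" "lie z s = 0"
  shows "lie (lie z p) q = lie (lie z r) s + (lam / 2) *\<^sub>C acomm (lie z r) q"
proof -
  have "lie z (lie p q - lie r s) = lie (lie z p) q - lie (lie z r) s"
    using assms(2,3) by (simp add: lie_jacobi[of z])
  moreover have "lie z (acomm r q) = acomm (lie z r) q"
    using assms(2) by (simp add: lie_acomm)
  ultimately show ?thesis using assms(1) by (simp add: algebra_simps)
qed

text \<open>
  Expand the left side by the Leibniz rule and the contracted relations.  Besides the right side,
  there remain brackets of \<open>y\<^sub>2\<close> with \<open>y\<^sub>1'\<close> and terms linear in \<open>\<lambda>\<close>, which cancel, and terms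
  quadratic in \<open>\<lambda>\<close>, which combine to the bracket of \<open>[y\<^sub>1, y']\<close> with \<open>[x, x']\<close> and vanish because
  \<open>[y\<^sub>1, y']\<close> has weight zero.
\<close>

lemma level_two_exchange: "lie (lie x1 x1') (lie y1 y') = 2 *\<^sub>C lie (lie x1 x') (lie y1 y1')"
proof -
  define \<kappa>0 \<kappa>1 \<kappa>2 where \<kappa>: "\<kappa>0 = lie x x'" "\<kappa>1 = lie x1 x'" "\<kappa>2 = lie x1 x1'"
  define \<mu> where "\<mu> = lam / 2"
  have y1_weight: "lie \<kappa>0 y1 = - y1"
    using weight_of_lie[of h \<kappa>0 y "- 1" "- 1" y1] by (simp add: \<kappa> h_k weight_k_y h_y)
  have y2_weight: "lie \<kappa>0 y2 = - y2"
    using weight_of_lie[of h \<kappa>0 y1 "- 1" "- 1" y2] by (simp add: y1_weight level_two) (simp add: \<kappa> h_k)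
  have y1'_weight: "lie \<kappa>0 y1' = y1'"
    using weight_of_lie[of h \<kappa>0 y' 1 1 y1'] by (simp add: \<kappa> h_k weight_k_y' h_y')
  have "lie \<kappa>0 (lie y1 y') = 0"
    using weight_k_y' by (simp add: lie_jacobi[of \<kappa>0] y1_weight) (simp add: \<kappa>)
  hence l1_weight: "lie (lie y1 y') \<kappa>0 = 0"
    by (simp add: lie_swap[of "lie y1 y'"])
  have a: "lie \<kappa>2 y1 = lie \<kappa>1 y2 - \<mu> *\<^sub>C acomm \<kappa>1 y1"
    using contract_plus[OF level_one_shifted orthogonal_level_two(3) orthogonal_level_three]
    by (simp add: \<kappa> \<mu>_def K_symmetric)
  have b: "lie \<kappa>1 y1 = - y2 - \<mu> *\<^sub>C acomm \<kappa>0 y1"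
    using contract_plus[OF level_one_shifted orthogonal_level_one(3) orthogonal_level_two(2)] y2_weight
    by (simp add: \<kappa> \<mu>_def)
  have c: "lie \<kappa>2 y' = lie \<kappa>1 y1' + \<mu> *\<^sub>C acomm \<kappa>1 y'"
    using contract_minus[OF level_one_minus orthogonal_level_one(1) orthogonal_level_two(1)]
    by (simp add: \<kappa> \<mu>_def)
  have d: "lie \<kappa>1 y' = y1' + \<mu> *\<^sub>C acomm \<kappa>0 y'"
    using contract_minus[OF level_one_minus x_y' orthogonal_level_one(2)] y1'_weight
    by (simp add: \<kappa> \<mu>_def K_symmetric)
  have "lie \<kappa>2 (lie y1 y') = lie (lie \<kappa>1 y2) y' - \<mu> *\<^sub>C lie (acomm \<kappa>1 y1) y'
      + lie y1 (lie \<kappa>1 y1') + \<mu> *\<^sub>C lie y1 (acomm \<kappa>1 y')"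
    by (simp add: lie_jacobi[of \<kappa>2] a c)
  also have "\<dots> = lie \<kappa>1 (lie y2 y') + lie \<kappa>1 (lie y1 y1') - lie y2 (lie \<kappa>1 y')
      - lie (lie \<kappa>1 y1) y1' - \<mu> *\<^sub>C (acomm (lie \<kappa>1 y1) y' + acomm y1 (lie \<kappa>1 y'))"
    by (simp add: lie_def acomm_def algebra_simps scaleC_simps)
  also have "\<dots> = 2 *\<^sub>C lie \<kappa>1 (lie y1 y1') + \<mu> *\<^sub>C (lie (acomm \<kappa>0 y1) y1' - lie y2 (acomm \<kappa>0 y')
      + acomm y2 y' - acomm y1 y1') + (\<mu> * \<mu>) *\<^sub>C (acomm (acomm \<kappa>0 y1) y' - acomm y1 (acomm \<kappa>0 y'))"
    by (simp add: b d L_two scaleC_2 scaleC_simps)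
  also have "lie (acomm \<kappa>0 y1) y1' = acomm y1 y1' + acomm \<kappa>0 (lie y1 y1')"
    by (simp add: lie_acomm y1'_weight) (simp add: acomm_def)
  also have "lie y2 (acomm \<kappa>0 y') = acomm y2 y' + acomm \<kappa>0 (lie y1 y1')"
    using y2_weight by (simp add: lie_acomm lie_swap[of y2 \<kappa>0] L_two)
  also have "acomm (acomm \<kappa>0 y1) y' - acomm y1 (acomm \<kappa>0 y') = - lie (lie y1 y') \<kappa>0"
    by (simp add: lie_def acomm_def algebra_simps)
  finally show ?thesis
    unfolding l1_weight by (simp add: \<kappa>)
qed

text \<open>
  The exchange relation and its mirror image for the other root say that \<open>u = [h, [y\<^sub>1, y\<^sub>1']]\<close> and
  \<open>v = [g, [x\<^sub>1, x\<^sub>1']]\<close> satisfy \<open>- v = 2u\<close> and \<open>- u = 2v\<close>, so both vanish.  As \<open>h\<close> acts on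
  \<open>[x\<^sub>1, x\<^sub>1']\<close> as \<open>- 2 g\<close> does, and \<open>[x\<^sub>1, x']\<close> differs from \<open>h\<close> by an element that commutes with
  \<open>[x\<^sub>1, x\<^sub>1']\<close>, the claim follows.
\<close>

theorem H_commutes_with_level_two: "lie (lie x1 x1') (lie x1 x') = 0"
proof -
  interpret swapped: adjacent_simple_roots lam g h y x y' x' y1 x1 y1' x1'
    by (rule swapped)
  define \<kappa>2 \<mu>2 where "\<kappa>2 = lie x1 x1'" "\<mu>2 = lie y1 y1'"
  \<comment> \<open>The action of \<open>h + 2g\<close> on the first root is trivial.\<close>
  have h_\<kappa>2: "lie h \<kappa>2 = - (2 *\<^sub>C lie g \<kappa>2)"
    by (simp add: \<kappa>2_\<mu>2_def lie_jacobi[of h] lie_jacobi[of g] level_two h_x' g_x' scaleC_simps)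
  have x1_weight: "lie (lie x x') x1 = 2 *\<^sub>C x1" "lie (lie y y') x1 = - x1"
    and x1'_weight: "lie (lie x x') x1' = - (2 *\<^sub>C x1')" "lie (lie y y') x1' = x1'"
    using weight_of_lie[of g "lie x x'" x 2 "- 1" x1] weight_of_lie[of g "lie y y'" x "- 1" "- 1" x1]
      weight_of_lie[of g "lie x x'" x' "- 2" 1 x1'] weight_of_lie[of g "lie y y'" x' 1 1 x1']
    by (simp_all add: g_k g_l weight_k_x weight_k_x' weight_l_x weight_l_x' g_x g_x')
  have y1_weight: "lie (lie x x') y1 = - y1" and y1'_weight: "lie (lie x x') y1' = y1'"
    using weight_of_lie[of h "lie x x'" y "- 1" "- 1" y1] weight_of_lie[of h "lie x x'" y' 1 1 y1']
    by (simp_all add: h_k weight_k_y weight_k_y' h_y h_y')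
  have weight_zero: "lie (lie x x') \<kappa>2 = 0" "lie (lie y y') \<kappa>2 = 0" "lie (lie x x') \<mu>2 = 0"
    by (simp_all add: \<kappa>2_\<mu>2_def lie_jacobi[of "lie x x'"] lie_jacobi[of "lie y y'"]
      x1_weight x1'_weight y1_weight y1'_weight)
  have g_\<kappa>2: "lie g \<kappa>2 = lie (lie y1 y') \<kappa>2" and h_\<mu>2: "lie h \<mu>2 = lie (lie x1 x') \<mu>2"
    by (simp_all add: l1 k1 lie_mult weight_zero)
  have "- lie g \<kappa>2 = 2 *\<^sub>C lie h \<mu>2"
    unfolding g_\<kappa>2 h_\<mu>2 using level_two_exchange by (simp add: \<kappa>2_\<mu>2_def lie_swap[of "lie x1 x1'"])
  moreover have "- lie h \<mu>2 = 2 *\<^sub>C lie g \<kappa>2"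
    unfolding g_\<kappa>2 h_\<mu>2 using swapped.level_two_exchange by (simp add: \<kappa>2_\<mu>2_def lie_swap[of "lie y1 y1'"])
  ultimately have "2 *\<^sub>C lie h \<mu>2 + lie g \<kappa>2 = 0" "- lie h \<mu>2 = 2 *\<^sub>C lie g \<kappa>2"
    by (simp_all flip: eq_neg_iff_add_eq_0)
  hence "lie g \<kappa>2 = 0" by (rule two_equations)
  hence "lie h \<kappa>2 = 0" by (simp add: h_\<kappa>2)
  thus ?thesis
    using weight_zero(1) by (simp add: \<kappa>2_\<mu>2_def k1 lie_mult lie_swap[of "lie x1 x1'"])
qed

end

section \<open>Matrix units in the deformed double current algebra\<close>

text \<open>
  The relations of the deformed double current algebra in terms of traceless matrix units, for an
  arbitrary finite index set with at least four elements.  As \<open>a \<noteq> d\<close> in the last relation, only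
  one of the two Kronecker deltas survives.
\<close>

locale ddca_units =
  fixes I :: "'i set" and lam bet :: complex and E K Q P :: "'i \<Rightarrow> 'i \<Rightarrow> 'a::complex_algebra"
  assumes finite_I: "finite I" and card_I: "4 \<le> card I"
    and E_E: "\<lbrakk>a \<in> I; b \<in> I; c \<in> I; d \<in> I\<rbrakk> \<Longrightarrow>
      lie (E a b) (E c d) = (if b = c then E a d else 0) - (if a = d then E c b else 0)"
    and K_E: "\<lbrakk>a \<in> I; b \<in> I; c \<in> I; d \<in> I\<rbrakk> \<Longrightarrow>
      lie (K a b) (E c d) = (if b = c then K a d else 0) - (if a = d then K c b else 0)"
    and Q_E: "\<lbrakk>a \<in> I; b \<in> I; c \<in> I; d \<in> I\<rbrakk> \<Longrightarrow>
      lie (Q a b) (E c d) = (if b = c then Q a d else 0) - (if a = d then Q c b else 0)"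
    and P_E: "\<lbrakk>a \<in> I; b \<in> I; c \<in> I; d \<in> I\<rbrakk> \<Longrightarrow>
      lie (P a b) (E c d) = (if b = c then P a d else 0) - (if a = d then P c b else 0)"
    and K_K: "\<lbrakk>a \<in> I; b \<in> I; c \<in> I; d \<in> I; b \<noteq> c; a \<noteq> d\<rbrakk> \<Longrightarrow>
      lie (K a b) (K c d) = 0"
    and Q_Q: "\<lbrakk>a \<in> I; b \<in> I; c \<in> I; d \<in> I; b \<noteq> c; a \<noteq> d\<rbrakk> \<Longrightarrow>
      lie (Q a b) (Q c d) = 0"
    and K_Q_relation: "\<lbrakk>a \<in> I; b \<in> I; c \<in> I; d \<in> I; a \<noteq> b; c \<noteq> d; a \<noteq> d\<rbrakk> \<Longrightarrow>
      lie (K a b) (Q c d) = (if b = c then P a d else 0)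
        + (bet - lam / 2) *\<^sub>C (if b = c then E a d else 0)
        - (lam / 4 * (of_bool (a = c) - of_bool (b = c) + of_bool (b = d))) *\<^sub>C acomm (E a b) (E c d)
        + (lam / 4) *\<^sub>C (\<Sum>p\<in>{(i, j). i \<in> I \<and> j \<in> I \<and> i \<noteq> j}.
            acomm ((if b = fst p then E a (snd p) else 0) - (if a = snd p then E (fst p) b else 0))
                 ((if fst p = c then E (snd p) d else 0) - (if snd p = d then E c (fst p) else 0)))"
begin

declare finite_I [simp]

text \<open>
  Twice the symmetrised square of the matrix \<open>(E\<^sub>a\<^sub>b)\<close>; it transforms under brackets with \<open>E\<^sub>c\<^sub>d\<close>
  like a matrix unit.
\<close>

definition quad :: "'i \<Rightarrow> 'i \<Rightarrow> 'a" where
  "quad a b = (\<Sum>j\<in>I. acomm (E a j) (E j b))"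

definition G :: "'i \<Rightarrow> 'i \<Rightarrow> 'a" where
  "G a b = P a b + (bet - lam / 2) *\<^sub>C E a b + (lam / 4) *\<^sub>C quad a b"

lemma E_E_commute:
  "\<lbrakk>a \<in> I; b \<in> I; c \<in> I; d \<in> I; b \<noteq> c; a \<noteq> d\<rbrakk> \<Longrightarrow> E a b * E c d = E c d * E a b"
  using E_E[of a b c d] by (simp add: lie_def)

lemma E_K: "\<lbrakk>a \<in> I; b \<in> I; c \<in> I; d \<in> I\<rbrakk> \<Longrightarrow>
      lie (E a b) (K c d) = (if b = c then K a d else 0) - (if a = d then K c b else 0)"
  using K_E[of c d a b] by (simp add: lie_swap[of "E a b"])

lemma E_Q: "\<lbrakk>a \<in> I; b \<in> I; c \<in> I; d \<in> I\<rbrakk> \<Longrightarrow>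
      lie (E a b) (Q c d) = (if b = c then Q a d else 0) - (if a = d then Q c b else 0)"
  using Q_E[of c d a b] by (simp add: lie_swap[of "E a b"])

lemma quad_E:
  assumes "a \<in> I" "b \<in> I" "c \<in> I" "d \<in> I"
  shows "lie (quad a b) (E c d) = (if b = c then quad a d else 0) - (if a = d then quad c b else 0)"
proof -
  have "lie (quad a b) (E c d) = (\<Sum>j\<in>I. (if j = c then acomm (E a d) (E j b) else 0)
      - (if a = d then acomm (E c j) (E j b) else 0)
      + (if b = c then acomm (E a j) (E j d) else 0) - (if j = d then acomm (E a j) (E c b) else 0))"
    unfolding quad_def lie_sum using assms
    by (intro sum.cong refl) (simp add: lie_acomm E_E)
  also have "\<dots> = (if b = c then quad a d else 0) - (if a = d then quad c b else 0)"
    using assms by (simp add: sum.distrib sum_subtractf sum.delta' sum.delta quad_def)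
  finally show ?thesis .
qed

lemma G_E:
  assumes "a \<in> I" "b \<in> I" "c \<in> I" "d \<in> I"
  shows "lie (G a b) (E c d) = (if b = c then G a d else 0) - (if a = d then G c b else 0)"
  using assms by (simp add: G_def P_E E_E quad_E scaleC_diff_right)

lemma E_G: "\<lbrakk>a \<in> I; b \<in> I; c \<in> I; d \<in> I\<rbrakk> \<Longrightarrow>
      lie (E a b) (G c d) = (if b = c then G a d else 0) - (if a = d then G c b else 0)"
  using G_E[of c d a b] by (simp add: lie_swap[of "E a b"])

text \<open>
  The sum over \<open>i \<noteq> j\<close> is the sum over all pairs, which gives \<open>quad\<close> and a product, minus the
  diagonal terms.  The latter are multiples of \<open>S(E\<^sub>a\<^sub>b, E\<^sub>c\<^sub>d)\<close> and cancel exactly against the term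
  with the inner product of the two roots.
\<close>

lemma K_Q:
  assumes "a \<in> I" "b \<in> I" "c \<in> I" "d \<in> I" "a \<noteq> b" "c \<noteq> d" "a \<noteq> d"
  shows "lie (K a b) (Q c d) = (if b = c then G a d else 0) - lam *\<^sub>C (E a d * E c b)"
proof -
  define t where "t i j = acomm ((if b = i then E a j else 0) - (if a = j then E i b else 0))
                 ((if i = c then E j d else 0) - (if j = d then E c i else 0))" for i j
  have fin: "finite {(i, j). i \<in> I \<and> j \<in> I \<and> i \<noteq> j}"
    by (rule finite_subset[of _ "I \<times> I"]) (auto simp: finite_I)
  have square_split: "I \<times> I = {(i, j). i \<in> I \<and> j \<in> I \<and> i \<noteq> j} \<union> (\<lambda>i. (i, i)) ` I"
    by auto
  have "(\<Sum>p\<in>I \<times> I. t (fst p) (snd p)) =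
      (\<Sum>p\<in>{(i, j). i \<in> I \<and> j \<in> I \<and> i \<noteq> j}. t (fst p) (snd p))
      + (\<Sum>p\<in>(\<lambda>i. (i, i)) ` I. t (fst p) (snd p))"
    unfolding square_split by (rule sum.union_disjoint) (use fin finite_I in auto)
  hence split: "(\<Sum>p\<in>{(i, j). i \<in> I \<and> j \<in> I \<and> i \<noteq> j}. t (fst p) (snd p))
      = (\<Sum>i\<in>I. \<Sum>j\<in>I. t i j) - (\<Sum>i\<in>I. t i i)"
    by (simp add: sum.cartesian_product case_prod_beta sum.reindex inj_on_def)
  \<comment> \<open>The fourth product of Kronecker deltas needs \<open>a = d\<close>.\<close>
  have t_expand: "t i j = (if i = b then (if b = c then acomm (E a j) (E j d) else 0) - (if j = d then acomm (E a d) (E c b) else 0) else 0)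
      - (if j = a then (if i = c then acomm (E c b) (E a d) else 0) else 0)" for i j
    using assms by (cases "i = b"; cases "j = a"; cases "b = c"; cases "j = d"; cases "i = c") (simp_all add: t_def)
  have "(\<Sum>j\<in>I. t i j) = (if i = b then (if b = c then quad a d else 0) - acomm (E a d) (E c b) else 0)
      - (if i = c then acomm (E c b) (E a d) else 0)" for i
    using assms by (cases "i = b"; cases "i = c"; cases "b = c")
      (simp_all add: t_expand sum_subtractf sum_negf sum.delta quad_def)
  hence double: "(\<Sum>i\<in>I. \<Sum>j\<in>I. t i j) = (if b = c then quad a d else 0) - acomm (E a d) (E c b) - acomm (E c b) (E a d)"
    using assms by (simp add: sum_subtractf sum.delta)
  have "t i i = (if i = b then (of_bool (b = c) - of_bool (b = d)) *\<^sub>C acomm (E a b) (E c d) else 0)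
      - (if i = a then of_bool (a = c) *\<^sub>C acomm (E a b) (E c d) else 0)" for i
    using assms by (cases "i = b"; cases "i = a"; cases "b = c"; cases "b = d"; cases "a = c")
      (simp_all add: t_expand scaleC_simps acomm_def add.commute)
  hence diag: "(\<Sum>i\<in>I. t i i) = (of_bool (b = c) - of_bool (b = d) - of_bool (a = c)) *\<^sub>C acomm (E a b) (E c d)"
    using assms by (simp add: sum_subtractf sum.delta scaleC_simps)
  have aa: "acomm (E c b) (E a d) = 2 *\<^sub>C (E a d * E c b)" "acomm (E a d) (E c b) = 2 *\<^sub>C (E a d * E c b)"
    using E_E_commute[of c b a d] assms by (auto simp: acomm_def scaleC_2)
  have total: "(\<Sum>p\<in>{(i, j). i \<in> I \<and> j \<in> I \<and> i \<noteq> j}. t (fst p) (snd p)) =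
      (if b = c then quad a d else 0) - 4 *\<^sub>C (E a d * E c b)
        - (of_bool (b = c) - of_bool (b = d) - of_bool (a = c)) *\<^sub>C acomm (E a b) (E c d)"
    using scaleC_add_left[of 2 2 "E a d * E c b"] by (simp add: split double diag aa)
  have "lie (K a b) (Q c d) = (if b = c then P a d else 0)
        + (bet - lam / 2) *\<^sub>C (if b = c then E a d else 0)
        - (lam / 4 * (of_bool (a = c) - of_bool (b = c) + of_bool (b = d))) *\<^sub>C acomm (E a b) (E c d)
        + (lam / 4) *\<^sub>C (\<Sum>p\<in>{(i, j). i \<in> I \<and> j \<in> I \<and> i \<noteq> j}. t (fst p) (snd p))"
    unfolding t_def by (rule K_Q_relation[OF assms])
  also have "\<dots> = (if b = c then P a d else 0)
        + (bet - lam / 2) *\<^sub>C (if b = c then E a d else 0) + (lam / 4) *\<^sub>C (if b = c then quad a d else 0)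
        - lam *\<^sub>C (E a d * E c b)"
    unfolding total by (cases "b = c"; cases "b = d"; cases "a = c") (use assms in \<open>simp_all add: scaleC_simps\<close>)
  finally show ?thesis by (simp add: G_def)
qed

end

context ddca_units begin

lemma Q_K:
  assumes "a \<in> I" "b \<in> I" "c \<in> I" "d \<in> I" "a \<noteq> b" "c \<noteq> d" "a \<noteq> d"
  shows "lie (Q c d) (K a b) = lam *\<^sub>C (E a d * E c b) - (if b = c then G a d else 0)"
  using K_Q[OF assms] by (simp add: lie_swap[of "Q c d"])

lemma fresh_index:
  assumes "finite S" "card S < 4"
  obtains x where "x \<in> I" "x \<notin> S"
  using assms card_I card_mono[of S I] by force

text \<open>
  Write \<open>G\<^sub>c\<^sub>d\<close> as the bracket of \<open>K\<^sub>c\<^sub>x\<close> and \<open>Q\<^sub>x\<^sub>d\<close> plus a product; then \<open>Q\<^sub>a\<^sub>b\<close> commutes with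
  \<open>Q\<^sub>x\<^sub>d\<close> and its bracket with \<open>K\<^sub>c\<^sub>x\<close> is a product of matrix units.
\<close>

lemma Q_G_fresh:
  assumes "a \<in> I" "b \<in> I" "c \<in> I" "d \<in> I" "x \<in> I"
    and "a \<noteq> b" "a \<noteq> d" "c \<noteq> b" "c \<noteq> d" "x \<noteq> a" "x \<noteq> b" "x \<noteq> c" "x \<noteq> d"
  shows "lie (Q a b) (G c d) = lam *\<^sub>C (E c b * Q a d)"
proof -
  have G: "G c d = lie (K c x) (Q x d) + lam *\<^sub>C (E c d * E x x)"
    using assms by (simp add: K_Q)
  show ?thesis
    unfolding G using assms by (simp add: lie_jacobi[of "Q a b"] Q_Q Q_K lie_mult E_Q Q_E)
qed

text \<open>
  With only four indices available there is no fresh one when \<open>a\<close>, \<open>b\<close>, \<open>c\<close>, \<open>d\<close> are distinct.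
  Using \<open>a\<close> itself as the auxiliary index gives the difference of two brackets.
\<close>

lemma Q_G_swap:
  assumes "a \<in> I" "b \<in> I" "c \<in> I" "d \<in> I" "distinct [a, b, c, d]"
  shows "lie (Q a b) (G c d) - lie (Q a d) (G c b) = lam *\<^sub>C (E c b * Q a d) - lam *\<^sub>C (E c d * Q a b)"
proof -
  have ne: "a \<noteq> b" "a \<noteq> c" "a \<noteq> d" "b \<noteq> c" "b \<noteq> d" "c \<noteq> d"
    using assms(5) by auto
  have G: "G c d = lie (K c a) (Q a d) + lam *\<^sub>C (E c d * E a a)"
    using assms(1-4) ne by (simp add: K_Q)
  have "lie (Q a d) (E c b * E a a) = - (E c b * Q a d)"
    using assms(1-4) ne by (simp add: lie_mult Q_E)
  hence 1: "lie (E c b * E a a) (Q a d) = E c b * Q a d"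
    by (simp add: lie_swap[of "E c b * E a a"])
  have "lie (Q a b) (G c d) = lam *\<^sub>C (E c b * Q a d) - lie (G c b) (Q a d) - lam *\<^sub>C (E c d * Q a b)"
    unfolding G using assms(1-4) ne 1 by (simp add: lie_jacobi[of "Q a b"] Q_Q Q_K) (simp add: lie_mult Q_E)
  thus ?thesis by (simp add: lie_swap[of "G c b"])
qed

text \<open>
  The sum complementary to \<open>Q_G_swap\<close> arises by bracketing a case with a repeated column index,
  where a fresh index exists, with a matrix unit.
\<close>

lemma Q_G_distinct:
  assumes "a \<in> I" "b \<in> I" "c \<in> I" "d \<in> I" "distinct [a, b, c, d]"
  shows "lie (Q a b) (G c d) = lam *\<^sub>C (E c b * Q a d)"
proof -
  have ne: "a \<noteq> b" "a \<noteq> c" "a \<noteq> d" "b \<noteq> c" "b \<noteq> d" "c \<noteq> d"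
    using assms(5) by auto
  obtain y where y: "y \<in> I" "y \<notin> {a, b, c}"
    by (rule fresh_index[of "{a, b, c}"]) (auto simp: card_insert_if)
  have col: "lie (Q a b) (G c b) = lam *\<^sub>C (E c b * Q a b)"
    using assms(1-4) ne y by (intro Q_G_fresh[of _ _ _ _ y]) auto
  have "lie (E b d) (lie (Q a b) (G c b)) = lie (E b d) (lam *\<^sub>C (E c b * Q a b))"
    by (simp only: col)
  hence sum: "lie (Q a d) (G c b) + lie (Q a b) (G c d) = lam *\<^sub>C (E c d * Q a b) + lam *\<^sub>C (E c b * Q a d)"
    using assms(1-4) ne by (simp add: lie_jacobi[of "E b d"] E_Q E_G lie_mult E_E scaleC_add_right scaleC_diff_right)
      (simp add: algebra_simps eq_neg_iff_add_eq_0)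
  have "2 *\<^sub>C lie (Q a b) (G c d) =
      (lie (Q a b) (G c d) - lie (Q a d) (G c b)) + (lie (Q a d) (G c b) + lie (Q a b) (G c d))"
    by (simp add: scaleC_2)
  also have "\<dots> = 2 *\<^sub>C (lam *\<^sub>C (E c b * Q a d))"
    unfolding sum Q_G_swap[OF assms] by (simp only: scaleC_2) (simp add: algebra_simps)
  finally show ?thesis by (simp only: scaleC_2_cancel)
qed

lemma Q_G:
  assumes "a \<in> I" "b \<in> I" "c \<in> I" "d \<in> I" "a \<noteq> b" "a \<noteq> d" "c \<noteq> b" "c \<noteq> d"
  shows "lie (Q a b) (G c d) = lam *\<^sub>C (E c b * Q a d)"
proof (cases "distinct [a, b, c, d]")
  case True
  thus ?thesis using assms by (intro Q_G_distinct)
next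
  case False
  hence "card {a, b, c, d} < 4" using assms by (auto simp: card_insert_if)
  then obtain x where "x \<in> I" "x \<notin> {a, b, c, d}"
    using fresh_index[of "{a, b, c, d}"] by blast
  thus ?thesis using assms by (intro Q_G_fresh[of _ _ _ _ x]) auto
qed

lemma K_G_fresh:
  assumes "a \<in> I" "b \<in> I" "c \<in> I" "d \<in> I" "x \<in> I"
    and "a \<noteq> b" "a \<noteq> d" "c \<noteq> b" "c \<noteq> d" "x \<noteq> a" "x \<noteq> b" "x \<noteq> c" "x \<noteq> d"
  shows "lie (K a b) (G c d) = - (lam *\<^sub>C (E a d * K c b))"
proof -
  have G: "G c d = lie (K c x) (Q x d) + lam *\<^sub>C (E c d * E x x)"
    using assms by (simp add: K_Q)
  have "lie (K a b) (G c d) = lie (K c x) (lie (K a b) (Q x d))"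
    unfolding G using assms by (simp add: lie_jacobi[of "K a b"] K_K) (simp add: lie_mult K_E)
  also have "lie (K a b) (Q x d) = - (lam *\<^sub>C (E a d * E x b))"
    using assms by (simp add: K_Q)
  finally show ?thesis
    using assms by (simp add: lie_mult K_E)
qed

text \<open>
  The auxiliary index is now \<open>b\<close>, the column of \<open>K\<close>.
\<close>

lemma K_G_swap:
  assumes "a \<in> I" "b \<in> I" "c \<in> I" "d \<in> I" "distinct [a, b, c, d]"
  shows "lie (K a b) (G c d) - lie (K c b) (G a d) = lam *\<^sub>C (E c d * K a b) - lam *\<^sub>C (E a d * K c b)"
proof -
  have ne: "a \<noteq> b" "a \<noteq> c" "a \<noteq> d" "b \<noteq> c" "b \<noteq> d" "c \<noteq> d"
    using assms(5) by auto
  have G: "G c d = lie (K c b) (Q b d) + lam *\<^sub>C (E c d * E b b)"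
    using assms(1-4) ne by (simp add: K_Q)
  have "lie (K a b) (G c d) = lie (K c b) (lie (K a b) (Q b d)) + lam *\<^sub>C (E c d * K a b)"
    unfolding G using assms(1-4) ne by (simp add: lie_jacobi[of "K a b"] K_K) (simp add: lie_mult K_E)
  also have "lie (K a b) (Q b d) = G a d - lam *\<^sub>C (E a d * E b b)"
    using assms(1-4) ne by (simp add: K_Q)
  also have "lie (K c b) (G a d - lam *\<^sub>C (E a d * E b b)) = lie (K c b) (G a d) - lam *\<^sub>C (E a d * K c b)"
    using assms(1-4) ne by (simp add: lie_mult K_E)
  finally show ?thesis by simp
qed

text \<open>
  As for \<open>Q_G_distinct\<close>, but starting from a repeated row index.
\<close>

lemma K_G_distinct:
  assumes "a \<in> I" "b \<in> I" "c \<in> I" "d \<in> I" "distinct [a, b, c, d]"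
  shows "lie (K a b) (G c d) = - (lam *\<^sub>C (E a d * K c b))"
proof -
  have ne: "a \<noteq> b" "a \<noteq> c" "a \<noteq> d" "b \<noteq> c" "b \<noteq> d" "c \<noteq> d"
    using assms(5) by auto
  obtain y where y: "y \<in> I" "y \<notin> {a, b, d}"
    by (rule fresh_index[of "{a, b, d}"]) (auto simp: card_insert_if)
  have row: "lie (K a b) (G a d) = - (lam *\<^sub>C (E a d * K a b))"
    using assms(1-4) ne y by (intro K_G_fresh[of _ _ _ _ y]) auto
  have "lie (E c a) (lie (K a b) (G a d)) = - lie (E c a) (lam *\<^sub>C (E a d * K a b))"
    by (simp only: row lie_bilinear)
  hence sum: "lie (K c b) (G a d) + lie (K a b) (G c d) = - (lam *\<^sub>C (E c d * K a b) + lam *\<^sub>C (E a d * K c b))"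
    using assms(1-4) ne by (simp add: lie_jacobi[of "E c a"] E_K E_G lie_mult E_E scaleC_add_right)
  have "2 *\<^sub>C lie (K a b) (G c d) =
      (lie (K a b) (G c d) - lie (K c b) (G a d)) + (lie (K c b) (G a d) + lie (K a b) (G c d))"
    by (simp add: scaleC_2)
  also have "\<dots> = 2 *\<^sub>C (- (lam *\<^sub>C (E a d * K c b)))"
    unfolding sum K_G_swap[OF assms] by (simp only: scaleC_2) (simp add: algebra_simps)
  finally show ?thesis by (simp only: scaleC_2_cancel)
qed

lemma K_G:
  assumes "a \<in> I" "b \<in> I" "c \<in> I" "d \<in> I" "a \<noteq> b" "a \<noteq> d" "c \<noteq> b" "c \<noteq> d"
  shows "lie (K a b) (G c d) = - (lam *\<^sub>C (E a d * K c b))"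
proof (cases "distinct [a, b, c, d]")
  case True
  thus ?thesis using assms by (intro K_G_distinct)
next
  case False
  hence "card {a, b, c, d} < 4" using assms by (auto simp: card_insert_if)
  then obtain x where "x \<in> I" "x \<notin> {a, b, c, d}"
    using fresh_index[of "{a, b, c, d}"] by blast
  thus ?thesis using assms by (intro K_G_fresh[of _ _ _ _ x]) auto
qed

text \<open>
  Only brackets of \<open>K\<close> and \<open>Q\<close> with \<open>G\<close> for disjoint row and column indices occur, since the
  auxiliary index \<open>d\<close> differs from the other three.
\<close>

lemma G_G_row:
  assumes "a \<in> I" "b \<in> I" "c \<in> I" "a \<noteq> b" "a \<noteq> c" "b \<noteq> c"
  shows "lie (G a b) (G a c) = lam *\<^sub>C (E a b * G a c - E a c * G a b)"
proof -
  obtain d where d: "d \<in> I" "d \<noteq> a" "d \<noteq> b" "d \<noteq> c"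
    by (rule fresh_index[of "{a, b, c}"]) (auto simp: card_insert_if)
  have G: "G a b = lie (K a d) (Q d b) + lam *\<^sub>C (E a b * E d d)"
    using assms d by (simp add: K_Q)
  have "lie (G a b) (G a c) =
      lie (K a d) (lie (Q d b) (G a c)) + lie (lie (K a d) (G a c)) (Q d b)
        + lam *\<^sub>C lie (E a b * E d d) (G a c)"
    unfolding G by (simp add: lie_def algebra_simps scaleC_simps)
  also have "lie (Q d b) (G a c) = lam *\<^sub>C (E a b * Q d c)"
    using assms d by (simp add: Q_G)
  also have "lie (K a d) (G a c) = - (lam *\<^sub>C (E a c * K a d))"
    using assms d by (simp add: K_G)
  also have "lie (K a d) (lam *\<^sub>C (E a b * Q d c)) = lam *\<^sub>C (E a b * (G a c - lam *\<^sub>C (E a c * E d d)))"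
    using assms d by (simp add: lie_mult K_E K_Q)
  also have "lie (- (lam *\<^sub>C (E a c * K a d))) (Q d b) = - (lam *\<^sub>C (E a c * (G a b - lam *\<^sub>C (E a b * E d d))))"
    using assms d by (simp add: lie_mult E_Q K_Q)
  also have "lie (E a b * E d d) (G a c) = 0"
    using assms d by (simp add: lie_mult E_G)
  finally show ?thesis
    using E_E_commute[of a c a b] assms
    by (simp add: algebra_simps scaleC_simps) (simp add: mult.assoc[symmetric])
qed

lemma G_G_column:
  assumes "a \<in> I" "b \<in> I" "c \<in> I" "a \<noteq> b" "a \<noteq> c" "b \<noteq> c"
  shows "lie (G a c) (G b c) = lam *\<^sub>C (E b c * G a c - E a c * G b c)"
proof -
  obtain d where d: "d \<in> I" "d \<noteq> a" "d \<noteq> b" "d \<noteq> c"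
    by (rule fresh_index[of "{a, b, c}"]) (auto simp: card_insert_if)
  have G: "G a c = lie (K a d) (Q d c) + lam *\<^sub>C (E a c * E d d)"
    using assms d by (simp add: K_Q)
  have "lie (G a c) (G b c) =
      lie (K a d) (lie (Q d c) (G b c)) + lie (lie (K a d) (G b c)) (Q d c)
        + lam *\<^sub>C lie (E a c * E d d) (G b c)"
    unfolding G by (simp add: lie_def algebra_simps scaleC_simps)
  also have "lie (Q d c) (G b c) = lam *\<^sub>C (E b c * Q d c)"
    using assms d by (simp add: Q_G)
  also have "lie (K a d) (G b c) = - (lam *\<^sub>C (E a c * K b d))"
    using assms d by (simp add: K_G)
  also have "lie (K a d) (lam *\<^sub>C (E b c * Q d c)) = lam *\<^sub>C (E b c * (G a c - lam *\<^sub>C (E a c * E d d)))"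
    using assms d by (simp add: lie_mult K_E K_Q)
  also have "lie (- (lam *\<^sub>C (E a c * K b d))) (Q d c) = - (lam *\<^sub>C (E a c * (G b c - lam *\<^sub>C (E b c * E d d))))"
    using assms d by (simp add: lie_mult E_Q K_Q)
  also have "lie (E a c * E d d) (G b c) = 0"
    using assms d by (simp add: lie_mult E_G)
  finally show ?thesis
    using E_E_commute[of a c b c] assms
    by (simp add: algebra_simps scaleC_simps) (simp add: mult.assoc[symmetric])
qed

text \<open>
  Moving one index of \<open>G_G_row\<close> and of \<open>G_G_column\<close> by a matrix unit gives two relations that
  contain the wanted bracket together with \<open>[G\<^sub>a\<^sub>d, G\<^sub>c\<^sub>b]\<close>, with opposite signs; the average remains.
\<close>

lemma G_G:
  assumes "a \<in> I" "b \<in> I" "c \<in> I" "d \<in> I" "distinct [a, b, c, d]"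
  shows "lie (G a b) (G c d) = lam *\<^sub>C (E c b * G a d - E a d * G c b)"
proof -
  have ne: "a \<noteq> b" "a \<noteq> c" "a \<noteq> d" "b \<noteq> c" "b \<noteq> d" "c \<noteq> d"
    using assms(5) by auto
  have "lie (E c a) (lie (G a b) (G a d)) = lie (E c a) (lam *\<^sub>C (E a b * G a d - E a d * G a b))"
    using assms(1-4) ne by (simp only: G_G_row not_False_eq_True)
  hence row: "lie (G c b) (G a d) + lie (G a b) (G c d) =
      lam *\<^sub>C (E c b * G a d + E a b * G c d - (E c d * G a b + E a d * G c b))"
    using assms(1-4) ne by (simp add: lie_jacobi[of "E c a"] E_G lie_mult E_E)
  have "lie (lie (G a b) (G c b)) (E b d) = lie (lam *\<^sub>C (E c b * G a b - E a b * G c b)) (E b d)"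
    using assms(1-4) ne by (simp add: G_G_column)
  hence column: "lie (G a d) (G c b) + lie (G a b) (G c d) =
      lam *\<^sub>C (E c d * G a b + E c b * G a d - (E a d * G c b + E a b * G c d))"
    using assms(1-4) ne lie_jacobi[of "E b d" "G a b" "G c b"]
    by (simp add: lie_swap[of _ "E b d"] E_G lie_mult E_E) (simp add: algebra_simps scaleC_simps)
  have "2 *\<^sub>C lie (G a b) (G c d) =
      (lie (G c b) (G a d) + lie (G a b) (G c d)) + (lie (G a d) (G c b) + lie (G a b) (G c d))"
    by (simp add: scaleC_2 lie_swap[of "G c b"])
  also have "\<dots> = 2 *\<^sub>C (lam *\<^sub>C (E c b * G a d - E a d * G c b))"
    unfolding row column by (simp only: scaleC_2 flip: scaleC_add_right) (simp add: algebra_simps)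
  finally show ?thesis by (simp only: scaleC_2_cancel)
qed

end

section \<open>Commuting diagonal elements\<close>

context ddca_units begin

text \<open>
  Up to the factor \<open>\<lambda>\<close>, the bracket of \<open>G\<^sub>a\<^sub>a\<close> and \<open>G\<^sub>b\<^sub>b\<close>, modulo terms that cancel in brackets
  of differences of diagonal elements.
\<close>

definition F :: "'i \<Rightarrow> 'i \<Rightarrow> 'a" where
  "F a b = E b a * G a b - E a b * G b a"

lemma F_swap: "F b a = - F a b"
  by (simp add: F_def)

text \<open>
  Bracketing \<open>G_G\<close> with \<open>E\<^sub>b\<^sub>a\<close> and then with \<open>E\<^sub>d\<^sub>c\<close> turns \<open>G\<^sub>a\<^sub>b\<close> into \<open>G\<^sub>a\<^sub>a - G\<^sub>b\<^sub>b\<close> and \<open>G\<^sub>c\<^sub>d\<close>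
  into \<open>G\<^sub>c\<^sub>c - G\<^sub>d\<^sub>d\<close>.
\<close>

lemma G_diagonal:
  assumes "a \<in> I" "b \<in> I" "c \<in> I" "d \<in> I" "distinct [a, b, c, d]"
  shows "lie (G a a - G b b) (G c c - G d d) = lam *\<^sub>C (F a c - F a d - F b c + F b d)"
proof -
  have ne: "a \<noteq> b" "a \<noteq> c" "a \<noteq> d" "b \<noteq> c" "b \<noteq> d" "c \<noteq> d"
    using assms(5) by auto
  have 1: "lie (lie (G a b) (G c d)) (E b a) = lie (G a a - G b b) (G c d)"
    using assms(1-4) ne lie_jacobi[of "E b a" "G a b" "G c d"]
    by (simp add: lie_swap[of _ "E b a"] E_G)
  have 2: "lie (lie (G a a - G b b) (G c d)) (E d c) = lie (G a a - G b b) (G c c - G d d)"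
    using assms(1-4) ne lie_jacobi[of "E d c" "G a a - G b b" "G c d"]
    by (simp add: lie_swap[of _ "E d c"] E_G del: lie_bilinear(3,4)) (simp add: E_G)
  have "lie (G a a - G b b) (G c c - G d d) =
      lie (lie (lam *\<^sub>C (E c b * G a d - E a d * G c b)) (E b a)) (E d c)"
    using G_G[OF assms] 1 2 by simp
  also have "\<dots> = lam *\<^sub>C (F a c - F a d - F b c + F b d)"
    using assms(1-4) ne by (simp add: lie_mult E_E G_E F_def) (simp add: algebra_simps)
  finally show ?thesis .
qed

end

locale ordered_ddca_units = ddca_units I lam bet E K Q P
  for I :: "'i::linorder set" and lam bet and E K Q P :: "'i \<Rightarrow> 'i \<Rightarrow> 'a::complex_algebra"
begin

text \<open>
  For \<open>j = k = a\<close> this is, up to Cartan elements, half the difference of the quadratic Casimir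
  elements of the general linear algebras on the indices \<open>\<ge> a\<close> and on the indices \<open>> a\<close>.
\<close>

definition tail :: "'i \<Rightarrow> 'i \<Rightarrow> 'i \<Rightarrow> 'a" where
  "tail a j k = (\<Sum>b\<in>{b\<in>I. a < b}. E b k * E j b)"

definition tau :: "'i \<Rightarrow> 'a" where
  "tau a = G a a - lam *\<^sub>C tail a a a - (lam / 2) *\<^sub>C (E a a * E a a)"

text \<open>
  In particular the bracket vanishes for \<open>j, k > a\<close>.
\<close>

lemma tail_E:
  assumes "a \<in> I" "j \<in> I" "k \<in> I"
  shows "lie (tail a a a) (E j k) =
    (of_bool (a < j) - of_bool (a < k)) *\<^sub>C (E j a * E a k)
    + (of_bool (a = j) - of_bool (a = k)) *\<^sub>C tail a j k"
proof -
  have "lie (tail a a a) (E j k) = (\<Sum>b\<in>{b\<in>I. a < b}.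
      (if b = j then E j a * E a k else 0) - (if b = k then E j a * E a k else 0)
      + (of_bool (a = j) - of_bool (a = k)) *\<^sub>C (E b k * E j b))"
    unfolding tail_def lie_sum using assms
    by (intro sum.cong refl) (auto simp: lie_mult E_E scaleC_simps algebra_simps)
  also have "\<dots> = (of_bool (a < j) - of_bool (a < k)) *\<^sub>C (E j a * E a k)
    + (of_bool (a = j) - of_bool (a = k)) *\<^sub>C tail a j k"
    using assms by (simp add: sum.distrib sum_subtractf sum.delta tail_def scaleC_simps scaleC_sum_right)
  finally show ?thesis .
qed

text \<open>
  The second tail only involves matrix units with indices \<open>> a\<close>, with which the first one
  commutes.
\<close>

lemma tail_commute:
  assumes "a \<in> I" "b \<in> I" "a < b"
  shows "lie (tail a a a) (tail b b b) = 0"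
  unfolding tail_def[of b] lie_sum using assms
  by (intro sum.neutral ballI) (auto simp: lie_mult tail_E)

lemma G_tail:
  assumes "a \<in> I" "b \<in> I" "a < b"
  shows "lie (G a a) (tail b b b) = 0"
  unfolding tail_def[of b] lie_sum using assms
  by (intro sum.neutral ballI) (auto simp: lie_mult G_E)

lemma tail_G:
  assumes "a \<in> I" "b \<in> I" "a < b"
  shows "lie (tail a a a) (G b b) = E b a * G a b - G b a * E a b"
proof -
  have "lie (tail a a a) (G b b) = (\<Sum>c\<in>{c\<in>I. a < c}. if c = b then E b a * G a b - G b a * E a b else 0)"
    unfolding tail_def[of a] lie_sum using assms
    by (intro sum.cong refl) (auto simp: lie_mult E_G)
  also have "\<dots> = E b a * G a b - G b a * E a b"
    using assms by (simp add: sum.delta)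
  finally show ?thesis .
qed

text \<open>
  The tail of \<open>a\<close> contributes \<open>F a b\<close>, which will cancel against the bracket of the diagonal
  elements, and a reordering term \<open>G\<^sub>a\<^sub>a - G\<^sub>b\<^sub>b\<close>, which disappears in differences.
\<close>

lemma lie_tau_tau_less:
  assumes "a \<in> I" "b \<in> I" "a < b"
  shows "lie (tau a) (tau b) = lie (G a a) (G b b) - lam *\<^sub>C (F a b + G a a - G b b)"
proof -
  have ne: "a \<noteq> b" using assms by simp
  have "G b a * E a b = E a b * G b a - (G a a - G b b)"
    using E_G[of a b b a] assms ne by (simp add: lie_def algebra_simps)
  hence "lie (tail a a a) (G b b) = F a b + G a a - G b b"
    using assms by (simp add: tail_G F_def)
  moreover have "lie (tail b b b) (E a a) = 0" "lie (tail a a a) (E b b) = 0"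
    using assms ne by (auto simp: tail_E)
  moreover have "lie (E a a) (tail b b b) = 0"
    using calculation(2) lie_swap[of "E a a"] by simp
  ultimately show ?thesis
    using assms ne by (simp add: tau_def tail_commute G_tail lie_mult G_E E_G E_E)
qed

lemma lie_tau_tau:
  assumes "a \<in> I" "b \<in> I" "a \<noteq> b"
  shows "lie (tau a) (tau b) = lie (G a a) (G b b) - lam *\<^sub>C (F a b + G a a - G b b)"
proof (cases "a < b")
  case True
  thus ?thesis using assms by (intro lie_tau_tau_less)
next
  case False
  hence "b < a" using assms(3) by simp
  thus ?thesis
    using lie_tau_tau_less[of b a] assms lie_swap[of "tau a"] lie_swap[of "G a a"]
    by (simp add: F_swap[of a b] scaleC_simps)
qed

lemma tau_commute_distinct:
  assumes "a \<in> I" "b \<in> I" "c \<in> I" "d \<in> I" "distinct [a, b, c, d]"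
  shows "lie (tau a - tau b) (tau c - tau d) = 0"
proof -
  have ne: "a \<noteq> b" "a \<noteq> c" "a \<noteq> d" "b \<noteq> c" "b \<noteq> d" "c \<noteq> d"
    using assms(5) by auto
  have "lie (tau a - tau b) (tau c - tau d) =
      lie (G a a - G b b) (G c c - G d d) - lam *\<^sub>C (F a c - F a d - F b c + F b d)"
    using assms(1-4) ne by (simp add: lie_tau_tau scaleC_simps)
  thus ?thesis by (simp only: G_diagonal[OF assms] diff_self)
qed

text \<open>
  With a fourth index \<open>d\<close>, the bivector \<open>(a - b) \<and> (b - c)\<close> is a combination of the three
  bivectors \<open>(a - b) \<and> (c - d)\<close>, \<open>(a - c) \<and> (b - d)\<close> and \<open>(a - d) \<and> (b - c)\<close>, which are covered by
  the case of distinct indices.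
\<close>

lemma tau_commute_chain:
  assumes "a \<in> I" "b \<in> I" "c \<in> I"
  shows "lie (tau a - tau b) (tau b - tau c) = 0"
proof (cases "distinct [a, b, c]")
  case False
  thus ?thesis by (auto simp: lie_swap[of "tau b"])
next
  case True
  obtain d where d: "d \<in> I" "d \<notin> {a, b, c}"
    by (rule fresh_index[of "{a, b, c}"]) (auto simp: card_insert_if)
  \<comment> \<open>The bivector identity, multiplied by two.\<close>
  have "2 *\<^sub>C lie (tau a - tau b) (tau b - tau c) = lie (tau a - tau c) (tau b - tau d)
      + lie (tau a - tau d) (tau b - tau c) - lie (tau a - tau b) (tau c - tau d)"
    by (simp add: scaleC_2 lie_def algebra_simps)
  also have "\<dots> = 2 *\<^sub>C 0"
    using assms True d by (simp only: tau_commute_distinct distinct.simps) (auto simp: tau_commute_distinct simp del: lie_bilinear)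
  finally show ?thesis by (simp only: scaleC_2_cancel)
qed

lemma tau_commute:
  assumes "a \<in> I" "b \<in> I" "c \<in> I" "d \<in> I"
  shows "lie (tau a - tau b) (tau c - tau d) = 0"
proof -
  have "lie (tau a - tau b) (tau c - tau d) =
      lie (tau a - tau b) (tau b - tau d) - lie (tau a - tau b) (tau b - tau c)"
    by simp
  thus ?thesis using assms by (simp only: tau_commute_chain diff_self)
qed

end

section \<open>Simple roots and the Yangian relations\<close>

lemma sgn_val_square [simp]: "sgn_val \<sigma> * sgn_val \<sigma> = 1"
  by (cases \<sigma>) simp_all

text \<open>
  Every simple root has a neighbour, through which the relation of level two is derived.
\<close>

locale sl_ddca_units = ordered_ddca_units I lam bet E K Q P
  for I :: "nat set" and lam bet and E K Q P :: "nat \<Rightarrow> nat \<Rightarrow> 'a::complex_algebra" +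
  assumes ex_adjacent: "\<lbrakk>i \<in> I; Suc i \<in> I\<rbrakk> \<Longrightarrow> Suc (Suc i) \<in> I \<or> (\<exists>j\<in>I. i = Suc j)"
begin

definition H0 :: "nat \<Rightarrow> 'a" where
  "H0 i = E i i - E (Suc i) (Suc i)"

fun X0 :: "sign \<Rightarrow> nat \<Rightarrow> 'a" where
  "X0 Plus i = E i (Suc i)"
| "X0 Minus i = E (Suc i) i"

text \<open>
  The element \<open>X\<^sub>i\<^sub>,\<^sub>1\<^sup>\<plusminus>\<close> up to a scalar multiple of \<open>X\<^sub>i\<^sub>,\<^sub>0\<^sup>\<plusminus>\<close>.
\<close>

fun Z :: "sign \<Rightarrow> nat \<Rightarrow> 'a" where
  "Z Plus i = G i (Suc i) - lam *\<^sub>C tail (Suc i) i (Suc i) - lam *\<^sub>C (E (Suc i) (Suc i) * E i (Suc i))"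
| "Z Minus i = G (Suc i) i - lam *\<^sub>C tail (Suc i) (Suc i) i - lam *\<^sub>C (E (Suc i) i * E (Suc i) (Suc i))"

text \<open>
  The tails run over the indices above \<open>Suc i\<close> and reordering each summand produces one matrix
  unit; hence the number of these indices enters the scalar.
\<close>

definition offset :: "nat \<Rightarrow> complex" where
  "offset i = bet + lam / 2 * of_nat (card {b \<in> I. Suc i < b})"

definition X1 :: "sign \<Rightarrow> nat \<Rightarrow> 'a" where
  "X1 \<sigma> i = Z \<sigma> i - offset i *\<^sub>C X0 \<sigma> i"

definition Ht :: "nat \<Rightarrow> 'a" where
  "Ht i = tau i - tau (Suc i) - offset i *\<^sub>C H0 i"

text \<open>
  All coefficients are brought to halves of \<open>\<lambda>\<close> so that like terms cancel syntactically.
\<close>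

lemma halves: "lam *\<^sub>C z = (lam / 2) *\<^sub>C z + (lam / 2) *\<^sub>C z"
  by (simp flip: scaleC_add_left)

lemma above_Suc: "Suc i \<in> I \<Longrightarrow> {b \<in> I. i < b} = insert (Suc i) {b \<in> I. Suc i < b}"
  by auto

lemma tail_Suc: "Suc i \<in> I \<Longrightarrow> tail i j k = E (Suc i) k * E j (Suc i) + tail (Suc i) j k"
  by (simp add: tail_def above_Suc)

lemma offset_Suc: "Suc (Suc i) \<in> I \<Longrightarrow> offset i = offset (Suc i) + lam / 2"
  by (simp add: offset_def above_Suc[of "Suc i"] field_simps)

lemma E_diagonal_X0:
  assumes "a \<in> I" "i \<in> I" "Suc i \<in> I"
  shows "lie (E a a) (X0 \<sigma> i) = (sgn_val \<sigma> * (of_bool (a = i) - of_bool (a = Suc i))) *\<^sub>C X0 \<sigma> i"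
  using assms by (cases \<sigma>) (auto simp: E_E)

text \<open>
  The contribution \<open>\<lambda>/2\<close>, of the same sign for both indices, is matched by the dependence of
  \<open>offset\<close> on the simple root.
\<close>

lemma tau_X0:
  assumes "a \<in> I" "i \<in> I" "Suc i \<in> I"
  shows "lie (tau a) (X0 \<sigma> i) =
    sgn_val \<sigma> *\<^sub>C ((of_bool (a = i) - of_bool (a = Suc i)) *\<^sub>C Z \<sigma> i
      + (lam / 2 * (of_bool (a = i) + of_bool (a = Suc i))) *\<^sub>C X0 \<sigma> i)"
proof (cases \<sigma>)
  case Plus
  consider "a = i" | "a = Suc i" | "a \<noteq> i" "a \<noteq> Suc i" by blast
  thus ?thesis
  proof cases
    case 1
    have "E i (Suc i) * E i i = E i i * E i (Suc i) - E i (Suc i)"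
      using E_E[of i i i "Suc i"] assms 1 by (simp add: lie_def algebra_simps)
    thus ?thesis using assms 1 Plus
      by (simp add: tau_def G_E tail_E lie_mult E_E scaleC_simps)
        (simp add: tail_Suc halves algebra_simps scaleC_simps)
  next
    case 2
    have "E i (Suc i) * E (Suc i) (Suc i) = E (Suc i) (Suc i) * E i (Suc i) + E i (Suc i)"
      using E_E[of i "Suc i" "Suc i" "Suc i"] assms 2 by (simp add: lie_def algebra_simps)
    thus ?thesis using assms 2 Plus
      by (simp add: tau_def G_E tail_E lie_mult E_E halves scaleC_simps)
  next
    case 3
    hence "(a < i) = (a < Suc i)" by auto
    thus ?thesis using assms 3 Plus
      by (simp add: tau_def G_E tail_E lie_mult E_E scaleC_simps)
  qed
next
  case Minus
  consider "a = i" | "a = Suc i" | "a \<noteq> i" "a \<noteq> Suc i" by blast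
  thus ?thesis
  proof cases
    case 1
    have "E i i * E (Suc i) i = E (Suc i) i * E i i - E (Suc i) i"
      using E_E[of i i "Suc i" i] assms 1 by (simp add: lie_def algebra_simps)
    thus ?thesis using assms 1 Minus
      by (simp add: tau_def G_E tail_E lie_mult E_E scaleC_simps)
        (simp add: tail_Suc halves algebra_simps scaleC_simps)
  next
    case 2
    have "E (Suc i) (Suc i) * E (Suc i) i = E (Suc i) i * E (Suc i) (Suc i) + E (Suc i) i"
      using E_E[of "Suc i" "Suc i" "Suc i" i] assms 2 by (simp add: lie_def algebra_simps)
    thus ?thesis using assms 2 Minus
      by (simp add: tau_def G_E tail_E lie_mult E_E halves scaleC_simps)
  next
    case 3
    hence "(a < i) = (a < Suc i)" by auto
    thus ?thesis using assms 3 Minus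
      by (simp add: tau_def G_E tail_E lie_mult E_E scaleC_simps)
  qed
qed

lemma H0_X0:
  assumes "i \<in> I" "Suc i \<in> I" "j \<in> I" "Suc j \<in> I"
  shows "lie (H0 i) (X0 \<sigma> j) = (sgn_val \<sigma> * of_int (cartan i j)) *\<^sub>C X0 \<sigma> j"
  using assms by (auto simp: H0_def E_diagonal_X0 cartan_def scaleC_simps[symmetric] algebra_simps)

text \<open>
  The differences \<open>offset i - offset (Suc i) = \<lambda>/2\<close> absorb the last term of \<open>tau_X0\<close> at
  neighbouring roots.
\<close>

lemma Ht_X0:
  assumes "i \<in> I" "Suc i \<in> I" "j \<in> I" "Suc j \<in> I"
  shows "lie (Ht i) (X0 \<sigma> j) = (sgn_val \<sigma> * of_int (cartan i j)) *\<^sub>C X1 \<sigma> j"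
proof -
  consider "i = j" | "j = Suc i" | "i = Suc j" | "i \<noteq> j" "j \<noteq> Suc i" "i \<noteq> Suc j" by blast
  thus ?thesis
  proof cases
    case 1
    have "(sgn_val \<sigma> * 2) *\<^sub>C Z \<sigma> j = sgn_val \<sigma> *\<^sub>C Z \<sigma> j + sgn_val \<sigma> *\<^sub>C Z \<sigma> j"
      by (simp only: mult_2_right scaleC_add_left)
    thus ?thesis using assms 1
      by (simp add: Ht_def tau_X0 H0_X0 X1_def cartan_def scaleC_simps) (simp add: algebra_simps scaleC_simps)
  next
    case 2
    thus ?thesis using assms offset_Suc[of i]
      by (simp add: Ht_def tau_X0 H0_X0 X1_def cartan_def scaleC_simps algebra_simps)
  next
    case 3
    thus ?thesis using assms offset_Suc[of j]
      by (simp add: Ht_def tau_X0 H0_X0 X1_def cartan_def scaleC_simps algebra_simps)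
  next
    case 4
    thus ?thesis using assms
      by (simp add: Ht_def tau_X0 H0_X0 X1_def cartan_def)
  qed
qed

lemma E_diagonal_tau: "\<lbrakk>a \<in> I; b \<in> I\<rbrakk> \<Longrightarrow> lie (E a a) (tau b) = 0"
  using lie_swap[of "E a a" "tail b b b"]
  by (auto simp: tau_def E_G tail_E lie_mult E_E)

lemma E_diagonal_commute: "\<lbrakk>a \<in> I; b \<in> I\<rbrakk> \<Longrightarrow> lie (E a a) (E b b) = 0"
  by (simp add: E_E)

lemma H0_H0: "\<lbrakk>i \<in> I; Suc i \<in> I; j \<in> I; Suc j \<in> I\<rbrakk> \<Longrightarrow> lie (H0 i) (H0 j) = 0"
  by (simp add: H0_def E_diagonal_commute)

lemma H0_tau: "\<lbrakk>i \<in> I; Suc i \<in> I; b \<in> I\<rbrakk> \<Longrightarrow> lie (H0 i) (tau b) = 0"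
  by (simp add: H0_def E_diagonal_tau)

lemma H0_Ht: "\<lbrakk>i \<in> I; Suc i \<in> I; j \<in> I; Suc j \<in> I\<rbrakk> \<Longrightarrow> lie (H0 i) (Ht j) = 0"
  by (simp add: Ht_def H0_tau H0_H0)

lemma Ht_H0: "\<lbrakk>i \<in> I; Suc i \<in> I; j \<in> I; Suc j \<in> I\<rbrakk> \<Longrightarrow> lie (Ht j) (H0 i) = 0"
  using H0_Ht[of i j] by (simp add: lie_swap[of "Ht j"])

lemma Ht_Ht:
  assumes "i \<in> I" "Suc i \<in> I" "j \<in> I" "Suc j \<in> I"
  shows "lie (Ht i) (Ht j) = 0"
proof -
  have "lie (Ht i) (Ht j) = lie (tau i - tau (Suc i)) (tau j - tau (Suc j))
      - offset j *\<^sub>C lie (tau i - tau (Suc i)) (H0 j) - offset i *\<^sub>C lie (H0 i) (Ht j)"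
    by (simp add: Ht_def scaleC_simps del: lie_bilinear(3,4)) (simp add: scaleC_simps mult.commute)
  moreover have "lie (tau i - tau (Suc i)) (H0 j) = 0"
    using assms H0_tau[of j i] H0_tau[of j "Suc i"] by (simp add: lie_swap[of _ "H0 j"] del: lie_bilinear(3))
  ultimately show ?thesis using assms by (simp only: tau_commute H0_Ht) simp
qed

lemma X0_X0_opposite:
  assumes "i \<in> I" "Suc i \<in> I" "j \<in> I" "Suc j \<in> I"
  shows "lie (X0 Plus i) (X0 Minus j) = (if i = j then H0 i else 0)"
  using assms by (auto simp: H0_def E_E)

lemma X0_X0_same:
  assumes "i \<in> I" "Suc i \<in> I" "j \<in> I" "Suc j \<in> I" "j \<noteq> Suc i" "i \<noteq> Suc j"
  shows "lie (X0 \<sigma> i) (X0 \<sigma> j) = 0"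
  using assms by (cases \<sigma>) (auto simp: E_E)

lemma X1_eq:
  assumes "i \<in> I" "Suc i \<in> I"
  shows "X1 \<sigma> i = (sgn_val \<sigma> / 2) *\<^sub>C lie (Ht i) (X0 \<sigma> i)"
  using assms by (simp add: Ht_X0 cartan_def)

definition H1 :: "nat \<Rightarrow> 'a" where
  "H1 i = Ht i + (lam / 2) *\<^sub>C (H0 i * H0 i)"

lemma X1_X0_level_one:
  assumes "i \<in> I" "Suc i \<in> I"
  shows "lie (X1 Plus i) (X0 Minus i) = H1 i"
proof -
  have tail: "lie (tail (Suc i) i (Suc i)) (E (Suc i) i) = tail (Suc i) i i - tail (Suc i) (Suc i) (Suc i)"
  proof -
    have "lie (tail (Suc i) i (Suc i)) (E (Suc i) i) =
        (\<Sum>b\<in>{b\<in>I. Suc i < b}. E b i * E i b - E b (Suc i) * E (Suc i) b)"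
      unfolding tail_def lie_sum using assms
      by (intro sum.cong refl) (auto simp: lie_mult E_E algebra_simps)
    thus ?thesis by (simp add: tail_def sum_subtractf)
  qed
  have c: "E (Suc i) (Suc i) * E i i = E i i * E (Suc i) (Suc i)"
    using assms by (intro E_E_commute) auto
  show ?thesis
    using assms
    by (simp add: X1_def H1_def Ht_def tau_def lie_mult G_E E_E tail H0_def tail_Suc[of i])
      (simp add: c halves algebra_simps scaleC_simps)
qed

lemma cartan_commute: "cartan i j = cartan j i"
  by (auto simp: cartan_def)

text \<open>
  Applying \<open>Ht i\<close> and \<open>Ht j\<close> to the level zero relation shows that each of the two brackets is
  \<open>c\<^sub>i\<^sub>j/2\<close> times the other, and \<open>c\<^sub>i\<^sub>j\<close> is \<open>0\<close> or \<open>-1\<close> for distinct roots.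
\<close>

lemma X1_X0_opposite:
  assumes "i \<in> I" "Suc i \<in> I" "j \<in> I" "Suc j \<in> I"
  shows "lie (X1 Plus i) (X0 Minus j) = (if i = j then H1 i else 0)"
    and "lie (X0 Plus i) (X1 Minus j) = (if i = j then H1 i else 0)"
proof -
  define A B where AB: "A = lie (X1 Plus i) (X0 Minus j)" "B = lie (X0 Plus i) (X1 Minus j)"
  define c :: complex where "c = of_int (cartan i j) / 2"
  have h_zero: "lie (Ht k) (lie (X0 Plus i) (X0 Minus j)) = 0" if "k \<in> I" "Suc k \<in> I" for k
    unfolding X0_X0_opposite[OF assms] using Ht_H0[of i k] that assms by auto
  have "A = (1 / 2) *\<^sub>C lie (lie (Ht i) (X0 Plus i)) (X0 Minus j)"
    using assms by (simp add: AB X1_eq[of i Plus] del: X0.simps)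
  also have "lie (lie (Ht i) (X0 Plus i)) (X0 Minus j) = - lie (X0 Plus i) (lie (Ht i) (X0 Minus j))"
    using h_zero[of i] assms by (simp add: lie_jacobi[of "Ht i"] eq_neg_iff_add_eq_0 del: X0.simps)
  finally have A: "A = c *\<^sub>C B"
    using assms by (simp add: AB c_def Ht_X0 del: X0.simps)
  have "B = - ((1 / 2) *\<^sub>C lie (X0 Plus i) (lie (Ht j) (X0 Minus j)))"
    using assms by (simp add: AB X1_eq[of j Minus] del: X0.simps)
  also have "lie (X0 Plus i) (lie (Ht j) (X0 Minus j)) = - lie (lie (Ht j) (X0 Plus i)) (X0 Minus j)"
    using h_zero[of j] assms by (simp add: lie_jacobi[of "Ht j"] eq_neg_iff_add_eq_0 add.commute del: X0.simps)
  finally have B: "B = c *\<^sub>C A"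
    using assms by (simp add: AB c_def Ht_X0 cartan_commute[of j i] del: X0.simps)
  have "A = (if i = j then H1 i else 0) \<and> B = (if i = j then H1 i else 0)"
  proof (cases "i = j")
    case True
    thus ?thesis using A B X1_X0_level_one[of j] assms by (simp add: AB c_def cartan_def)
  next
    case False
    \<comment> \<open>Here \<open>c\<close> is \<open>0\<close> or \<open>- 1/2\<close>.\<close>
    have "1 *\<^sub>C A = (c * c) *\<^sub>C A" using A B by (metis scaleC_scaleC scaleC_one)
    hence "(1 - c * c) *\<^sub>C A = (1 - c * c) *\<^sub>C 0" by (simp add: scaleC_diff_left)
    moreover have "1 - c * c \<noteq> 0" using False by (auto simp: c_def cartan_def)
    ultimately have "A = 0" by (metis scaleC_cancel)
    thus ?thesis using B False by simp
  qed
  thus "lie (X1 Plus i) (X0 Minus j) = (if i = j then H1 i else 0)"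
    and "lie (X0 Plus i) (X1 Minus j) = (if i = j then H1 i else 0)"
    by (simp_all only: AB)
qed

lemma H0_X1:
  assumes "i \<in> I" "Suc i \<in> I" "j \<in> I" "Suc j \<in> I"
  shows "lie (H0 i) (X1 \<sigma> j) = (sgn_val \<sigma> * of_int (cartan i j)) *\<^sub>C X1 \<sigma> j"
  using assms by (simp add: X1_eq lie_jacobi[of "H0 i"] H0_Ht H0_X0 mult.commute)

lemma H1_X0:
  assumes "i \<in> I" "Suc i \<in> I" "j \<in> I" "Suc j \<in> I"
  shows "lie (H1 i) (X0 \<sigma> j) - lie (H0 i) (X1 \<sigma> j)
    = (sgn_val \<sigma> * (lam * of_int (cartan i j) / 2)) *\<^sub>C acomm (H0 i) (X0 \<sigma> j)"
  using assms by (simp add: H1_def Ht_X0 H0_X1 lie_mult H0_X0 acomm_def scaleC_simps mult.commute mult.left_commute)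

lemma H0_H1: "\<lbrakk>i \<in> I; Suc i \<in> I; j \<in> I; Suc j \<in> I\<rbrakk> \<Longrightarrow> lie (H0 i) (H1 j) = 0"
  by (simp add: H1_def H0_Ht lie_mult H0_H0)

lemma H1_H0: "\<lbrakk>i \<in> I; Suc i \<in> I; j \<in> I; Suc j \<in> I\<rbrakk> \<Longrightarrow> lie (H1 i) (H0 j) = 0"
  by (simp add: H1_def Ht_H0 lie_mult H0_H0)

lemma H1_H1:
  assumes "i \<in> I" "Suc i \<in> I" "j \<in> I" "Suc j \<in> I"
  shows "lie (H1 i) (H1 j) = 0"
  using assms by (simp add: H1_def H0_Ht Ht_H0 Ht_Ht lie_mult H0_H0)

lemma X1_X0_self:
  assumes "i \<in> I" "Suc i \<in> I"
  shows "lie (X1 \<sigma> i) (X0 \<sigma> i) = (sgn_val \<sigma> * lam) *\<^sub>C (X0 \<sigma> i * X0 \<sigma> i)"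
proof -
  have "lie (tail (Suc i) i (Suc i)) (E i (Suc i)) = 0" "lie (tail (Suc i) (Suc i) i) (E (Suc i) i) = 0"
    unfolding tail_def lie_sum using assms
    by (auto intro!: sum.neutral simp: lie_mult E_E)
  thus ?thesis
    using assms by (cases \<sigma>) (simp_all add: X1_def G_E lie_mult E_E)
qed

text \<open>
  The element \<open>\<tau>\<^sub>i\<^sub>+\<^sub>1\<close> acts on both neighbouring root vectors, with opposite signs, so the left
  side can be read off from its action on their bracket, a non-simple root vector.
\<close>

lemma X1_X0_next:
  assumes "i \<in> I" "Suc i \<in> I" "Suc (Suc i) \<in> I"
  shows "lie (X1 \<sigma> i) (X0 \<sigma> (Suc i)) - lie (X0 \<sigma> i) (X1 \<sigma> (Suc i)) =
    - ((sgn_val \<sigma> * (lam / 2)) *\<^sub>C acomm (X0 \<sigma> i) (X0 \<sigma> (Suc i)))"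
proof -
  define s where "s = sgn_val \<sigma>"
  have ss: "s * s = 1" "s * (s * c) = c" for c
    by (simp_all add: s_def flip: mult.assoc)
  define w where "w = lie (X0 \<sigma> i) (X0 \<sigma> (Suc i))"
  have tau_w: "lie (tau (Suc i)) w = (lam / 2) *\<^sub>C (acomm (X0 \<sigma> i) (X0 \<sigma> (Suc i)) + s *\<^sub>C w)"
  proof (cases \<sigma>)
    case Plus
    have "E i (Suc i) * E (Suc i) (Suc (Suc i)) = E (Suc i) (Suc (Suc i)) * E i (Suc i) + E i (Suc (Suc i))"
      using E_E[of i "Suc i" "Suc i" "Suc (Suc i)"] assms by (simp add: lie_def algebra_simps)
    thus ?thesis using assms Plus
      by (simp add: w_def s_def E_E tau_def G_E tail_E lie_mult acomm_def halves scaleC_simps)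
  next
    case Minus
    have "E (Suc (Suc i)) (Suc i) * E (Suc i) i = E (Suc i) i * E (Suc (Suc i)) (Suc i) + E (Suc (Suc i)) i"
      using E_E[of "Suc (Suc i)" "Suc i" "Suc i" i] assms by (simp add: lie_def algebra_simps)
    thus ?thesis using assms Minus
      by (simp add: w_def s_def E_E tau_def G_E tail_E lie_mult acomm_def halves scaleC_simps)
  qed
  have "s *\<^sub>C lie (tau (Suc i)) w =
      lie (X0 \<sigma> i) (Z \<sigma> (Suc i)) - lie (Z \<sigma> i) (X0 \<sigma> (Suc i)) + lam *\<^sub>C w"
    using assms unfolding w_def lie_jacobi[of "tau (Suc i)"]
    by (simp add: tau_X0 s_def[symmetric] ss scaleC_simps halves)
  hence "lie (X1 \<sigma> i) (X0 \<sigma> (Suc i)) - lie (X0 \<sigma> i) (X1 \<sigma> (Suc i)) =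
      lam *\<^sub>C w - s *\<^sub>C lie (tau (Suc i)) w - (lam / 2) *\<^sub>C w"
    using assms by (simp add: X1_def offset_Suc scaleC_simps w_def)
  also have "\<dots> = - ((s * (lam / 2)) *\<^sub>C acomm (X0 \<sigma> i) (X0 \<sigma> (Suc i)))"
    by (simp add: tau_w scaleC_simps ss halves mult.commute mult.left_commute)
  finally show ?thesis by (simp only: s_def)
qed

lemma X1_X0_same:
  assumes "i \<in> I" "Suc i \<in> I" "j \<in> I" "Suc j \<in> I"
  shows "lie (X1 \<sigma> i) (X0 \<sigma> j) - lie (X0 \<sigma> i) (X1 \<sigma> j)
    = (sgn_val \<sigma> * (lam * of_int (cartan i j) / 2)) *\<^sub>C acomm (X0 \<sigma> i) (X0 \<sigma> j)"
proof -
  consider "i = j" | "j = Suc i" | "i = Suc j" | "i \<noteq> j" "j \<noteq> Suc i" "i \<noteq> Suc j" by blast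
  thus ?thesis
  proof cases
    case 1
    thus ?thesis using assms lie_swap[of "X0 \<sigma> j" "X1 \<sigma> j"]
      by (simp add: X1_X0_self cartan_def acomm_def scaleC_simps)
  next
    case 2
    thus ?thesis using assms X1_X0_next[of i \<sigma>] by (simp add: cartan_def)
  next
    case 3
    have "lie (X1 \<sigma> i) (X0 \<sigma> j) - lie (X0 \<sigma> i) (X1 \<sigma> j) = lie (X1 \<sigma> j) (X0 \<sigma> i) - lie (X0 \<sigma> j) (X1 \<sigma> i)"
      by (simp add: lie_def)
    moreover have "acomm (X0 \<sigma> i) (X0 \<sigma> j) = acomm (X0 \<sigma> j) (X0 \<sigma> i)"
      by (simp add: acomm_def add.commute)
    ultimately show ?thesis using assms 3 X1_X0_next[of j \<sigma>] by (simp add: cartan_def)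
  next
    case 4
    have "lie (lie (Ht i) (X0 \<sigma> i)) (X0 \<sigma> j) = 0" "lie (X0 \<sigma> i) (lie (Ht j) (X0 \<sigma> j)) = 0"
      using assms 4 X0_X0_same[of i j \<sigma>] lie_jacobi[of "Ht i" "X0 \<sigma> i" "X0 \<sigma> j"] lie_jacobi[of "Ht j" "X0 \<sigma> i" "X0 \<sigma> j"]
      by (simp_all add: Ht_X0 cartan_def)
    thus ?thesis using assms 4 by (simp add: X1_eq cartan_def)
  qed
qed

lemma serre:
  assumes "i \<in> I" "Suc i \<in> I" "j \<in> I" "Suc j \<in> I" "i \<noteq> j"
  shows "(lie (X0 \<sigma> i) ^^ nat (1 - cartan i j)) (X0 \<sigma> j) = 0"
proof -
  consider "j = Suc i" | "i = Suc j" | "j \<noteq> Suc i" "i \<noteq> Suc j" by blast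
  thus ?thesis
    using assms by cases (cases \<sigma>; simp add: cartan_def numeral_2_eq_2 E_E X0_X0_same)+
qed

lemma level_two_commutes_adjacent:
  assumes "i \<in> I" "Suc i \<in> I" "j \<in> I" "Suc j \<in> I" "i = Suc j \<or> j = Suc i"
  shows "lie (lie (X1 Plus i) (X1 Minus i)) (H1 i) = 0"
proof -
  have c: "cartan i j = - 1" "cartan j i = - 1" "cartan i i = 2" "cartan j j = 2" "i \<noteq> j" "j \<noteq> i"
    using assms(5) by (auto simp: cartan_def)
  interpret adjacent_simple_roots lam "Ht i" "Ht j" "X0 Plus i" "X0 Plus j" "X0 Minus i" "X0 Minus j"
    "X1 Plus i" "X1 Plus j" "X1 Minus i" "X1 Minus j"
    using X1_X0_same[of i j Plus] X1_X0_same[of i j Minus] X0_X0_opposite[of i j] X0_X0_opposite[of j i]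
      X0_X0_opposite[of i i] X0_X0_opposite[of j j] X1_X0_level_one[of i] X1_X0_level_one[of j] assms(1-4)
    by unfold_locales (simp_all add: c Ht_Ht Ht_X0 H0_X0 Ht_H0 H1_def del: X0.simps)
  show ?thesis
    using H_commutes_with_level_two X1_X0_level_one[of i] assms by (simp del: X0.simps)
qed

lemma level_two_commutes:
  assumes "i \<in> I" "Suc i \<in> I"
  shows "lie (lie (X1 Plus i) (X1 Minus i)) (H1 i) = 0"
  using ex_adjacent[OF assms] level_two_commutes_adjacent[of i] assms by blast

end

section \<open>Comparison with the quadratic corrections\<close>

context sl_ddca_units begin

fun omega_units :: "sign \<Rightarrow> nat \<Rightarrow> 'a" where
  "omega_units Plus i = (1 / 4) *\<^sub>C (\<Sum>(a, b)\<in>{(a, b). a \<in> I \<and> b \<in> I \<and> a < b}. acomm (lie (E i (Suc i)) (E a b)) (E b a))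
     - (1 / 4) *\<^sub>C acomm (E i (Suc i)) (H0 i)"
| "omega_units Minus i = (- 1 / 4) *\<^sub>C (\<Sum>(a, b)\<in>{(a, b). a \<in> I \<and> b \<in> I \<and> a < b}. acomm (lie (E (Suc i) i) (E b a)) (E a b))
     - (1 / 4) *\<^sub>C acomm (E (Suc i) i) (H0 i)"

lemma sum_pairs:
  "(\<Sum>(a, b)\<in>{(a, b). a \<in> I \<and> b \<in> I \<and> a < b}. f a b) = (\<Sum>a\<in>I. \<Sum>b\<in>{b\<in>I. a < b}. f a b :: 'a)"
  by (subst sum.Sigma) (auto intro!: sum.cong)

lemma sum_pairs_delta:
  assumes "i \<in> I" "Suc i \<in> I"
  shows "(\<Sum>(a, b)\<in>{(a, b). a \<in> I \<and> b \<in> I \<and> a < b}. (if a = Suc i then f b else 0) - (if b = i then g a else 0))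
    = (\<Sum>b\<in>{b\<in>I. Suc i < b}. f b) - (\<Sum>a\<in>{a\<in>I. a < i}. g a :: 'a)"
proof -
  have "(\<Sum>a\<in>I. \<Sum>b\<in>{b\<in>I. a < b}. if a = Suc i then f b else 0) = (\<Sum>b\<in>{b\<in>I. Suc i < b}. f b)"
    using assms by (subst sum.cong[OF refl, of I _ "\<lambda>a. if a = Suc i then (\<Sum>b\<in>{b\<in>I. Suc i < b}. f b) else 0"]) auto
  moreover have "(\<Sum>a\<in>I. \<Sum>b\<in>{b\<in>I. a < b}. if b = i then g a else 0) = (\<Sum>a\<in>{a\<in>I. a < i}. g a)"
    using assms by (simp add: sum.delta sum.inter_filter)
  ultimately show ?thesis by (simp add: sum_pairs sum_subtractf)
qed

lemma sum_split:
  assumes "i \<in> I" "Suc i \<in> I"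
  shows "(\<Sum>j\<in>I. f j) = (\<Sum>j\<in>{j\<in>I. j < i}. f j) + f i + f (Suc i) + (\<Sum>j\<in>{j\<in>I. Suc i < j}. f j :: 'a)"
proof -
  have "I = {j\<in>I. j < i} \<union> insert i {j\<in>I. i < j}" using assms by auto
  hence "sum f I = sum f ({j\<in>I. j < i} \<union> insert i {j\<in>I. i < j})" by simp
  also have "\<dots> = (\<Sum>j\<in>{j\<in>I. j < i}. f j) + (\<Sum>j\<in>insert i {j\<in>I. i < j}. f j)"
    by (intro sum.union_disjoint) auto
  finally show ?thesis using assms by (simp add: above_Suc[of i] add.assoc)
qed

lemma sum_acomm_tail:
  assumes "i \<in> I" "j \<in> I" "k \<in> I" "j \<le> i" "k \<le> i" "j \<noteq> k"
  shows "(\<Sum>b\<in>{b\<in>I. i < b}. acomm (E j b) (E b k)) =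
    2 *\<^sub>C tail i j k + of_nat (card {b\<in>I. i < b}) *\<^sub>C E j k"
proof -
  have *: "of_nat m *\<^sub>C z = (\<Sum>b\<in>B. z)" if "card B = m" "finite B" for m B and z :: 'a
    using that(2,1) by (induction B arbitrary: m rule: finite_induct) (auto simp: scaleC_simps)
  have "(\<Sum>b\<in>{b\<in>I. i < b}. acomm (E j b) (E b k)) = (\<Sum>b\<in>{b\<in>I. i < b}. 2 *\<^sub>C (E b k * E j b) + E j k)"
  proof (intro sum.cong refl)
    fix b assume "b \<in> {b\<in>I. i < b}"
    hence "E j b * E b k = E b k * E j b + E j k"
      using E_E[of j b b k] assms by (simp add: lie_def algebra_simps)
    thus "acomm (E j b) (E b k) = 2 *\<^sub>C (E b k * E j b) + E j k"
      by (simp add: acomm_def scaleC_2)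
  qed
  thus ?thesis
    by (simp add: sum.distrib tail_def scaleC_sum_right *)
qed

text \<open>
  The bookkeeping common to both signs: \<open>up\<close> and \<open>dn\<close> are the parts of \<open>quad\<close> with summation
  index above and below the simple root, which enter \<open>\<omega>\<close> with opposite signs, so that the part
  below cancels and the part above is doubled.
\<close>

lemma shift_by_omega:
  fixes p g t y z A1 A2 up dn \<omega> :: 'a
  assumes "g = p + (bet - lam / 2) *\<^sub>C y + (lam / 4) *\<^sub>C (dn + A1 + A2 + up)"
    and "\<omega> = (1 / 4) *\<^sub>C (up - dn) - (1 / 4) *\<^sub>C (A1 - A2)"
    and "up = 2 *\<^sub>C t + m *\<^sub>C y" and "A2 = 2 *\<^sub>C z + y"
  shows "p - lam *\<^sub>C \<omega> = g - lam *\<^sub>C t - lam *\<^sub>C z - (bet + lam / 2 * m) *\<^sub>C y"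
proof -
  have half: "(lam / 2) *\<^sub>C w = (lam / 4) *\<^sub>C w + (lam / 4) *\<^sub>C w" for w :: 'a
    by (simp flip: scaleC_add_left)
  have "p - lam *\<^sub>C \<omega> = g - (bet - lam / 2) *\<^sub>C y - (lam / 2) *\<^sub>C up - (lam / 2) *\<^sub>C A2"
    unfolding assms(1,2) half by (simp add: scaleC_simps)
  also have "\<dots> = g - lam *\<^sub>C t - lam *\<^sub>C z - (bet + lam / 2 * m) *\<^sub>C y"
    unfolding assms(3,4) by (simp add: scaleC_simps)
  finally show ?thesis .
qed

theorem P_minus_omega:
  assumes "i \<in> I" "Suc i \<in> I"
  shows "(case \<sigma> of Plus \<Rightarrow> P i (Suc i) | Minus \<Rightarrow> P (Suc i) i) - lam *\<^sub>C omega_units \<sigma> i = X1 \<sigma> i"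
proof (cases \<sigma>)
  case Plus
  define up dn where updn: "up = (\<Sum>j\<in>{j\<in>I. Suc i < j}. acomm (E i j) (E j (Suc i)))"
    "dn = (\<Sum>j\<in>{j\<in>I. j < i}. acomm (E i j) (E j (Suc i)))"
  have "(\<Sum>(a, b)\<in>{(a, b). a \<in> I \<and> b \<in> I \<and> a < b}. acomm (lie (E i (Suc i)) (E a b)) (E b a)) =
      (\<Sum>(a, b)\<in>{(a, b). a \<in> I \<and> b \<in> I \<and> a < b}.
        (if a = Suc i then acomm (E i b) (E b (Suc i)) else 0) - (if b = i then acomm (E i a) (E a (Suc i)) else 0))"
    using assms by (intro sum.cong refl) (auto simp: E_E acomm_def add.commute)
  also have "\<dots> = up - dn" unfolding updn by (rule sum_pairs_delta[OF assms])
  finally have omega: "omega_units Plus i = (1 / 4) *\<^sub>C (up - dn)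
      - (1 / 4) *\<^sub>C (acomm (E i i) (E i (Suc i)) - acomm (E i (Suc i)) (E (Suc i) (Suc i)))"
    by (simp add: H0_def) (simp add: acomm_def add.commute)
  have c: "acomm (E i (Suc i)) (E (Suc i) (Suc i)) = 2 *\<^sub>C (E (Suc i) (Suc i) * E i (Suc i)) + E i (Suc i)"
    using E_E[of i "Suc i" "Suc i" "Suc i"] assms by (simp add: lie_def acomm_def scaleC_2 algebra_simps)
  have quad: "quad i (Suc i) = dn + acomm (E i i) (E i (Suc i)) + acomm (E i (Suc i)) (E (Suc i) (Suc i)) + up"
    using assms unfolding quad_def updn by (rule sum_split)
  have up: "up = 2 *\<^sub>C tail (Suc i) i (Suc i) + of_nat (card {b \<in> I. Suc i < b}) *\<^sub>C E i (Suc i)"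
    unfolding updn using assms by (intro sum_acomm_tail) auto
  show ?thesis
    using shift_by_omega[OF G_def[of i "Suc i", unfolded quad] omega up c] Plus
    by (simp add: X1_def offset_def del: omega_units.simps)
next
  case Minus
  define up dn where updn: "up = (\<Sum>j\<in>{j\<in>I. Suc i < j}. acomm (E (Suc i) j) (E j i))"
    "dn = (\<Sum>j\<in>{j\<in>I. j < i}. acomm (E (Suc i) j) (E j i))"
  have "(\<Sum>(a, b)\<in>{(a, b). a \<in> I \<and> b \<in> I \<and> a < b}. acomm (lie (E (Suc i) i) (E b a)) (E a b)) =
      - (\<Sum>(a, b)\<in>{(a, b). a \<in> I \<and> b \<in> I \<and> a < b}.
        (if a = Suc i then acomm (E (Suc i) b) (E b i) else 0) - (if b = i then acomm (E (Suc i) a) (E a i) else 0))"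
    using assms unfolding sum_negf[symmetric] by (intro sum.cong refl) (auto simp: E_E acomm_def add.commute)
  also have "\<dots> = - (up - dn)" unfolding updn by (subst sum_pairs_delta[OF assms]) simp
  finally have omega: "omega_units Minus i = (1 / 4) *\<^sub>C (up - dn)
      - (1 / 4) *\<^sub>C (acomm (E (Suc i) i) (E i i) - acomm (E (Suc i) (Suc i)) (E (Suc i) i))"
    by (simp add: H0_def) (simp add: acomm_def add.commute scaleC_diff_right)
  have c: "acomm (E (Suc i) (Suc i)) (E (Suc i) i) = 2 *\<^sub>C (E (Suc i) i * E (Suc i) (Suc i)) + E (Suc i) i"
    using E_E[of "Suc i" "Suc i" "Suc i" i] assms by (simp add: lie_def acomm_def scaleC_2 algebra_simps)
  have quad: "quad (Suc i) i = dn + acomm (E (Suc i) i) (E i i) + acomm (E (Suc i) (Suc i)) (E (Suc i) i) + up"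
    using assms unfolding quad_def updn by (rule sum_split)
  have up: "up = 2 *\<^sub>C tail (Suc i) (Suc i) i + of_nat (card {b \<in> I. Suc i < b}) *\<^sub>C E (Suc i) i"
    unfolding updn using assms by (intro sum_acomm_tail) auto
  show ?thesis
    using shift_by_omega[OF G_def[of "Suc i" i, unfolded quad] omega up c] Minus
    by (simp add: X1_def offset_def del: omega_units.simps)
qed

end

section \<open>The product of all complex algebras on a type\<close>

locale complex_algebra_record = ring A for A :: "(complex, 'a) module" (structure) +
  assumes smult_closed [simp, intro]: "x \<in> carrier A \<Longrightarrow> c \<odot> x \<in> carrier A"
    and smult_add_right: "\<lbrakk>x \<in> carrier A; y \<in> carrier A\<rbrakk> \<Longrightarrow> c \<odot> (x \<oplus> y) = c \<odot> x \<oplus> c \<odot> y"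
    and smult_add_left: "x \<in> carrier A \<Longrightarrow> (c + d) \<odot> x = c \<odot> x \<oplus> d \<odot> x"
    and smult_smult: "x \<in> carrier A \<Longrightarrow> c \<odot> (d \<odot> x) = (c * d) \<odot> x"
    and smult_one: "x \<in> carrier A \<Longrightarrow> 1 \<odot> x = x"
    and smult_mult_left: "\<lbrakk>x \<in> carrier A; y \<in> carrier A\<rbrakk> \<Longrightarrow> (c \<odot> x) \<otimes> y = c \<odot> (x \<otimes> y)"
    and smult_mult_right: "\<lbrakk>x \<in> carrier A; y \<in> carrier A\<rbrakk> \<Longrightarrow> x \<otimes> (c \<odot> y) = c \<odot> (x \<otimes> y)"

text \<open>
  The product over all algebra structures on a type is a type that does not depend on any
  parameters, whereas a quotient algebra depends on \<open>n\<close>, \<open>\<lambda>\<close> and \<open>\<beta>\<close>.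
\<close>

typedef 'a algebra_product =
  "{f :: (complex, 'a) module \<Rightarrow> 'a.
     \<forall>A. if complex_algebra_record A then f A \<in> carrier A else f A = undefined}"
proof
  show "(\<lambda>A. if complex_algebra_record A then \<zero>\<^bsub>A\<^esub> else undefined) \<in> {f. \<forall>A.
     if complex_algebra_record A then f A \<in> carrier A else f A = undefined}"
    by (auto intro: ring.ring_simprules complex_algebra_record.axioms)
qed

definition component :: "(complex, 'a) module \<Rightarrow> 'a algebra_product \<Rightarrow> 'a" where
  "component A x = Rep_algebra_product x A"

definition of_components :: "((complex, 'a) module \<Rightarrow> 'a) \<Rightarrow> 'a algebra_product" where
  "of_components f = Abs_algebra_product (\<lambda>A. if complex_algebra_record A then f A else undefined)"

lemma component_carrier [simp]: "complex_algebra_record A \<Longrightarrow> component A x \<in> carrier A"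
  using Rep_algebra_product[of x] by (auto simp: component_def)

lemma component_of_components [simp]:
  assumes "\<And>A. complex_algebra_record A \<Longrightarrow> f A \<in> carrier A" "complex_algebra_record A"
  shows "component A (of_components f) = f A"
  using assms by (simp add: component_def of_components_def Abs_algebra_product_inverse)

lemma algebra_product_eqI:
  assumes "\<And>A. complex_algebra_record A \<Longrightarrow> component A x = component A y"
  shows "x = y"
proof -
  have "Rep_algebra_product x A = Rep_algebra_product y A" for A
    using assms[of A] Rep_algebra_product[of x] Rep_algebra_product[of y]
    by (cases "complex_algebra_record A") (auto simp: component_def)
  thus ?thesis by (simp add: Rep_algebra_product_inject[symmetric] ext)
qed

instantiation algebra_product :: (type) complex_algebra
begin

definition "0 = of_components (\<lambda>A. \<zero>\<^bsub>A\<^esub>)"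
definition "x + y = of_components (\<lambda>A. component A x \<oplus>\<^bsub>A\<^esub> component A y)"
definition "- x = of_components (\<lambda>A. \<ominus>\<^bsub>A\<^esub> component A x)"
definition "x - y = of_components (\<lambda>A. component A x \<ominus>\<^bsub>A\<^esub> component A y)"
definition "x * y = of_components (\<lambda>A. component A x \<otimes>\<^bsub>A\<^esub> component A y)"
definition "c *\<^sub>C x = of_components (\<lambda>A. c \<odot>\<^bsub>A\<^esub> component A x)"

lemma component_operations:
  assumes "complex_algebra_record A"
  shows "component A 0 = \<zero>\<^bsub>A\<^esub>" "component A (x + y) = component A x \<oplus>\<^bsub>A\<^esub> component A y"
    "component A (- x) = \<ominus>\<^bsub>A\<^esub> component A x" "component A (x - y) = component A x \<ominus>\<^bsub>A\<^esub> component A y"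
    "component A (x * y) = component A x \<otimes>\<^bsub>A\<^esub> component A y" "component A (c *\<^sub>C x) = c \<odot>\<^bsub>A\<^esub> component A x"
  unfolding zero_algebra_product_def plus_algebra_product_def uminus_algebra_product_def
    minus_algebra_product_def times_algebra_product_def scaleC_algebra_product_def
  by (rule component_of_components[OF _ assms],
      simp add: ring.ring_simprules complex_algebra_record.axioms complex_algebra_record.smult_closed)+

instance
proof
  fix x y z :: "'a algebra_product" and c d :: complex
  show "x + y + z = x + (y + z)" "x + y = y + x" "0 + x = x" "- x + x = 0" "x - y = x + - y"
    "x * y * z = x * (y * z)" "(x + y) * z = x * z + y * z" "x * (y + z) = x * y + x * z"
    "c *\<^sub>C (x + y) = c *\<^sub>C x + c *\<^sub>C y" "(c + d) *\<^sub>C x = c *\<^sub>C x + d *\<^sub>C x" "c *\<^sub>C d *\<^sub>C x = (c * d) *\<^sub>C x"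
    "1 *\<^sub>C x = x" "(c *\<^sub>C x) * y = c *\<^sub>C (x * y)" "x * (c *\<^sub>C y) = c *\<^sub>C (x * y)"
    by (rule algebra_product_eqI; frule complex_algebra_record.axioms(1);
        simp add: component_operations ring.ring_simprules complex_algebra_record.smult_add_right complex_algebra_record.smult_add_left
          complex_algebra_record.smult_smult complex_algebra_record.smult_one
          complex_algebra_record.smult_mult_left complex_algebra_record.smult_mult_right)+
qed

end

text \<open>
  The inclusion of a factor; zero in the other factors makes it compatible with all operations.
\<close>

definition embed :: "(complex, 'a) module \<Rightarrow> 'a \<Rightarrow> 'a algebra_product" where
  "embed A x = of_components (\<lambda>B. if B = A then x else \<zero>\<^bsub>B\<^esub>)"

context complex_algebra_record
begin

lemma component_embed:
  "\<lbrakk>x \<in> carrier A; complex_algebra_record B\<rbrakk> \<Longrightarrow> component B (embed A x) = (if B = A then x else \<zero>\<^bsub>B\<^esub>)"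
  unfolding embed_def
  by (rule component_of_components) (auto intro: ring.ring_simprules complex_algebra_record.axioms)

lemma smult_zero: "c \<odot> \<zero> = \<zero>"
  using smult_add_right[of \<zero> \<zero> c] by (metis add.l_cancel_one' smult_closed zero_closed r_zero)

lemma embed_operations:
  assumes "x \<in> carrier A" "y \<in> carrier A"
  shows "embed A (x \<oplus> y) = embed A x + embed A y"
    and "embed A (x \<ominus> y) = embed A x - embed A y"
    and "embed A (x \<otimes> y) = embed A x * embed A y"
  using assms
  by (auto intro!: algebra_product_eqI simp: component_operations component_embed ring.ring_simprules
      complex_algebra_record.axioms complex_algebra_record.smult_zero)

lemma embed_smult: "x \<in> carrier A \<Longrightarrow> embed A (c \<odot> x) = c *\<^sub>C embed A x"
  by (auto intro!: algebra_product_eqI simp: component_operations component_embed complex_algebra_record.smult_zero)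

lemma embed_zero: "embed A \<zero> = 0"
  by (auto intro!: algebra_product_eqI simp: component_operations component_embed)

lemma embed_eq_iff:
  assumes "x \<in> carrier A" "y \<in> carrier A"
  shows "embed A x = embed A y \<longleftrightarrow> x = y"
  using component_embed[OF assms(1)] component_embed[OF assms(2)] complex_algebra_record_axioms by metis

lemma embed_finsum:
  assumes "finite S" "f \<in> S \<rightarrow> carrier A"
  shows "embed A (finsum A f S) = (\<Sum>s\<in>S. embed A (f s))"
  using assms by (induction S rule: finite_induct) (simp_all add: embed_zero embed_operations Pi_def)

lemma embed_brackets:
  assumes "x \<in> carrier A" "y \<in> carrier A"
  shows "embed A (commutator A x y) = lie (embed A x) (embed A y)"
    and "embed A (symm A x y) = acomm (embed A x) (embed A y)"
  using assms by (simp_all add: commutator_def symm_def lie_def acomm_def embed_operations)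

lemma bracket_closed [simp, intro]:
  assumes "x \<in> carrier A" "y \<in> carrier A"
  shows "commutator A x y \<in> carrier A" "symm A x y \<in> carrier A"
  using assms by (simp_all add: commutator_def symm_def)

lemma embed_funpow_commutator:
  assumes "x \<in> carrier A" "y \<in> carrier A"
  shows "(commutator A x ^^ k) y \<in> carrier A"
    and "embed A ((commutator A x ^^ k) y) = (lie (embed A x) ^^ k) (embed A y)"
  using assms by (induction k) (simp_all add: embed_brackets)

end

section \<open>Quotients of free algebras\<close>

lemma free_algebra_simps [simp]:
  "monoid.mult (free_algebra G) = (*)" "one (free_algebra G) = 1" "zero (free_algebra G) = 0"
  "add (free_algebra G) = (+)" "smult (free_algebra G) = (\<lambda>c p. Poly_Mapping.single 0 c * p)"
  by (simp_all add: free_algebra_def)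

abbreviation over :: "'g set \<Rightarrow> ('g word \<Rightarrow>\<^sub>0 complex) \<Rightarrow> bool" where
  "over G p \<equiv> p \<in> carrier (free_algebra G)"

lemma over_iff: "over G p \<longleftrightarrow> (\<forall>w \<in> Poly_Mapping.keys p. set (letters w) \<subseteq> G)"
  by (simp add: free_algebra_def)

lemma over_closed [simp]:
  "over G 0" "over G 1" "over G (Poly_Mapping.single 0 c)"
  "over G p \<Longrightarrow> over G q \<Longrightarrow> over G (p + q)" "over G p \<Longrightarrow> over G q \<Longrightarrow> over G (p - q)"
  "over G p \<Longrightarrow> over G (- p)" "over G p \<Longrightarrow> over G q \<Longrightarrow> over G (p * q)"
  "g \<in> G \<Longrightarrow> over G (free_gen g)"
proof -
  show "over G 0" "over G 1" "over G (Poly_Mapping.single 0 c)" "g \<in> G \<Longrightarrow> over G (free_gen g)"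
    by (auto simp: over_iff free_gen_def zero_word_def)
  show "over G p \<Longrightarrow> over G q \<Longrightarrow> over G (p + q)" "over G p \<Longrightarrow> over G q \<Longrightarrow> over G (p - q)" "over G p \<Longrightarrow> over G (- p)"
    using keys_add[of p q] keys_diff[of p q] by (auto simp: over_iff)
  show "over G p \<Longrightarrow> over G q \<Longrightarrow> over G (p * q)"
    using keys_mult[of p q] unfolding over_iff by (fastforce simp: plus_word_def)
qed

lemma scalar_scalar: "Poly_Mapping.single 0 c * (Poly_Mapping.single 0 d * p) = Poly_Mapping.single 0 (c * d) * (p :: 'g word \<Rightarrow>\<^sub>0 complex)"
  by (simp add: mult_single flip: mult.assoc)

text \<open>
  Scalars are concentrated in the empty word.
\<close>

lemma scalar_central: "p * Poly_Mapping.single 0 c = Poly_Mapping.single 0 c * (p :: 'g word \<Rightarrow>\<^sub>0 complex)"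
proof -
  have "p = (\<Sum>k\<in>Poly_Mapping.keys p. Poly_Mapping.single k (poly_mapping.lookup p k))"
    by (intro poly_mapping_eqI) (simp add: lookup_sum lookup_single when_def sum.delta in_keys_iff)
  moreover have "(\<Sum>k\<in>K. Poly_Mapping.single k (f k)) * Poly_Mapping.single 0 c
      = Poly_Mapping.single 0 c * (\<Sum>k\<in>K. Poly_Mapping.single k (f k))" for K and f :: "'g word \<Rightarrow> complex"
    by (simp add: sum_distrib_left sum_distrib_right mult_single mult.commute)
  ultimately show ?thesis by metis
qed

lemma scalar_shift: "p * (Poly_Mapping.single 0 c * q) = Poly_Mapping.single 0 c * (p * (q :: 'g word \<Rightarrow>\<^sub>0 complex))"
  by (metis mult.assoc scalar_central)

lemma free_algebra_ring: "ring (free_algebra G)"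
proof (rule ringI)
  show "abelian_group (free_algebra G)"
  proof (rule abelian_groupI)
    fix p assume "over G p"
    thus "\<exists>q\<in>carrier (free_algebra G). q \<oplus>\<^bsub>free_algebra G\<^esub> p = \<zero>\<^bsub>free_algebra G\<^esub>"
      by (intro bexI[of _ "- p"]) simp_all
  qed (simp_all add: add_ac)
  show "Group.monoid (free_algebra G)"
    by unfold_locales (simp_all add: mult.assoc)
qed (simp_all add: algebra_simps)

lemma quot_algebra_simps [simp]:
  "carrier (quot_algebra A I) = carrier (A Quot I)"
  "monoid.mult (quot_algebra A I) = monoid.mult (A Quot I)" "one (quot_algebra A I) = one (A Quot I)"
  "zero (quot_algebra A I) = zero (A Quot I)" "add (quot_algebra A I) = add (A Quot I)"
  "smult (quot_algebra A I) = (\<lambda>c C. \<Union>x\<in>C. I +>\<^bsub>A\<^esub> (c \<odot>\<^bsub>A\<^esub> x))"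
  by (simp_all add: quot_algebra_def ring.defs module.defs)

lemma ring_of_same_operations:
  assumes "ring R" "carrier S = carrier R" "monoid.mult S = monoid.mult R" "one S = one R"
    "zero S = zero R" "add S = add R"
  shows "ring S"
proof -
  interpret R: ring R by fact
  show ?thesis
  proof (rule ringI)
    show "abelian_group S"
      by (rule abelian_groupI) (use assms R.add.l_inv_ex in \<open>auto simp: R.ring_simprules\<close>)
    show "Group.monoid S"
      by unfold_locales (use assms in \<open>auto simp: R.m_assoc\<close>)
  qed (use assms in \<open>auto simp: R.ring_simprules\<close>)
qed

locale free_quotient = ideal I "free_algebra G" for I :: "('g word \<Rightarrow>\<^sub>0 complex) set" and G
begin

abbreviation "F \<equiv> free_algebra G"
abbreviation "Qt \<equiv> quot_algebra F I"

definition cls :: "('g word \<Rightarrow>\<^sub>0 complex) \<Rightarrow> ('g word \<Rightarrow>\<^sub>0 complex) set" where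
  "cls p = I +>\<^bsub>F\<^esub> p"

lemma cls_closed [simp]: "over G p \<Longrightarrow> cls p \<in> carrier Qt"
  using ring_hom_closed[OF rcos_ring_hom] by (simp add: cls_def)

lemma carrier_cls:
  assumes "C \<in> carrier Qt"
  obtains p where "over G p" "C = cls p"
  using assms by (auto simp: FactRing_def A_RCOSETS_def' cls_def)

lemma cls_add: "over G p \<Longrightarrow> over G q \<Longrightarrow> cls (p + q) = cls p \<oplus>\<^bsub>Qt\<^esub> cls q"
  and cls_mult: "over G p \<Longrightarrow> over G q \<Longrightarrow> cls (p * q) = cls p \<otimes>\<^bsub>Qt\<^esub> cls q"
  using ring_hom_add[OF rcos_ring_hom] ring_hom_mult[OF rcos_ring_hom] by (simp_all add: cls_def)

lemma cls_zero: "cls 0 = \<zero>\<^bsub>Qt\<^esub>"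
  using ring_hom_zero[OF rcos_ring_hom free_algebra_ring quotient_is_ring] by (simp add: cls_def)

text \<open>
  The scalar action on the quotient is a union over representatives, all of which give the same
  coset.
\<close>

lemma cls_smult: "over G p \<Longrightarrow> cls (Poly_Mapping.single 0 c * p) = c \<odot>\<^bsub>Qt\<^esub> cls p"
proof -
  assume p: "over G p"
  have "I +>\<^bsub>F\<^esub> (Poly_Mapping.single 0 c * x) = cls (Poly_Mapping.single 0 c * p)" if "x \<in> cls p" for x
  proof -
    have "over G x" using that p a_r_coset_subset_G[OF a_subset] by (auto simp: cls_def)
    moreover have "cls x = cls p"
      using that p a_repr_independence[OF _ _ a_subgroup] by (auto simp: cls_def)
    ultimately have "cls (Poly_Mapping.single 0 c * x) = cls (Poly_Mapping.single 0 c * p)"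
      using p by (simp add: cls_mult del: quot_algebra_simps)
    thus ?thesis by (simp add: cls_def)
  qed
  moreover have "p \<in> cls p" using p a_rcos_self by (simp add: cls_def)
  ultimately show ?thesis by auto
qed

lemma Qt_ring: "ring Qt"
  by (rule ring_of_same_operations[OF quotient_is_ring]) simp_all

lemma Qt_algebra: "complex_algebra_record Qt"
proof -
  interpret Qt: ring Qt by (rule Qt_ring)
  note hom = cls_add[symmetric] cls_mult[symmetric] cls_smult[symmetric]
  show ?thesis
  proof
    fix c x assume "x \<in> carrier Qt"
    then obtain p where "over G p" "x = cls p" by (rule carrier_cls)
    thus "c \<odot>\<^bsub>Qt\<^esub> x \<in> carrier Qt" "1 \<odot>\<^bsub>Qt\<^esub> x = x"
      "(c + d) \<odot>\<^bsub>Qt\<^esub> x = c \<odot>\<^bsub>Qt\<^esub> x \<oplus>\<^bsub>Qt\<^esub> d \<odot>\<^bsub>Qt\<^esub> x"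
      "c \<odot>\<^bsub>Qt\<^esub> (d \<odot>\<^bsub>Qt\<^esub> x) = (c * d) \<odot>\<^bsub>Qt\<^esub> x" for d
      by (simp_all add: hom scalar_scalar single_add distrib_right del: quot_algebra_simps)
    fix y assume "y \<in> carrier Qt"
    then obtain q where "over G q" "y = cls q" by (rule carrier_cls)
    thus "c \<odot>\<^bsub>Qt\<^esub> (x \<oplus>\<^bsub>Qt\<^esub> y) = c \<odot>\<^bsub>Qt\<^esub> x \<oplus>\<^bsub>Qt\<^esub> c \<odot>\<^bsub>Qt\<^esub> y"
      "(c \<odot>\<^bsub>Qt\<^esub> x) \<otimes>\<^bsub>Qt\<^esub> y = c \<odot>\<^bsub>Qt\<^esub> (x \<otimes>\<^bsub>Qt\<^esub> y)"
      "x \<otimes>\<^bsub>Qt\<^esub> (c \<odot>\<^bsub>Qt\<^esub> y) = c \<odot>\<^bsub>Qt\<^esub> (x \<otimes>\<^bsub>Qt\<^esub> y)"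
      using \<open>over G p\<close> \<open>x = cls p\<close>
      by (simp_all add: hom scalar_shift distrib_left mult.assoc del: quot_algebra_simps)
  qed
qed

sublocale Qt: complex_algebra_record Qt by (rule Qt_algebra)

lemma cls_diff:
  assumes "over G p" "over G q"
  shows "cls (p - q) = cls p \<ominus>\<^bsub>Qt\<^esub> cls q"
proof -
  have "cls (p - q) \<oplus>\<^bsub>Qt\<^esub> cls q = cls p"
    using assms by (simp flip: cls_add del: quot_algebra_simps)
  thus ?thesis using assms
    by (metis Qt.add.inv_solve_right Qt.minus_eq cls_closed over_closed(5))
qed

lemma cls_eq_iff:
  assumes "over G p" "over G q"
  shows "cls p = cls q \<longleftrightarrow> p - q \<in> I"
proof -
  have "p \<ominus>\<^bsub>F\<^esub> q = p - q"
    using assms minus_equality[of "- q" q] by (simp add: minus_eq)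
  thus ?thesis
    using quotient_eq_iff_same_a_r_cos[OF is_ideal, of p q] assms by (simp add: cls_def)
qed

text \<open>
  The image of a polynomial in the type class of complex algebras, via the quotient algebra.
\<close>

definition \<Phi> :: "('g word \<Rightarrow>\<^sub>0 complex) \<Rightarrow> ('g word \<Rightarrow>\<^sub>0 complex) set algebra_product" where
  "\<Phi> p = embed Qt (cls p)"

lemma \<Phi>_operations:
  assumes "over G p" "over G q"
  shows "\<Phi> (p + q) = \<Phi> p + \<Phi> q" "\<Phi> (p - q) = \<Phi> p - \<Phi> q" "\<Phi> (p * q) = \<Phi> p * \<Phi> q"
    "\<Phi> (Poly_Mapping.single 0 c * p) = c *\<^sub>C \<Phi> p"
proof -
  show "\<Phi> (Poly_Mapping.single 0 c * p) = c *\<^sub>C \<Phi> p"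
    using assms by (simp add: \<Phi>_def cls_smult Qt.embed_smult del: quot_algebra_simps)
qed (use assms in \<open>simp_all add: \<Phi>_def cls_add cls_diff cls_mult Qt.embed_operations del: quot_algebra_simps\<close>)

lemma \<Phi>_zero: "\<Phi> 0 = 0"
  using Qt.embed_zero by (simp add: \<Phi>_def cls_zero)

lemma \<Phi>_sum: "finite S \<Longrightarrow> (\<And>s. s \<in> S \<Longrightarrow> over G (f s)) \<Longrightarrow> over G (sum f S) \<and> \<Phi> (sum f S) = (\<Sum>s\<in>S. \<Phi> (f s))"
  by (induction S rule: finite_induct) (simp_all add: \<Phi>_zero \<Phi>_operations)

lemma \<Phi>_eq_iff: "over G p \<Longrightarrow> over G q \<Longrightarrow> \<Phi> p = \<Phi> q \<longleftrightarrow> p - q \<in> I"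
  using Qt.embed_eq_iff by (simp add: \<Phi>_def cls_eq_iff del: quot_algebra_simps)

end

section \<open>Current algebras and their enveloping algebras\<close>

lemma sl_carrier: "X \<in> sl n \<Longrightarrow> X \<in> carrier_mat n n"
  by (simp add: sl_def)

lemma sl_add [simp]: "X \<in> sl n \<Longrightarrow> Y \<in> sl n \<Longrightarrow> X + Y \<in> sl n"
  by (auto simp: sl_def sum.distrib)

lemma sl_smult [simp]: "X \<in> sl n \<Longrightarrow> c \<cdot>\<^sub>m X \<in> sl n"
  by (auto simp: sl_def simp flip: sum_distrib_left)

lemma sl_zero [simp]: "0\<^sub>m n n \<in> sl n"
  by (simp add: sl_def)

lemma index_mat_bracket:
  assumes "X \<in> carrier_mat n n" "Y \<in> carrier_mat n n" "i < n" "j < n"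
  shows "mat_bracket X Y $$ (i, j) = (\<Sum>k<n. X $$ (i, k) * Y $$ (k, j)) - (\<Sum>k<n. Y $$ (i, k) * X $$ (k, j))"
  using assms by (simp add: mat_bracket_def scalar_prod_def lessThan_atLeast0)

lemma mat_bracket_carrier [simp]:
  "X \<in> carrier_mat n n \<Longrightarrow> Y \<in> carrier_mat n n \<Longrightarrow> mat_bracket X Y \<in> carrier_mat n n"
  unfolding mat_bracket_def by (rule minus_carrier_mat) (rule mult_carrier_mat)

lemma mat_bracket_sl:
  assumes "X \<in> carrier_mat n n" "Y \<in> carrier_mat n n"
  shows "mat_bracket X Y \<in> sl n"
proof -
  have "(\<Sum>i<n. mat_bracket X Y $$ (i, i)) =
      (\<Sum>i<n. \<Sum>k<n. X $$ (i, k) * Y $$ (k, i)) - (\<Sum>i<n. \<Sum>k<n. Y $$ (i, k) * X $$ (k, i))"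
    using assms by (simp add: index_mat_bracket sum_subtractf)
  also have "(\<Sum>i<n. \<Sum>k<n. Y $$ (i, k) * X $$ (k, i)) = (\<Sum>i<n. \<Sum>k<n. X $$ (i, k) * Y $$ (k, i))"
    by (subst sum.swap) (simp add: mult.commute)
  finally show ?thesis using assms by (simp add: sl_def)
qed

lemma sl_bracket [simp]: "X \<in> sl n \<Longrightarrow> Y \<in> sl n \<Longrightarrow> mat_bracket X Y \<in> sl n"
  by (intro mat_bracket_sl sl_carrier)

lemma env_relators_subset: "env_relators n \<subseteq> carrier (free_algebra (sl_poly n))"
  unfolding env_relators_def by (auto simp del: mult_single)

lemma env_free_quotient: "free_quotient (env_ideal n) (sl_poly n)"
  unfolding free_quotient_def env_ideal_def
  by (intro ring.genideal_ideal[OF free_algebra_ring] env_relators_subset)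

lemma env_relators_ideal: "env_relators n \<subseteq> env_ideal n"
  unfolding env_ideal_def by (intro ring.genideal_self[OF free_algebra_ring] env_relators_subset)

text \<open>
  The relators of the enveloping algebra make the canonical map a Lie algebra homomorphism, so a
  homomorphism from the enveloping algebra restricts to one from the current algebra.
\<close>

lemma alg_hom_lie_map:
  assumes A: "complex_algebra_record A" and \<phi>: "\<phi> \<in> alg_hom (env_sl_poly n) A"
    and X: "X \<in> sl_poly n" and Y: "Y \<in> sl_poly n"
  defines "\<psi> \<equiv> \<lambda>X. embed A (\<phi> (env_incl n X))"
  shows "\<psi> (X + Y) = \<psi> X + \<psi> Y" "\<psi> ([:c:] \<cdot>\<^sub>m X) = c *\<^sub>C \<psi> X" "\<psi> (mat_bracket X Y) = lie (\<psi> X) (\<psi> Y)"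
proof -
  interpret env: free_quotient "env_ideal n" "sl_poly n" by (rule env_free_quotient)
  interpret A: complex_algebra_record A by (rule A)
  have incl: "env_incl n Z = env.cls (free_gen Z)" for Z
    by (simp add: env_incl_def env.cls_def)
  have hom: "\<phi> \<in> Ring.ring_hom env.Qt A" and smult: "\<And>c x. x \<in> carrier env.Qt \<Longrightarrow> \<phi> (c \<odot>\<^bsub>env.Qt\<^esub> x) = c \<odot>\<^bsub>A\<^esub> \<phi> x"
    using \<phi> by (auto simp: alg_hom_def env_sl_poly_def)
  note hom_rules = ring_hom_add[OF hom] ring_hom_mult[OF hom] ring_hom_closed[OF hom] smult
  have minus: "\<phi> (x \<ominus>\<^bsub>env.Qt\<^esub> y) = \<phi> x \<ominus>\<^bsub>A\<^esub> \<phi> y" if "x \<in> carrier env.Qt" "y \<in> carrier env.Qt" for x y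
  proof -
    have "\<phi> (x \<ominus>\<^bsub>env.Qt\<^esub> y) \<oplus>\<^bsub>A\<^esub> \<phi> y = \<phi> ((x \<ominus>\<^bsub>env.Qt\<^esub> y) \<oplus>\<^bsub>env.Qt\<^esub> y)"
      using that by (subst ring_hom_add[OF hom]) (auto simp del: quot_algebra_simps)
    also have "(x \<ominus>\<^bsub>env.Qt\<^esub> y) \<oplus>\<^bsub>env.Qt\<^esub> y = x"
      using that by (simp add: env.Qt.minus_eq env.Qt.a_assoc env.Qt.l_neg del: quot_algebra_simps)
    finally show ?thesis using that ring_hom_closed[OF hom]
      by (metis A.add.inv_solve_right A.minus_eq env.Qt.minus_closed)
  qed
  have cls: "env.cls p = env.cls q" if "p - q \<in> env_relators n" "over (sl_poly n) p" "over (sl_poly n) q" for p q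
    using that env_relators_ideal by (auto simp: env.cls_eq_iff)
  have "env.cls (free_gen (X + Y)) = env.cls (free_gen X + free_gen Y)"
    using X Y by (intro cls) (auto simp: env_relators_def)
  thus "\<psi> (X + Y) = \<psi> X + \<psi> Y"
    using X Y by (simp add: \<psi>_def incl env.cls_add hom_rules A.embed_operations del: quot_algebra_simps)
  have "env.cls (free_gen ([:c:] \<cdot>\<^sub>m X)) = env.cls (Poly_Mapping.single 0 c * free_gen X)"
    using X by (intro cls) (auto simp: env_relators_def)
  thus "\<psi> ([:c:] \<cdot>\<^sub>m X) = c *\<^sub>C \<psi> X"
    using X by (simp add: \<psi>_def incl env.cls_smult hom_rules A.embed_smult del: quot_algebra_simps)
  have "env.cls (free_gen (mat_bracket X Y)) = env.cls (free_gen X * free_gen Y - free_gen Y * free_gen X)"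
  proof (rule cls)
    show "free_gen (mat_bracket X Y) - (free_gen X * free_gen Y - free_gen Y * free_gen X) \<in> env_relators n"
      unfolding env_relators_def using X Y by blast
  qed (use X Y in simp_all)
  thus "\<psi> (mat_bracket X Y) = lie (\<psi> X) (\<psi> Y)"
    using X Y by (simp add: \<psi>_def incl env.cls_diff env.cls_mult minus hom_rules A.embed_operations lie_def del: quot_algebra_simps)
qed

lemma loop_elem_sl [simp]: "X \<in> sl n \<Longrightarrow> loop_elem X k \<in> sl n"
  by (auto simp: sl_def loop_elem_def simp flip: monom_sum)

lemma loop_elem_add: "X \<in> sl n \<Longrightarrow> Y \<in> sl n \<Longrightarrow> loop_elem (X + Y) k = loop_elem X k + loop_elem Y k"
  by (rule eq_matI) (auto simp: sl_def loop_elem_def add_monom)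

lemma loop_elem_smult: "loop_elem (c \<cdot>\<^sub>m X) k = [:c:] \<cdot>\<^sub>m loop_elem X k"
  by (rule eq_matI) (auto simp: loop_elem_def smult_monom)

lemma loop_elem_bracket:
  assumes "X \<in> sl n" "Y \<in> sl n"
  shows "mat_bracket (loop_elem X k) (loop_elem Y l) = loop_elem (mat_bracket X Y) (k + l)"
proof (rule eq_matI)
  have X: "X \<in> carrier_mat n n" and Y: "Y \<in> carrier_mat n n"
    using assms by (auto intro: sl_carrier)
  hence XY: "loop_elem X k \<in> carrier_mat n n" "loop_elem Y l \<in> carrier_mat n n" "mat_bracket X Y \<in> carrier_mat n n"
    by (auto simp: loop_elem_def)
  fix i j assume "i < dim_row (loop_elem (mat_bracket X Y) (k + l))" "j < dim_col (loop_elem (mat_bracket X Y) (k + l))"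
  hence ij: "i < n" "j < n" using XY(3) by (auto simp: loop_elem_def)
  show "mat_bracket (loop_elem X k) (loop_elem Y l) $$ (i, j) = loop_elem (mat_bracket X Y) (k + l) $$ (i, j)"
    using ij X Y XY(3)
    by (subst index_mat_bracket[OF XY(1,2) ij])
      (simp add: loop_elem_def carrier_matD[OF XY(3)] index_mat_bracket[OF X Y ij] mult_monom add.commute diff_monom flip: monom_sum)
qed (use assms[THEN sl_carrier] in \<open>auto simp: loop_elem_def mat_bracket_def\<close>)

section \<open>Identities in the deformed double current algebra\<close>

text \<open>
  The elements of degree zero and one of the current algebra.  Elements of degree one with
  commuting matrix parts commute because their bracket is the image of an element of degree two
  with matrix part zero.
\<close>

lemma current_identities:
  assumes A: "complex_algebra_record A" and \<phi>: "\<phi> \<in> alg_hom (env_sl_poly n) A"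
    and g: "\<forall>X\<in>sl n. \<phi> (env_incl n (loop_elem X 0)) = g0 X \<and> \<phi> (env_incl n (loop_elem X 1)) = g1 X"
    and X: "X \<in> sl n" and Y: "Y \<in> sl n"
  shows "embed A (g0 (X + Y)) = embed A (g0 X) + embed A (g0 Y)"
    and "embed A (g1 (X + Y)) = embed A (g1 X) + embed A (g1 Y)"
    and "embed A (g0 (c \<cdot>\<^sub>m X)) = c *\<^sub>C embed A (g0 X)"
    and "embed A (g1 (c \<cdot>\<^sub>m X)) = c *\<^sub>C embed A (g1 X)"
    and "lie (embed A (g0 X)) (embed A (g0 Y)) = embed A (g0 (mat_bracket X Y))"
    and "lie (embed A (g1 X)) (embed A (g0 Y)) = embed A (g1 (mat_bracket X Y))"
    and "mat_bracket X Y = 0\<^sub>m n n \<Longrightarrow> lie (embed A (g1 X)) (embed A (g1 Y)) = 0"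
proof -
  define \<psi> where "\<psi> Z = embed A (\<phi> (env_incl n Z))" for Z
  note lie = alg_hom_lie_map[OF A \<phi>, folded \<psi>_def]
  note lie_smult = lie(2)[OF _ loop_elem_sl[OF Y, of 0]]
  have \<psi>: "embed A (g0 Z) = \<psi> (loop_elem Z 0)" "embed A (g1 Z) = \<psi> (loop_elem Z 1)" if "Z \<in> sl n" for Z
    using g that by (simp_all add: \<psi>_def)
  show "embed A (g0 (X + Y)) = embed A (g0 X) + embed A (g0 Y)"
    and "embed A (g1 (X + Y)) = embed A (g1 X) + embed A (g1 Y)"
    and "embed A (g0 (c \<cdot>\<^sub>m X)) = c *\<^sub>C embed A (g0 X)"
    and "embed A (g1 (c \<cdot>\<^sub>m X)) = c *\<^sub>C embed A (g1 X)"
    and "lie (embed A (g0 X)) (embed A (g0 Y)) = embed A (g0 (mat_bracket X Y))"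
    and "lie (embed A (g1 X)) (embed A (g0 Y)) = embed A (g1 (mat_bracket X Y))"
    using X Y by (simp_all add: \<psi> loop_elem_add[OF X Y] loop_elem_smult lie(1) lie_smult) (simp_all add: lie(3)[symmetric] loop_elem_bracket)
  assume zero: "mat_bracket X Y = 0\<^sub>m n n"
  have "\<psi> (loop_elem (0 \<cdot>\<^sub>m 0\<^sub>m n n) 2) = 0"
    unfolding loop_elem_smult using lie(2)[of "loop_elem (0\<^sub>m n n) 2" "loop_elem (0\<^sub>m n n) 2" 0] by simp
  \<comment> \<open>The zero matrix is a multiple of itself by zero, so it is mapped to zero.\<close>
  moreover have "0 \<cdot>\<^sub>m 0\<^sub>m n n = (0\<^sub>m n n :: complex mat)" by auto
  ultimately show "lie (embed A (g1 X)) (embed A (g1 Y)) = 0"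
    using X Y zero lie(3)[symmetric, of "loop_elem X 1" "loop_elem Y 1"]
    by (simp add: \<psi> loop_elem_bracket one_add_one[symmetric] del: one_add_one)
qed

text \<open>
  The equational consequences of the defining relations that are used.  Unlike the relations, which
  assert the existence of homomorphisms, they are equations between polynomials in the generators,
  so their validity in a quotient passes to intersections of ideals.
\<close>

definition ddca_identities ::
  "nat \<Rightarrow> complex \<Rightarrow> complex \<Rightarrow> (ddca_gen \<Rightarrow> 'b::complex_algebra) \<Rightarrow> bool" where
  "ddca_identities n lam bet \<gamma> \<longleftrightarrow>
    (\<forall>T \<in> {GenX, GenK, GenQ, GenP}. \<forall>X \<in> sl n. \<forall>Y \<in> sl n.
      \<gamma> (T (X + Y)) = \<gamma> (T X) + \<gamma> (T Y) \<and> (\<forall>c. \<gamma> (T (c \<cdot>\<^sub>m X)) = c *\<^sub>C \<gamma> (T X)) \<and>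
      lie (\<gamma> (T X)) (\<gamma> (GenX Y)) = \<gamma> (T (mat_bracket X Y))) \<and>
    (\<forall>T \<in> {GenK, GenQ}. \<forall>X \<in> sl n. \<forall>Y \<in> sl n.
      mat_bracket X Y = 0\<^sub>m n n \<longrightarrow> lie (\<gamma> (T X)) (\<gamma> (T Y)) = 0) \<and>
    (\<forall>a \<in> {1..n}. \<forall>b \<in> {1..n}. \<forall>c \<in> {1..n}. \<forall>d \<in> {1..n}.
       a \<noteq> b \<longrightarrow> c \<noteq> d \<longrightarrow> (a, b) \<noteq> (d, c) \<longrightarrow>
       lie (\<gamma> (GenK (Emat n a b))) (\<gamma> (GenQ (Emat n c d))) =
         \<gamma> (GenP (mat_bracket (Emat n a b) (Emat n c d)))
         + (bet - lam / 2) *\<^sub>C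
              \<gamma> (GenX (of_bool (b = c) \<cdot>\<^sub>m Emat n a d + of_bool (a = d) \<cdot>\<^sub>m Emat n c b))
         - (lam / 4 * (eps n a b \<bullet>c eps n c d)) *\<^sub>C
              acomm (\<gamma> (GenX (Emat n a b))) (\<gamma> (GenX (Emat n c d)))
         + (lam / 4) *\<^sub>C
              (\<Sum>p\<in>{(i, j). i \<in> {1..n} \<and> j \<in> {1..n} \<and> i \<noteq> j}.
                 acomm
                   (\<gamma> (GenX (mat_bracket (Emat n a b) (Emat n (fst p) (snd p)))))
                   (\<gamma> (GenX (mat_bracket (Emat n (snd p) (fst p)) (Emat n c d))))))"

lemma Emat_carrier [simp]: "Emat n a b \<in> carrier_mat n n"
  by (simp add: Emat_def)

lemma Emat_sl [simp]: "a \<noteq> b \<Longrightarrow> Emat n a b \<in> sl n"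
  by (auto simp: sl_def Emat_def intro!: sum.neutral)

lemma Emat_bracket_sl [simp]: "mat_bracket (Emat n a b) (Emat n c d) \<in> sl n"
  by (rule mat_bracket_sl) simp_all

lemma Emat_sum_sl [simp]:
  "a \<noteq> b \<Longrightarrow> c \<noteq> d \<Longrightarrow> (a, b) \<noteq> (d, c) \<Longrightarrow> of_bool (b = c) \<cdot>\<^sub>m Emat n a d + of_bool (a = d) \<cdot>\<^sub>m Emat n c b \<in> sl n"
  by (auto simp: sl_def Emat_def intro!: sum.neutral split: if_splits)

lemma finite_off_diagonal [simp]: "finite {(i, j). i \<in> {1..n} \<and> j \<in> {1..n::nat} \<and> i \<noteq> j}"
  by (rule finite_subset[of _ "{1..n} \<times> {1..n}"]) auto

lemma ddca_gens_closed [simp]: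
  "X \<in> sl n \<Longrightarrow> GenX X \<in> ddca_gens n" "X \<in> sl n \<Longrightarrow> GenK X \<in> ddca_gens n"
  "X \<in> sl n \<Longrightarrow> GenQ X \<in> ddca_gens n" "X \<in> sl n \<Longrightarrow> GenP X \<in> ddca_gens n"
  by (auto simp: ddca_gens_def)

lemma (in complex_algebra_record) embed_quadratic_relation:
  assumes "commutator A k q = p \<oplus> c1 \<odot> x \<ominus> c2 \<odot> symm A y z \<oplus> c3 \<odot> (\<Oplus>i\<in>S. symm A (u i) (v i))"
    and "k \<in> carrier A" "q \<in> carrier A" "p \<in> carrier A" "x \<in> carrier A" "y \<in> carrier A" "z \<in> carrier A"
    and S: "finite S" and uv: "\<And>i. u i \<in> carrier A" "\<And>i. v i \<in> carrier A"
  shows "lie (embed A k) (embed A q) = embed A p + c1 *\<^sub>C embed A x - c2 *\<^sub>C acomm (embed A y) (embed A z)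
    + c3 *\<^sub>C (\<Sum>i\<in>S. acomm (embed A (u i)) (embed A (v i)))"
proof -
  have "(\<Oplus>i\<in>S. symm A (u i) (v i)) \<in> carrier A"
    using uv by (intro finsum_closed) auto
  moreover have "embed A (\<Oplus>i\<in>S. symm A (u i) (v i)) = (\<Sum>i\<in>S. acomm (embed A (u i)) (embed A (v i)))"
    using S uv by (subst embed_finsum) (auto simp: embed_brackets)
  ultimately show ?thesis
    using assms(2-7) by (simp add: embed_brackets(1)[symmetric] assms(1) embed_operations embed_smult embed_brackets(2))
qed

lemma identities_of_relations:
  assumes A: "complex_algebra_record A" and rel: "ddca_relations n lam bet A g"
    and closed: "\<And>x. x \<in> ddca_gens n \<Longrightarrow> g x \<in> carrier A"
  shows "ddca_identities n lam bet (\<lambda>x. embed A (g x))"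
proof -
  interpret A: complex_algebra_record A by (rule A)
  note rel = rel[unfolded ddca_relations_def]
  note rel_K = rel[THEN conjunct1] and rel_Q = rel[THEN conjunct2, THEN conjunct1]
    and rel_P = rel[THEN conjunct2, THEN conjunct2, THEN conjunct1, rule_format]
      rel[THEN conjunct2, THEN conjunct2, THEN conjunct2, THEN conjunct1, rule_format]
      rel[THEN conjunct2, THEN conjunct2, THEN conjunct2, THEN conjunct2, THEN conjunct1, rule_format]
    and rel_KQ = rel[THEN conjunct2, THEN conjunct2, THEN conjunct2, THEN conjunct2, THEN conjunct2, rule_format]
  from rel_K obtain \<phi>K where \<phi>K: "\<phi>K \<in> alg_hom (env_sl_poly n) A"
    "\<forall>X\<in>sl n. \<phi>K (env_incl n (loop_elem X 0)) = g (GenX X) \<and> \<phi>K (env_incl n (loop_elem X 1)) = g (GenK X)"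
    by (elim bexE)
  from rel_Q obtain \<phi>Q where \<phi>Q: "\<phi>Q \<in> alg_hom (env_sl_poly n) A"
    "\<forall>X\<in>sl n. \<phi>Q (env_incl n (loop_elem X 0)) = g (GenX X) \<and> \<phi>Q (env_incl n (loop_elem X 1)) = g (GenQ X)"
    by (elim bexE)
  note K = current_identities[OF A \<phi>K] and Q = current_identities[OF A \<phi>Q]
  note bracket = A.embed_brackets[OF closed closed, symmetric]
  have P: "embed A (g (GenP (X + Y))) = embed A (g (GenP X)) + embed A (g (GenP Y))"
    "embed A (g (GenP (c \<cdot>\<^sub>m X))) = c *\<^sub>C embed A (g (GenP X))"
    "lie (embed A (g (GenP X))) (embed A (g (GenX Y))) = embed A (g (GenP (mat_bracket X Y)))"
    if "X \<in> sl n" "Y \<in> sl n" for X Y c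
  proof -
    show "embed A (g (GenP (X + Y))) = embed A (g (GenP X)) + embed A (g (GenP Y))"
      "embed A (g (GenP (c \<cdot>\<^sub>m X))) = c *\<^sub>C embed A (g (GenP X))"
      "lie (embed A (g (GenP X))) (embed A (g (GenX Y))) = embed A (g (GenP (mat_bracket X Y)))"
      using that by (simp_all add: rel_P(1,2) rel_P(3)[symmetric] A.embed_operations A.embed_smult A.embed_brackets closed)
  qed
  have KQ: "lie (embed A (g (GenK (Emat n a b)))) (embed A (g (GenQ (Emat n c d)))) =
         embed A (g (GenP (mat_bracket (Emat n a b) (Emat n c d))))
         + (bet - lam / 2) *\<^sub>C
              embed A (g (GenX (of_bool (b = c) \<cdot>\<^sub>m Emat n a d + of_bool (a = d) \<cdot>\<^sub>m Emat n c b)))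
         - (lam / 4 * (eps n a b \<bullet>c eps n c d)) *\<^sub>C
              acomm (embed A (g (GenX (Emat n a b)))) (embed A (g (GenX (Emat n c d))))
         + (lam / 4) *\<^sub>C
              (\<Sum>p\<in>{(i, j). i \<in> {1..n} \<and> j \<in> {1..n} \<and> i \<noteq> j}.
                 acomm
                   (embed A (g (GenX (mat_bracket (Emat n a b) (Emat n (fst p) (snd p))))))
                   (embed A (g (GenX (mat_bracket (Emat n (snd p) (fst p)) (Emat n c d))))))"
    if "a \<in> {1..n}" "b \<in> {1..n}" "c \<in> {1..n}" "d \<in> {1..n}" "a \<noteq> b" "c \<noteq> d" "(a, b) \<noteq> (d, c)" for a b c d
  proof -
    have closed': "g (GenK (Emat n a b)) \<in> carrier A" "g (GenQ (Emat n c d)) \<in> carrier A"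
      "g (GenX (Emat n a b)) \<in> carrier A" "g (GenX (Emat n c d)) \<in> carrier A"
      "g (GenX (of_bool (b = c) \<cdot>\<^sub>m Emat n a d + of_bool (a = d) \<cdot>\<^sub>m Emat n c b)) \<in> carrier A"
      "\<And>i j k l. g (GenX (mat_bracket (Emat n i j) (Emat n k l))) \<in> carrier A"
      "\<And>i j k l. g (GenP (mat_bracket (Emat n i j) (Emat n k l))) \<in> carrier A"
      using Emat_sum_sl[OF that(5-7)] that(5,6) by (simp_all add: closed)
    show ?thesis
      by (rule A.embed_quadratic_relation[OF rel_KQ[OF that]]) (simp_all only: closed' finite_off_diagonal)
  qed
  have "\<forall>T \<in> {GenX, GenK, GenQ, GenP}. \<forall>X \<in> sl n. \<forall>Y \<in> sl n.
      embed A (g (T (X + Y))) = embed A (g (T X)) + embed A (g (T Y)) \<and>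
      (\<forall>c. embed A (g (T (c \<cdot>\<^sub>m X))) = c *\<^sub>C embed A (g (T X))) \<and>
      lie (embed A (g (T X))) (embed A (g (GenX Y))) = embed A (g (T (mat_bracket X Y)))"
  proof (intro ballI)
    fix T :: "complex mat \<Rightarrow> ddca_gen" and X Y :: "complex mat"
    assume T: "T \<in> {GenX, GenK, GenQ, GenP}" and XY: "X \<in> sl n" "Y \<in> sl n"
    from T have "T = GenX \<or> T = GenK \<or> T = GenQ \<or> T = GenP" by simp
    thus "embed A (g (T (X + Y))) = embed A (g (T X)) + embed A (g (T Y)) \<and>
      (\<forall>c. embed A (g (T (c \<cdot>\<^sub>m X))) = c *\<^sub>C embed A (g (T X))) \<and>
      lie (embed A (g (T X))) (embed A (g (GenX Y))) = embed A (g (T (mat_bracket X Y)))"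
      using K(1-6)[OF XY] Q(1-6)[OF XY] P[OF XY] by (elim disjE) (hypsubst, intro conjI allI, blast+)+
  qed
  moreover have "\<forall>T \<in> {GenK, GenQ}. \<forall>X \<in> sl n. \<forall>Y \<in> sl n.
      mat_bracket X Y = 0\<^sub>m n n \<longrightarrow> lie (embed A (g (T X))) (embed A (g (T Y))) = 0"
    using K(7) Q(7) by blast
  ultimately show ?thesis
    unfolding ddca_identities_def using KQ by blast
qed

text \<open>
  All relations hold in the zero algebra, so the family of ideals whose intersection is taken is
  not empty.
\<close>

lemma trivial_ideal_relations:
  "ideal (carrier (ddca_free n)) (ddca_free n)"
  "ddca_relations n lam bet (quot_algebra (ddca_free n) (carrier (ddca_free n)))
     (\<lambda>x. carrier (ddca_free n) +>\<^bsub>ddca_free n\<^esub> free_gen x)"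
proof -
  show ideal: "ideal (carrier (ddca_free n)) (ddca_free n)"
    by (rule ring.oneideal[OF free_algebra_ring])
  interpret J: free_quotient "carrier (ddca_free n)" "ddca_gens n"
    unfolding free_quotient_def by (rule ideal)
  \<comment> \<open>The quotient has one element, so every equation between its elements holds.\<close>
  have collapse: "x = y" if xy: "x \<in> carrier J.Qt" "y \<in> carrier J.Qt" for x y
  proof -
    obtain p where p: "over (ddca_gens n) p" "x = J.cls p" using xy(1) by (rule J.carrier_cls)
    obtain q where q: "over (ddca_gens n) q" "y = J.cls q" using xy(2) by (rule J.carrier_cls)
    show ?thesis using p q J.cls_eq_iff[of p q] by simp
  qed
  have cls: "carrier (ddca_free n) +>\<^bsub>ddca_free n\<^esub> free_gen x = J.cls (free_gen x)" for x
    by (simp add: J.cls_def)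
  have zero: "J.cls 0 \<in> carrier J.Qt"
    by (rule J.cls_closed) simp
  have "(\<lambda>_. J.cls 0) \<in> Ring.ring_hom (env_sl_poly n) J.Qt"
    by (rule ring_hom_memI) (rule zero, (rule collapse; intro J.Qt.m_closed J.Qt.a_closed J.Qt.one_closed zero)+)
  hence hom: "(\<lambda>_. J.cls 0) \<in> alg_hom (env_sl_poly n) J.Qt"
    unfolding alg_hom_def using zero by (auto intro!: collapse J.Qt.smult_closed simp del: quot_algebra_simps)
  have gen: "J.cls (free_gen x) \<in> carrier J.Qt" if "x \<in> ddca_gens n" for x
    by (rule J.cls_closed) (simp add: that)
  note closed = J.Qt.a_closed J.Qt.minus_closed J.Qt.smult_closed J.Qt.bracket_closed gen ddca_gens_closed
    sl_add sl_smult sl_bracket Emat_bracket_sl Emat_sl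
  show "ddca_relations n lam bet J.Qt (\<lambda>x. carrier (ddca_free n) +>\<^bsub>ddca_free n\<^esub> free_gen x)"
    unfolding ddca_relations_def cls
  proof (intro conjI)
    show "\<exists>\<phi>\<in>alg_hom (env_sl_poly n) J.Qt. \<forall>X\<in>sl n. \<phi> (env_incl n (loop_elem X 0)) = J.cls (free_gen (GenX X)) \<and>
        \<phi> (env_incl n (loop_elem X 1)) = J.cls (free_gen (GenK X))"
      by (intro bexI[OF _ hom] ballI conjI collapse zero gen ddca_gens_closed)
    show "\<exists>\<phi>\<in>alg_hom (env_sl_poly n) J.Qt. \<forall>X\<in>sl n. \<phi> (env_incl n (loop_elem X 0)) = J.cls (free_gen (GenX X)) \<and>
        \<phi> (env_incl n (loop_elem X 1)) = J.cls (free_gen (GenQ X))"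
      by (intro bexI[OF _ hom] ballI conjI collapse zero gen ddca_gens_closed)
    show "\<forall>X\<in>sl n. \<forall>Y\<in>sl n. J.cls (free_gen (GenP (X + Y))) = J.cls (free_gen (GenP X)) \<oplus>\<^bsub>J.Qt\<^esub> J.cls (free_gen (GenP Y))"
      by (intro ballI collapse closed)
    show "\<forall>c. \<forall>X\<in>sl n. J.cls (free_gen (GenP (c \<cdot>\<^sub>m X))) = c \<odot>\<^bsub>J.Qt\<^esub> J.cls (free_gen (GenP X))"
      by (intro ballI allI collapse closed)
    show "\<forall>X\<in>sl n. \<forall>Y\<in>sl n. commutator J.Qt (J.cls (free_gen (GenP X))) (J.cls (free_gen (GenX Y))) =
        J.cls (free_gen (GenP (mat_bracket X Y)))"
      by (intro ballI collapse closed)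
  qed (intro ballI impI, rule collapse; intro closed Emat_sum_sl J.Qt.finsum_closed Pi_I; assumption)
qed

definition ddca_family :: "nat \<Rightarrow> complex \<Rightarrow> complex \<Rightarrow> (ddca_gen word \<Rightarrow>\<^sub>0 complex) set set" where
  "ddca_family n lam bet = {I. ideal I (ddca_free n) \<and>
     ddca_relations n lam bet (quot_algebra (ddca_free n) I) (\<lambda>x. I +>\<^bsub>ddca_free n\<^esub> free_gen x)}"

lemma ddca_ideal_eq: "ddca_ideal n lam bet = \<Inter> (ddca_family n lam bet)"
  by (simp add: ddca_ideal_def ddca_family_def)

lemma ddca_family_quotient: "J \<in> ddca_family n lam bet \<Longrightarrow> free_quotient J (ddca_gens n)"
  by (simp add: ddca_family_def free_quotient_def)

lemma ddca_ideal_quotient: "free_quotient (ddca_ideal n lam bet) (ddca_gens n)"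
proof -
  have "carrier (ddca_free n) \<in> ddca_family n lam bet"
    using trivial_ideal_relations by (simp add: ddca_family_def)
  hence "ddca_family n lam bet \<noteq> {}" by blast
  thus ?thesis
    unfolding free_quotient_def ddca_ideal_eq
    by (intro ring.i_Intersect[OF free_algebra_ring]) (auto simp: ddca_family_def)
qed

lemma ddca_family_identities:
  assumes "J \<in> ddca_family n lam bet"
  shows "ddca_identities n lam bet (\<lambda>x. free_quotient.\<Phi> J (ddca_gens n) (free_gen x))"
proof -
  interpret J: free_quotient J "ddca_gens n" by (rule ddca_family_quotient[OF assms])
  have "ddca_identities n lam bet (\<lambda>x. embed J.Qt (J +>\<^bsub>ddca_free n\<^esub> free_gen x))"
    using assms ring_hom_closed[OF J.rcos_ring_hom]
    by (intro identities_of_relations[OF J.Qt_algebra]) (auto simp: ddca_family_def)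
  thus ?thesis by (simp add: J.\<Phi>_def J.cls_def)
qed

text \<open>
  Congruence modulo an intersection of ideals is congruence modulo each of them.
\<close>

lemma ddca_\<Phi>_eqI:
  assumes "over (ddca_gens n) p" "over (ddca_gens n) q"
    and "\<And>J. J \<in> ddca_family n lam bet \<Longrightarrow> free_quotient.\<Phi> J (ddca_gens n) p = free_quotient.\<Phi> J (ddca_gens n) q"
  shows "free_quotient.\<Phi> (ddca_ideal n lam bet) (ddca_gens n) p = free_quotient.\<Phi> (ddca_ideal n lam bet) (ddca_gens n) q"
  using assms free_quotient.\<Phi>_eq_iff[OF ddca_family_quotient] free_quotient.\<Phi>_eq_iff[OF ddca_ideal_quotient]
  by (auto simp: ddca_ideal_eq)

context free_quotient
begin

lemma \<Phi>_lie: "over G p \<Longrightarrow> over G q \<Longrightarrow> \<Phi> (p * q - q * p) = lie (\<Phi> p) (\<Phi> q)"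
  and \<Phi>_acomm: "over G p \<Longrightarrow> over G q \<Longrightarrow> \<Phi> (p * q + q * p) = acomm (\<Phi> p) (\<Phi> q)"
  by (simp_all add: lie_def acomm_def \<Phi>_operations)

lemma \<Phi>_quadratic:
  fixes c1 c2 c3 :: complex
  assumes "over G p" "over G x" "over G y" "over G z"
    and S: "finite S" and uv: "\<And>i. over G (u i)" "\<And>i. over G (v i)"
  defines "r \<equiv> p + Poly_Mapping.single 0 c1 * x - Poly_Mapping.single 0 c2 * (y * z + z * y)
    + Poly_Mapping.single 0 c3 * (\<Sum>i\<in>S. u i * v i + v i * u i)"
  shows "over G r" and "\<Phi> r = \<Phi> p + c1 *\<^sub>C \<Phi> x - c2 *\<^sub>C acomm (\<Phi> y) (\<Phi> z)
    + c3 *\<^sub>C (\<Sum>i\<in>S. acomm (\<Phi> (u i)) (\<Phi> (v i)))"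
proof -
  have sum: "over G (\<Sum>i\<in>S. u i * v i + v i * u i)"
    "\<Phi> (\<Sum>i\<in>S. u i * v i + v i * u i) = (\<Sum>i\<in>S. acomm (\<Phi> (u i)) (\<Phi> (v i)))"
    using \<Phi>_sum[OF S, of "\<lambda>i. u i * v i + v i * u i"] uv by (simp_all add: \<Phi>_acomm)
  define w where "w = y * z + z * y"
  have w: "over G w" "\<Phi> w = acomm (\<Phi> y) (\<Phi> z)"
    unfolding w_def using assms(3,4) by (simp_all only: \<Phi>_acomm over_closed)
  show "over G r" using assms(1-4) sum(1) by (simp add: r_def)
  have scalar: "\<Phi> (Poly_Mapping.single 0 c * q) = c *\<^sub>C \<Phi> q" if "over G q" for c q
    using that by (rule \<Phi>_operations(4)[OF _ that])
  show "\<Phi> r = \<Phi> p + c1 *\<^sub>C \<Phi> x - c2 *\<^sub>C acomm (\<Phi> y) (\<Phi> z)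
    + c3 *\<^sub>C (\<Sum>i\<in>S. acomm (\<Phi> (u i)) (\<Phi> (v i)))"
    using assms(1-4) sum w by (simp add: r_def \<Phi>_operations(1,2) scalar flip: w_def)
qed

end

lemma ddca_identities_hold:
  "ddca_identities n lam bet (\<lambda>x. free_quotient.\<Phi> (ddca_ideal n lam bet) (ddca_gens n) (free_gen x))"
proof -
  interpret I: free_quotient "ddca_ideal n lam bet" "ddca_gens n" by (rule ddca_ideal_quotient)
  define \<Phi> where "\<Phi> J = free_quotient.\<Phi> J (ddca_gens n)" for J
  note \<Phi>_I = \<Phi>_def[of "ddca_ideal n lam bet", symmetric]
  have eqI: "I.\<Phi> p = I.\<Phi> q" if "over (ddca_gens n) p" "over (ddca_gens n) q"
    "\<And>J. J \<in> ddca_family n lam bet \<Longrightarrow> \<Phi> J p = \<Phi> J q" for p q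
    using that unfolding \<Phi>_def by (rule ddca_\<Phi>_eqI)
  note quot = ddca_family_quotient
  note ident = ddca_family_identities[unfolded ddca_identities_def, folded \<Phi>_def]
  note current = ident[THEN conjunct1, rule_format] and
    commuting = ident[THEN conjunct2, THEN conjunct1, rule_format] and
    KQ = ident[THEN conjunct2, THEN conjunct2, rule_format]
  have gen: "over (ddca_gens n) (free_gen (T X))" if "T \<in> {GenX, GenK, GenQ, GenP}" "X \<in> sl n" for T :: "complex mat \<Rightarrow> ddca_gen" and X
    using that by (intro over_closed) auto
  show ?thesis
    unfolding ddca_identities_def
  proof (intro conjI ballI allI impI)
    fix T :: "complex mat \<Rightarrow> ddca_gen" and X Y :: "complex mat" and c
    assume T: "T \<in> {GenX, GenK, GenQ, GenP}" and X: "X \<in> sl n" and Y: "Y \<in> sl n"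
    have "I.\<Phi> (free_gen (T (X + Y))) = I.\<Phi> (free_gen (T X) + free_gen (T Y))"
    proof (rule eqI)
      fix J assume J: "J \<in> ddca_family n lam bet"
      show "\<Phi> J (free_gen (T (X + Y))) = \<Phi> J (free_gen (T X) + free_gen (T Y))"
        using current[OF J T X Y] free_quotient.\<Phi>_operations(1)[OF quot[OF J] gen[OF T X] gen[OF T Y]] by (simp add: \<Phi>_def)
    qed (use T X Y gen in simp_all)
    thus "I.\<Phi> (free_gen (T (X + Y))) = I.\<Phi> (free_gen (T X)) + I.\<Phi> (free_gen (T Y))"
      using I.\<Phi>_operations(1)[OF gen[OF T X] gen[OF T Y]] by simp
    have "I.\<Phi> (free_gen (T (c \<cdot>\<^sub>m X))) = I.\<Phi> (Poly_Mapping.single 0 c * free_gen (T X))"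
    proof (rule eqI)
      fix J assume J: "J \<in> ddca_family n lam bet"
      show "\<Phi> J (free_gen (T (c \<cdot>\<^sub>m X))) = \<Phi> J (Poly_Mapping.single 0 c * free_gen (T X))"
        using current[OF J T X Y] free_quotient.\<Phi>_operations(4)[OF quot[OF J] gen[OF T X] gen[OF T X]] by (simp add: \<Phi>_def)
    qed (use T X Y gen in simp_all)
    thus "I.\<Phi> (free_gen (T (c \<cdot>\<^sub>m X))) = c *\<^sub>C I.\<Phi> (free_gen (T X))"
      using I.\<Phi>_operations(4)[OF gen[OF T X] gen[OF T X]] by simp
    have GX: "GenX \<in> {GenX, GenK, GenQ, GenP}" by simp
    have "I.\<Phi> (free_gen (T X) * free_gen (GenX Y) - free_gen (GenX Y) * free_gen (T X)) = I.\<Phi> (free_gen (T (mat_bracket X Y)))"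
    proof (rule eqI)
      fix J assume J: "J \<in> ddca_family n lam bet"
      show "\<Phi> J (free_gen (T X) * free_gen (GenX Y) - free_gen (GenX Y) * free_gen (T X)) = \<Phi> J (free_gen (T (mat_bracket X Y)))"
        using current[OF J T X Y] free_quotient.\<Phi>_lie[OF quot[OF J] gen[OF T X] gen[OF GX Y]] by (simp add: \<Phi>_def)
    qed (use T X Y gen gen[OF GX] in simp_all)
    thus "lie (I.\<Phi> (free_gen (T X))) (I.\<Phi> (free_gen (GenX Y))) = I.\<Phi> (free_gen (T (mat_bracket X Y)))"
      using I.\<Phi>_lie[OF gen[OF T X] gen[OF GX Y]] by simp
  next
    fix T :: "complex mat \<Rightarrow> ddca_gen" and X Y :: "complex mat"
    assume T: "T \<in> {GenK, GenQ}" and X: "X \<in> sl n" and Y: "Y \<in> sl n" and zero: "mat_bracket X Y = 0\<^sub>m n n"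
    have T': "T \<in> {GenX, GenK, GenQ, GenP}" using T by auto
    have "I.\<Phi> (free_gen (T X) * free_gen (T Y) - free_gen (T Y) * free_gen (T X)) = I.\<Phi> 0"
    proof (rule eqI)
      fix J assume J: "J \<in> ddca_family n lam bet"
      show "\<Phi> J (free_gen (T X) * free_gen (T Y) - free_gen (T Y) * free_gen (T X)) = \<Phi> J 0"
        using commuting[OF J T X Y zero] free_quotient.\<Phi>_lie[OF quot[OF J] gen[OF T' X] gen[OF T' Y]]
          free_quotient.\<Phi>_zero[OF quot[OF J]] by (simp add: \<Phi>_def)
    qed (use T' X Y gen in simp_all)
    thus "lie (I.\<Phi> (free_gen (T X))) (I.\<Phi> (free_gen (T Y))) = 0"
      using I.\<Phi>_lie[OF gen[OF T' X] gen[OF T' Y]] I.\<Phi>_zero by simp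
  next
    fix a b c d :: nat
    assume abcd: "a \<in> {1..n}" "b \<in> {1..n}" "c \<in> {1..n}" "d \<in> {1..n}" "a \<noteq> b" "c \<noteq> d" "(a, b) \<noteq> (d, c)"
    define k q p x y z where "k = (free_gen (GenK (Emat n a b)) :: ddca_gen word \<Rightarrow>\<^sub>0 complex)"
      and "q = (free_gen (GenQ (Emat n c d)) :: ddca_gen word \<Rightarrow>\<^sub>0 complex)"
      and "p = (free_gen (GenP (mat_bracket (Emat n a b) (Emat n c d))) :: ddca_gen word \<Rightarrow>\<^sub>0 complex)"
      and "x = (free_gen (GenX (of_bool (b = c) \<cdot>\<^sub>m Emat n a d + of_bool (a = d) \<cdot>\<^sub>m Emat n c b)) :: ddca_gen word \<Rightarrow>\<^sub>0 complex)"
      and "y = (free_gen (GenX (Emat n a b)) :: ddca_gen word \<Rightarrow>\<^sub>0 complex)"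
      and "z = (free_gen (GenX (Emat n c d)) :: ddca_gen word \<Rightarrow>\<^sub>0 complex)"
    define u v where "u i = (free_gen (GenX (mat_bracket (Emat n a b) (Emat n (fst i) (snd i)))) :: ddca_gen word \<Rightarrow>\<^sub>0 complex)"
      and "v i = (free_gen (GenX (mat_bracket (Emat n (snd i) (fst i)) (Emat n c d))) :: ddca_gen word \<Rightarrow>\<^sub>0 complex)" for i
    note defs = k_def q_def p_def x_def y_def z_def u_def v_def
    have over: "over (ddca_gens n) k" "over (ddca_gens n) q" "over (ddca_gens n) p" "over (ddca_gens n) x"
      "over (ddca_gens n) y" "over (ddca_gens n) z" "\<And>i. over (ddca_gens n) (u i)" "\<And>i. over (ddca_gens n) (v i)"
      unfolding defs by (intro over_closed ddca_gens_closed Emat_sl Emat_sum_sl Emat_bracket_sl abcd)+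
    note quadratic = free_quotient.\<Phi>_quadratic[OF _ over(3,4,5,6) finite_off_diagonal over(7,8)]
    note relation = KQ[OF _ abcd, folded defs]
    have "I.\<Phi> (k * q - q * k) = I.\<Phi> (p + Poly_Mapping.single 0 (bet - lam / 2) * x
        - Poly_Mapping.single 0 (lam / 4 * (eps n a b \<bullet>c eps n c d)) * (y * z + z * y)
        + Poly_Mapping.single 0 (lam / 4) * (\<Sum>i\<in>{(i, j). i \<in> {1..n} \<and> j \<in> {1..n} \<and> i \<noteq> j}. u i * v i + v i * u i))"
    proof (rule eqI)
      show "over (ddca_gens n) (p + Poly_Mapping.single 0 (bet - lam / 2) * x
        - Poly_Mapping.single 0 (lam / 4 * (eps n a b \<bullet>c eps n c d)) * (y * z + z * y)
        + Poly_Mapping.single 0 (lam / 4) * (\<Sum>i\<in>{(i, j). i \<in> {1..n} \<and> j \<in> {1..n} \<and> i \<noteq> j}. u i * v i + v i * u i))"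
        by (rule quadratic(1)[OF ddca_ideal_quotient])
      fix J assume J: "J \<in> ddca_family n lam bet"
      show "\<Phi> J (k * q - q * k) = \<Phi> J (p + Poly_Mapping.single 0 (bet - lam / 2) * x
        - Poly_Mapping.single 0 (lam / 4 * (eps n a b \<bullet>c eps n c d)) * (y * z + z * y)
        + Poly_Mapping.single 0 (lam / 4) * (\<Sum>i\<in>{(i, j). i \<in> {1..n} \<and> j \<in> {1..n} \<and> i \<noteq> j}. u i * v i + v i * u i))"
        unfolding \<Phi>_def quadratic(2)[OF quot[OF J]] free_quotient.\<Phi>_lie[OF quot[OF J] over(1,2)]
        using relation[OF J] by (simp only: \<Phi>_def)
    qed (use over in simp)
    thus "lie (I.\<Phi> (free_gen (GenK (Emat n a b)))) (I.\<Phi> (free_gen (GenQ (Emat n c d)))) =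
         I.\<Phi> (free_gen (GenP (mat_bracket (Emat n a b) (Emat n c d))))
         + (bet - lam / 2) *\<^sub>C
              I.\<Phi> (free_gen (GenX (of_bool (b = c) \<cdot>\<^sub>m Emat n a d + of_bool (a = d) \<cdot>\<^sub>m Emat n c b)))
         - (lam / 4 * (eps n a b \<bullet>c eps n c d)) *\<^sub>C
              acomm (I.\<Phi> (free_gen (GenX (Emat n a b)))) (I.\<Phi> (free_gen (GenX (Emat n c d))))
         + (lam / 4) *\<^sub>C
              (\<Sum>p\<in>{(i, j). i \<in> {1..n} \<and> j \<in> {1..n} \<and> i \<noteq> j}.
                 acomm
                   (I.\<Phi> (free_gen (GenX (mat_bracket (Emat n a b) (Emat n (fst p) (snd p))))))
                   (I.\<Phi> (free_gen (GenX (mat_bracket (Emat n (snd p) (fst p)) (Emat n c d))))))"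
      unfolding quadratic(2)[OF ddca_ideal_quotient] I.\<Phi>_lie[OF over(1,2)] unfolding defs .
  qed
qed

section \<open>Traceless matrix units\<close>

lemma Emat_mult:
  assumes "b \<in> {1..n}"
  shows "Emat n a b * Emat n c d = (if b = c then Emat n a d else 0\<^sub>m n n)"
proof (rule eq_matI)
  fix i j assume "i < dim_row (if b = c then Emat n a d else 0\<^sub>m n n)" "j < dim_col (if b = c then Emat n a d else 0\<^sub>m n n)"
  hence ij: "i < n" "j < n" by (auto simp: Emat_def split: if_splits)
  have b: "k + 1 = b \<longleftrightarrow> k = b - 1" for k using assms by auto
  have "(Emat n a b * Emat n c d) $$ (i, j) = (\<Sum>k<n. (if i + 1 = a \<and> k + 1 = b then 1 else 0) * (if k + 1 = c \<and> j + 1 = d then 1 else 0))"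
    using ij by (simp add: Emat_def scalar_prod_def lessThan_atLeast0)
  also have "\<dots> = (\<Sum>k<n. if k = b - 1 then (if i + 1 = a \<and> b = c \<and> j + 1 = d then 1 else 0) else 0)"
    using assms by (intro sum.cong refl) auto
  also have "\<dots> = (if i + 1 = a \<and> b = c \<and> j + 1 = d then 1 else 0)"
    using assms by (subst sum.delta) auto
  also have "\<dots> = (if b = c then Emat n a d else 0\<^sub>m n n) $$ (i, j)"
    using ij by (simp add: Emat_def)
  finally show "(Emat n a b * Emat n c d) $$ (i, j) = (if b = c then Emat n a d else 0\<^sub>m n n) $$ (i, j)" .
qed (auto simp: Emat_def)

text \<open>
  Subtracting the trace gives elements of \<open>sl\<^sub>n\<close> for equal indices too, and does not affect
  brackets; so all relations of matrix units hold without exceptions on the diagonal.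
\<close>

definition traceless_unit :: "nat \<Rightarrow> nat \<Rightarrow> nat \<Rightarrow> complex mat" where
  "traceless_unit n a b = Emat n a b - (of_bool (a = b) / of_nat n) \<cdot>\<^sub>m 1\<^sub>m n"

lemma traceless_unit_off_diagonal: "a \<noteq> b \<Longrightarrow> traceless_unit n a b = Emat n a b"
  by (rule eq_matI) (auto simp: traceless_unit_def Emat_def)

lemma traceless_unit_carrier [simp]: "traceless_unit n a b \<in> carrier_mat n n"
  unfolding traceless_unit_def by (rule minus_carrier_mat) simp

lemma traceless_unit_sl [simp]:
  assumes "a \<in> {1..n}"
  shows "traceless_unit n a b \<in> sl n"
proof (cases "a = b")
  case True
  have a: "i + 1 = a \<longleftrightarrow> i = a - 1" for i using assms by auto
  have "(\<Sum>i<n. traceless_unit n a b $$ (i, i)) = (\<Sum>i<n. (if i = a - 1 then 1 else 0) - 1 / of_nat n)"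
    using True assms by (intro sum.cong refl) (auto simp: traceless_unit_def Emat_def)
  also have "\<dots> = 0"
  proof -
    have "a - 1 < n" using assms by auto
    thus ?thesis by (simp add: sum_subtractf)
  qed
  finally show ?thesis by (simp add: sl_def)
qed (simp add: traceless_unit_off_diagonal)

lemma mat_bracket_shift:
  assumes "X \<in> carrier_mat n n" "Y \<in> carrier_mat n n"
  shows "mat_bracket (X - c \<cdot>\<^sub>m 1\<^sub>m n) (Y - d \<cdot>\<^sub>m 1\<^sub>m n) = (mat_bracket X Y :: complex mat)"
proof (rule eq_matI)
  fix i j assume "i < dim_row (mat_bracket X Y)" "j < dim_col (mat_bracket X Y)"
  hence ij: "i < n" "j < n" using assms by (auto simp: mat_bracket_def)
  have "(\<Sum>k<n. (X - c \<cdot>\<^sub>m 1\<^sub>m n) $$ (i, k) * (Y - d \<cdot>\<^sub>m 1\<^sub>m n) $$ (k, j))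
      = (\<Sum>k<n. X $$ (i, k) * Y $$ (k, j)) - d * X $$ (i, j) - c * Y $$ (i, j) + (if i = j then c * d else 0)"
    if "X \<in> carrier_mat n n" "Y \<in> carrier_mat n n" for X Y :: "complex mat" and c d
  proof -
    have "(\<Sum>k<n. (X - c \<cdot>\<^sub>m 1\<^sub>m n) $$ (i, k) * (Y - d \<cdot>\<^sub>m 1\<^sub>m n) $$ (k, j))
      = (\<Sum>k<n. X $$ (i, k) * Y $$ (k, j) - (if k = j then d * X $$ (i, j) else 0)
          - (if k = i then c * Y $$ (i, j) else 0) + (if k = i then (if i = j then c * d else 0) else 0))"
      using that ij by (intro sum.cong refl) (auto simp: algebra_simps)
    also have "\<dots> = (\<Sum>k<n. X $$ (i, k) * Y $$ (k, j)) - d * X $$ (i, j) - c * Y $$ (i, j) + (if i = j then c * d else 0)"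
      using ij by (simp add: sum.distrib sum_subtractf)
    finally show ?thesis .
  qed
  from this[OF assms, of c d] this[OF assms(2,1), of d c] show "mat_bracket (X - c \<cdot>\<^sub>m 1\<^sub>m n) (Y - d \<cdot>\<^sub>m 1\<^sub>m n) $$ (i, j) = mat_bracket X Y $$ (i, j)"
    using assms ij by (subst (1 2) index_mat_bracket) (auto simp: mult.commute)
qed (use assms in \<open>auto simp: mat_bracket_def\<close>)

lemma traceless_unit_bracket:
  assumes "a \<in> {1..n}" "b \<in> {1..n}" "c \<in> {1..n}" "d \<in> {1..n}"
  shows "mat_bracket (traceless_unit n a b) (traceless_unit n c d) =
    of_bool (b = c) \<cdot>\<^sub>m traceless_unit n a d + (- of_bool (a = d)) \<cdot>\<^sub>m traceless_unit n c b"
proof -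
  have "mat_bracket (traceless_unit n a b) (traceless_unit n c d) = mat_bracket (Emat n a b) (Emat n c d)"
    unfolding traceless_unit_def by (rule mat_bracket_shift) simp_all
  also have "\<dots> = (if b = c then Emat n a d else 0\<^sub>m n n) - (if d = a then Emat n c b else 0\<^sub>m n n)"
    using assms by (simp add: mat_bracket_def Emat_mult)
  also have "\<dots> = of_bool (b = c) \<cdot>\<^sub>m traceless_unit n a d + (- of_bool (a = d)) \<cdot>\<^sub>m traceless_unit n c b"
    by (rule eq_matI) (auto simp: traceless_unit_def Emat_def)
  finally show ?thesis .
qed

lemma eps_inner:
  assumes "a \<in> {1..n}" "b \<in> {1..n}" "c \<in> {1..n}" "d \<in> {1..n}"
  shows "eps n a b \<bullet>c eps n c d = of_bool (a = c) - of_bool (a = d) - of_bool (b = c) + of_bool (b = d)"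
proof -
  have unit: "unit_vec n (i - 1) \<bullet>c unit_vec n (j - 1) = (of_bool (i = j) :: complex)"
    if "i \<in> {1..n}" "j \<in> {1..n}" for i j
  proof -
    have "conjugate (unit_vec n (j - 1)) = (unit_vec n (j - 1) :: complex vec)"
      by (rule eq_vecI) (auto simp: unit_vec_def)
    thus ?thesis using that by (subst scalar_prod_left_unit) (auto simp: unit_vec_def)
  qed
  have "conjugate (eps n c d) = unit_vec n (c - 1) - unit_vec n (d - 1)"
    by (rule eq_vecI) (auto simp: eps_def unit_vec_def)
  moreover have "conjugate (unit_vec n (j - 1)) = (unit_vec n (j - 1) :: complex vec)" for j
    by (rule eq_vecI) (auto simp: unit_vec_def)
  ultimately show ?thesis
    using unit[of a c] unit[of a d] unit[of b c] unit[of b d] assms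
    by (simp add: eps_def minus_scalar_prod_distrib[of _ n] scalar_prod_minus_distrib[of _ n])
qed

lemma linear_identities:
  assumes "ddca_identities n lam bet \<gamma>" "T \<in> {GenX, GenK, GenQ, GenP}"
    and "X \<in> sl n" "Y \<in> sl n"
  shows "\<gamma> (T (X + Y)) = \<gamma> (T X) + \<gamma> (T Y)" "\<gamma> (T (c \<cdot>\<^sub>m X)) = c *\<^sub>C \<gamma> (T X)"
    "lie (\<gamma> (T X)) (\<gamma> (GenX Y)) = \<gamma> (T (mat_bracket X Y))"
  using assms(1)[unfolded ddca_identities_def, THEN conjunct1, rule_format, OF assms(2-4)] by simp_all

lemma unit_bracket:
  assumes "ddca_identities n lam bet \<gamma>" "T \<in> {GenX, GenK, GenQ, GenP}"
    and "a \<in> {1..n}" "b \<in> {1..n}" "c \<in> {1..n}" "d \<in> {1..n}"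
  shows "lie (\<gamma> (T (traceless_unit n a b))) (\<gamma> (GenX (traceless_unit n c d))) =
    (if b = c then \<gamma> (T (traceless_unit n a d)) else 0) - (if a = d then \<gamma> (T (traceless_unit n c b)) else 0)"
proof -
  note lin = linear_identities[OF assms(1,2)]
  have "lie (\<gamma> (T (traceless_unit n a b))) (\<gamma> (GenX (traceless_unit n c d))) =
    \<gamma> (T (of_bool (b = c) \<cdot>\<^sub>m traceless_unit n a d + (- of_bool (a = d)) \<cdot>\<^sub>m traceless_unit n c b))"
    using assms(3-6) by (simp only: lin(3) traceless_unit_sl traceless_unit_bracket)
  also have "\<dots> = of_bool (b = c) *\<^sub>C \<gamma> (T (traceless_unit n a d)) + (- of_bool (a = d)) *\<^sub>C \<gamma> (T (traceless_unit n c b))"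
    using assms(3-6) lin(2)[OF traceless_unit_sl traceless_unit_sl]
    by (simp only: lin(1) sl_smult traceless_unit_sl)
  finally show ?thesis by (simp split: if_splits)
qed

lemma commuting_units:
  assumes "ddca_identities n lam bet \<gamma>" "T \<in> {GenK, GenQ}"
    and "a \<in> {1..n}" "b \<in> {1..n}" "c \<in> {1..n}" "d \<in> {1..n}" "b \<noteq> c" "a \<noteq> d"
  shows "lie (\<gamma> (T (traceless_unit n a b))) (\<gamma> (T (traceless_unit n c d))) = 0"
proof -
  have "mat_bracket (traceless_unit n a b) (traceless_unit n c d) = 0\<^sub>m n n"
    using assms(3-8) by (subst traceless_unit_bracket) (auto intro!: eq_matI simp: traceless_unit_def)
  thus ?thesis
    using assms(1)[unfolded ddca_identities_def, THEN conjunct2, THEN conjunct1, rule_format, OF assms(2)] assms(3,5)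
    by (simp only: traceless_unit_sl)
qed

lemma sl_ddca_units_of_identities:
  assumes n: "4 \<le> n" and id: "ddca_identities n lam bet \<gamma>"
  shows "sl_ddca_units {1..n} lam bet (\<lambda>a b. \<gamma> (GenX (traceless_unit n a b))) (\<lambda>a b. \<gamma> (GenK (traceless_unit n a b)))
    (\<lambda>a b. \<gamma> (GenQ (traceless_unit n a b))) (\<lambda>a b. \<gamma> (GenP (traceless_unit n a b)))"
proof
  show "finite {1..n}" "4 \<le> card {1..n}" using n by simp_all
  fix i assume "i \<in> {1..n}" "Suc i \<in> {1..n}"
  thus "Suc (Suc i) \<in> {1..n} \<or> (\<exists>j\<in>{1..n}. i = Suc j)"
    using n by (cases "i = 1") (auto intro!: bexI[of _ "i - 1"])
next
  fix a b c d assume abcd: "a \<in> {1..n}" "b \<in> {1..n}" "c \<in> {1..n}" "d \<in> {1..n}"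
  note bracket = unit_bracket[OF id _ abcd]
  show "lie (\<gamma> (GenX (traceless_unit n a b))) (\<gamma> (GenX (traceless_unit n c d))) =
      (if b = c then \<gamma> (GenX (traceless_unit n a d)) else 0) - (if a = d then \<gamma> (GenX (traceless_unit n c b)) else 0)"
    by (rule bracket) simp
  show "lie (\<gamma> (GenK (traceless_unit n a b))) (\<gamma> (GenX (traceless_unit n c d))) =
      (if b = c then \<gamma> (GenK (traceless_unit n a d)) else 0) - (if a = d then \<gamma> (GenK (traceless_unit n c b)) else 0)"
    by (rule bracket) simp
  show "lie (\<gamma> (GenQ (traceless_unit n a b))) (\<gamma> (GenX (traceless_unit n c d))) =
      (if b = c then \<gamma> (GenQ (traceless_unit n a d)) else 0) - (if a = d then \<gamma> (GenQ (traceless_unit n c b)) else 0)"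
    by (rule bracket) simp
  show "lie (\<gamma> (GenP (traceless_unit n a b))) (\<gamma> (GenX (traceless_unit n c d))) =
      (if b = c then \<gamma> (GenP (traceless_unit n a d)) else 0) - (if a = d then \<gamma> (GenP (traceless_unit n c b)) else 0)"
    by (rule bracket) simp
next
  fix a b c d assume "a \<in> {1..n}" "b \<in> {1..n}" "c \<in> {1..n}" "d \<in> {1..n}" "b \<noteq> c" "a \<noteq> d"
  note commuting = commuting_units[OF id _ this]
  show "lie (\<gamma> (GenK (traceless_unit n a b))) (\<gamma> (GenK (traceless_unit n c d))) = 0"
    "lie (\<gamma> (GenQ (traceless_unit n a b))) (\<gamma> (GenQ (traceless_unit n c d))) = 0"
    by (rule commuting; simp)+
next
  fix a b c d assume abcd: "a \<in> {1..n}" "b \<in> {1..n}" "c \<in> {1..n}" "d \<in> {1..n}" and ne: "a \<noteq> b" "c \<noteq> d" "a \<noteq> d"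
  have neq: "(a, b) \<noteq> (d, c)" using ne by simp
  have unit: "Emat n i j = traceless_unit n i j" if "i \<noteq> j" for i j
    using that by (simp add: traceless_unit_off_diagonal)
  have bracket_unit: "\<gamma> (T (mat_bracket (Emat n i j) (Emat n k l))) =
      (if j = k then \<gamma> (T (traceless_unit n i l)) else 0) - (if i = l then \<gamma> (T (traceless_unit n k j)) else 0)"
    if T: "T \<in> {GenX, GenK, GenQ, GenP}" and ijkl: "i \<in> {1..n}" "j \<in> {1..n}" "k \<in> {1..n}" "l \<in> {1..n}" and ne: "i \<noteq> j" "k \<noteq> l"
    for T :: "complex mat \<Rightarrow> ddca_gen" and i j k l
    unfolding unit[OF ne(1)] unit[OF ne(2)] unit_bracket[OF id T ijkl, symmetric]
    by (rule linear_identities(3)[OF id T, symmetric]) (use ijkl in \<open>simp_all only: traceless_unit_sl\<close>)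
  have GP: "GenP \<in> {GenX, GenK, GenQ, GenP}" and GX: "GenX \<in> {GenX, GenK, GenQ, GenP}" by simp_all
  have P: "\<gamma> (GenP (mat_bracket (Emat n a b) (Emat n c d))) = (if b = c then \<gamma> (GenP (traceless_unit n a d)) else 0)"
    using ne by (simp add: bracket_unit[OF GP abcd ne(1,2)])
  have eq: "of_bool (b = c) \<cdot>\<^sub>m Emat n a d + of_bool (a = d) \<cdot>\<^sub>m Emat n c b = of_bool (b = c) \<cdot>\<^sub>m traceless_unit n a d"
    using ne by (intro eq_matI) (auto simp: unit traceless_unit_def Emat_def)
  have X: "\<gamma> (GenX (of_bool (b = c) \<cdot>\<^sub>m Emat n a d + of_bool (a = d) \<cdot>\<^sub>m Emat n c b)) =
      (if b = c then \<gamma> (GenX (traceless_unit n a d)) else 0)"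
    unfolding eq using linear_identities(2)[OF id GX, of "traceless_unit n a d" "traceless_unit n a d" "of_bool (b = c)"] traceless_unit_sl[OF abcd(1), of d]
    by simp
  have sum: "(\<Sum>p\<in>{(i, j). i \<in> {1..n} \<and> j \<in> {1..n} \<and> i \<noteq> j}.
         acomm (\<gamma> (GenX (mat_bracket (Emat n a b) (Emat n (fst p) (snd p)))))
              (\<gamma> (GenX (mat_bracket (Emat n (snd p) (fst p)) (Emat n c d))))) =
      (\<Sum>p\<in>{(i, j). i \<in> {1..n} \<and> j \<in> {1..n} \<and> i \<noteq> j}.
         acomm ((if b = fst p then \<gamma> (GenX (traceless_unit n a (snd p))) else 0) - (if a = snd p then \<gamma> (GenX (traceless_unit n (fst p) b)) else 0))
              ((if fst p = c then \<gamma> (GenX (traceless_unit n (snd p) d)) else 0) - (if snd p = d then \<gamma> (GenX (traceless_unit n c (fst p))) else 0)))"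
  proof (intro sum.cong refl)
    fix p assume "p \<in> {(i, j). i \<in> {1..n} \<and> j \<in> {1..n} \<and> i \<noteq> j}"
    hence p: "fst p \<in> {1..n}" "snd p \<in> {1..n}" "fst p \<noteq> snd p" "snd p \<noteq> fst p" by (cases p; simp; fail)+
    show "acomm (\<gamma> (GenX (mat_bracket (Emat n a b) (Emat n (fst p) (snd p)))))
              (\<gamma> (GenX (mat_bracket (Emat n (snd p) (fst p)) (Emat n c d)))) =
         acomm ((if b = fst p then \<gamma> (GenX (traceless_unit n a (snd p))) else 0) - (if a = snd p then \<gamma> (GenX (traceless_unit n (fst p) b)) else 0))
              ((if fst p = c then \<gamma> (GenX (traceless_unit n (snd p) d)) else 0) - (if snd p = d then \<gamma> (GenX (traceless_unit n c (fst p))) else 0))"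
      unfolding bracket_unit[OF GX abcd(1,2) p(1,2) ne(1) p(3)] bracket_unit[OF GX p(2,1) abcd(3,4) p(4) ne(2)] ..
  qed
  have inner: "eps n a b \<bullet>c eps n c d = of_bool (a = c) - of_bool (b = c) + of_bool (b = d)"
    using eps_inner[OF abcd] ne by simp
  from id[unfolded ddca_identities_def, THEN conjunct2, THEN conjunct2, rule_format, OF abcd ne(1,2) neq]
  show "lie (\<gamma> (GenK (traceless_unit n a b))) (\<gamma> (GenQ (traceless_unit n c d))) =
       (if b = c then \<gamma> (GenP (traceless_unit n a d)) else 0) +
       (bet - lam / 2) *\<^sub>C (if b = c then \<gamma> (GenX (traceless_unit n a d)) else 0) -
       (lam / 4 * (of_bool (a = c) - of_bool (b = c) + of_bool (b = d))) *\<^sub>C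
       acomm (\<gamma> (GenX (traceless_unit n a b))) (\<gamma> (GenX (traceless_unit n c d))) +
       (lam / 4) *\<^sub>C (\<Sum>p\<in>{(i, j). i \<in> {1..n} \<and> j \<in> {1..n} \<and> i \<noteq> j}.
         acomm ((if b = fst p then \<gamma> (GenX (traceless_unit n a (snd p))) else 0) - (if a = snd p then \<gamma> (GenX (traceless_unit n (fst p) b)) else 0))
              ((if fst p = c then \<gamma> (GenX (traceless_unit n (snd p) d)) else 0) - (if snd p = d then \<gamma> (GenX (traceless_unit n c (fst p))) else 0)))"
    unfolding P X sum inner unfolding unit[OF ne(1)] unit[OF ne(2)] .
qed

section \<open>The Yangian generators\<close>

lemma simple_vec_eq: "simple_vec n Plus i = Emat n i (Suc i)" "simple_vec n Minus i = Emat n (Suc i) i"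
  by (simp_all add: simple_vec_def)

lemma simple_vec_sl [simp]: "simple_vec n \<sigma> i \<in> sl n"
  by (cases \<sigma>) (simp_all add: simple_vec_eq)

lemma root_vec_sl [simp]: "\<alpha> \<in> pos_roots n \<Longrightarrow> root_vec n \<sigma> \<alpha> \<in> sl n"
  by (cases \<sigma>; cases \<alpha>) (auto simp: pos_roots_def)

lemma coroot_eq: "coroot n i = traceless_unit n i i + (- 1) \<cdot>\<^sub>m traceless_unit n (Suc i) (Suc i)"
  by (rule eq_matI) (auto simp: coroot_def traceless_unit_def Emat_def)

lemma coroot_sl: "i \<in> {1..n} \<Longrightarrow> Suc i \<in> {1..n} \<Longrightarrow> coroot n i \<in> sl n"
  by (simp only: coroot_eq sl_add sl_smult traceless_unit_sl)

lemma finite_pos_roots [simp]: "finite (pos_roots n)"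
  by (rule finite_subset[of _ "{1..n} \<times> {1..n}"]) (auto simp: pos_roots_def)

theorem theorem5p3:
  fixes n :: nat and lam bet :: complex
    and D :: "(complex, (ddca_gen word \<Rightarrow>\<^sub>0 complex) set) module"
    and g :: "ddca_gen \<Rightarrow> (ddca_gen word \<Rightarrow>\<^sub>0 complex) set"
    and X :: "sign \<Rightarrow> nat \<Rightarrow> nat \<Rightarrow> (ddca_gen word \<Rightarrow>\<^sub>0 complex) set"
    and H :: "nat \<Rightarrow> nat \<Rightarrow> (ddca_gen word \<Rightarrow>\<^sub>0 complex) set"
  assumes n: "n \<ge> 4"
    and D: "D = ddca n lam bet"
    and g: "g = ddca_elem n lam bet"
    and X0: "\<And>\<sigma> i. i \<in> {1..n-1} \<Longrightarrow> X \<sigma> i 0 = g (GenX (simple_vec n \<sigma> i))"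
    and H0: "\<And>i. i \<in> {1..n-1} \<Longrightarrow> H i 0 = g (GenX (coroot n i))"
    and X1: "\<And>\<sigma> i. i \<in> {1..n-1} \<Longrightarrow>
      X \<sigma> i 1 = g (GenP (simple_vec n \<sigma> i)) \<ominus>\<^bsub>D\<^esub> lam \<odot>\<^bsub>D\<^esub> omega D (\<lambda>Y. g (GenX Y)) n \<sigma> i"
    and H1: "\<And>i. i \<in> {1..n-1} \<Longrightarrow>
      H i 1 = g (GenP (coroot n i)) \<ominus>\<^bsub>D\<^esub> lam \<odot>\<^bsub>D\<^esub> nu D (\<lambda>Y. g (GenX Y)) n i"
  shows "\<forall>i \<in> {1..n-1}. \<forall>j \<in> {1..n-1}.
    (\<forall>r \<in> {0, 1}. \<forall>s \<in> {0, 1}. commutator D (H i r) (H j s) = \<zero>\<^bsub>D\<^esub>) \<and>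
    (\<forall>\<sigma>. \<forall>s \<in> {0, 1}.
       commutator D (H i 0) (X \<sigma> j s) = (sgn_val \<sigma> * of_int (cartan i j)) \<odot>\<^bsub>D\<^esub> X \<sigma> j s) \<and>
    (\<forall>\<sigma>. commutator D (X \<sigma> i 1) (X \<sigma> j 0) \<ominus>\<^bsub>D\<^esub> commutator D (X \<sigma> i 0) (X \<sigma> j 1) =
       (sgn_val \<sigma> * (lam * of_int (cartan i j) / 2)) \<odot>\<^bsub>D\<^esub> symm D (X \<sigma> i 0) (X \<sigma> j 0)) \<and>
    (\<forall>\<sigma>. commutator D (H i 1) (X \<sigma> j 0) \<ominus>\<^bsub>D\<^esub> commutator D (H i 0) (X \<sigma> j 1) =
       (sgn_val \<sigma> * (lam * of_int (cartan i j) / 2)) \<odot>\<^bsub>D\<^esub> symm D (H i 0) (X \<sigma> j 0)) \<and>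
    (\<forall>r s. r + s \<in> {0, 1} \<longrightarrow>
       commutator D (X Plus i r) (X Minus j s) = (if i = j then H i (r + s) else \<zero>\<^bsub>D\<^esub>)) \<and>
    commutator D (commutator D (X Plus i 1) (X Minus i 1)) (H i 1) = \<zero>\<^bsub>D\<^esub> \<and>
    (\<forall>\<sigma>. i \<noteq> j \<longrightarrow>
       (commutator D (X \<sigma> i 0) ^^ nat (1 - cartan i j)) (X \<sigma> j 0) = \<zero>\<^bsub>D\<^esub>)"
proof -
  interpret Q: free_quotient "ddca_ideal n lam bet" "ddca_gens n" by (rule ddca_ideal_quotient)
  define \<gamma> where "\<gamma> x = Q.\<Phi> (free_gen x)" for x
  have id: "ddca_identities n lam bet \<gamma>"
    using ddca_identities_hold[of n lam bet] by (simp add: \<gamma>_def[abs_def])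
  interpret U: sl_ddca_units "{1..n}" lam bet "\<lambda>a b. \<gamma> (GenX (traceless_unit n a b))" "\<lambda>a b. \<gamma> (GenK (traceless_unit n a b))"
    "\<lambda>a b. \<gamma> (GenQ (traceless_unit n a b))" "\<lambda>a b. \<gamma> (GenP (traceless_unit n a b))"
    by (rule sl_ddca_units_of_identities[OF n id])
  have D_eq: "D = Q.Qt" by (simp add: D ddca_def)
  have g_eq: "g x = Q.cls (free_gen x)" for x by (simp add: g ddca_elem_def Q.cls_def)
  interpret D: complex_algebra_record D unfolding D_eq by (rule Q.Qt_algebra)
  have emb: "embed D (g x) = \<gamma> x" for x
    by (simp add: D_eq g_eq \<gamma>_def Q.\<Phi>_def)
  have g_closed: "g x \<in> carrier D" if "x \<in> ddca_gens n" for x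
    unfolding D_eq g_eq by (rule Q.cls_closed) (simp add: that)
  have GX: "GenX \<in> {GenX, GenK, GenQ, GenP}" and GP: "GenP \<in> {GenX, GenK, GenQ, GenP}" by simp_all
  have \<gamma>_simple: "\<gamma> (GenX (simple_vec n \<sigma> i)) = U.X0 \<sigma> i"
    "\<gamma> (GenP (simple_vec n \<sigma> i)) = (case \<sigma> of Plus \<Rightarrow> \<gamma> (GenP (traceless_unit n i (Suc i))) | Minus \<Rightarrow> \<gamma> (GenP (traceless_unit n (Suc i) i)))" for \<sigma> i
    by (cases \<sigma>; simp add: simple_vec_eq traceless_unit_off_diagonal)+
  have \<gamma>_coroot: "\<gamma> (T (coroot n i)) = \<gamma> (T (traceless_unit n i i)) - \<gamma> (T (traceless_unit n (Suc i) (Suc i)))"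
    if "T \<in> {GenX, GenK, GenQ, GenP}" "i \<in> {1..n}" "Suc i \<in> {1..n}" for T :: "complex mat \<Rightarrow> ddca_gen" and i
    unfolding coroot_eq using linear_identities(1,2)[OF id that(1)] that(2,3)
    by (simp only: traceless_unit_sl sl_smult linear_identities(2)[OF id that(1) traceless_unit_sl[OF that(3)] traceless_unit_sl[OF that(3)]]) simp
  have omega: "omega D (\<lambda>Y. g (GenX Y)) n \<sigma> i \<in> carrier D \<and> embed D (omega D (\<lambda>Y. g (GenX Y)) n \<sigma> i) = U.omega_units \<sigma> i"
    if i: "i \<in> {1..n}" "Suc i \<in> {1..n}" for \<sigma> i
  proof -
    let ?t = "\<lambda>\<alpha>. symm D (g (GenX (mat_bracket (simple_vec n \<sigma> i) (root_vec n \<sigma> \<alpha>)))) (g (GenX (root_vec n (opp \<sigma>) \<alpha>)))"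
    have t: "?t \<in> pos_roots n \<rightarrow> carrier D"
      by (auto intro!: D.bracket_closed g_closed)
    have s: "symm D (g (GenX (simple_vec n \<sigma> i))) (g (GenX (coroot n i))) \<in> carrier D"
      using coroot_sl[OF i] by (auto intro!: D.bracket_closed g_closed)
    have closed: "omega D (\<lambda>Y. g (GenX Y)) n \<sigma> i \<in> carrier D"
      unfolding omega_def using t s by (intro D.minus_closed D.smult_closed D.finsum_closed)
    have "embed D (omega D (\<lambda>Y. g (GenX Y)) n \<sigma> i) =
        (sgn_val \<sigma> / 4) *\<^sub>C (\<Sum>\<alpha>\<in>pos_roots n. embed D (?t \<alpha>)) - (1 / 4) *\<^sub>C acomm (U.X0 \<sigma> i) (U.H0 i)"
      unfolding omega_def using t s coroot_sl[OF i]
      by (simp add: D.embed_operations D.embed_smult D.embed_finsum D.finsum_closed D.embed_brackets g_closed emb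
          \<gamma>_simple \<gamma>_coroot[OF GX i] U.H0_def)
    also have "(\<Sum>\<alpha>\<in>pos_roots n. embed D (?t \<alpha>)) =
        (\<Sum>\<alpha>\<in>pos_roots n. acomm (lie (U.X0 \<sigma> i) (\<gamma> (GenX (root_vec n \<sigma> \<alpha>)))) (\<gamma> (GenX (root_vec n (opp \<sigma>) \<alpha>))))"
    proof (intro sum.cong refl)
      fix \<alpha> assume \<alpha>: "\<alpha> \<in> pos_roots n"
      show "embed D (?t \<alpha>) = acomm (lie (U.X0 \<sigma> i) (\<gamma> (GenX (root_vec n \<sigma> \<alpha>)))) (\<gamma> (GenX (root_vec n (opp \<sigma>) \<alpha>)))"
        using \<alpha> by (simp add: D.embed_brackets g_closed emb \<gamma>_simple(1)[symmetric] linear_identities(3)[OF id GX])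
    qed
    also have "\<dots> = (\<Sum>(a, b)\<in>{(a, b). a \<in> {1..n} \<and> b \<in> {1..n} \<and> a < b}.
        acomm (lie (U.X0 \<sigma> i) (\<gamma> (GenX (root_vec n \<sigma> (a, b))))) (\<gamma> (GenX (root_vec n (opp \<sigma>) (a, b)))))"
      by (rule sum.cong) (auto simp: pos_roots_def)
    also have "\<dots> = (\<Sum>(a, b)\<in>{(a, b). a \<in> {1..n} \<and> b \<in> {1..n} \<and> a < b}.
        (case \<sigma> of Plus \<Rightarrow> acomm (lie (U.X0 \<sigma> i) (\<gamma> (GenX (traceless_unit n a b)))) (\<gamma> (GenX (traceless_unit n b a)))
         | Minus \<Rightarrow> acomm (lie (U.X0 \<sigma> i) (\<gamma> (GenX (traceless_unit n b a)))) (\<gamma> (GenX (traceless_unit n a b)))))"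
      by (rule sum.cong) (cases \<sigma>; auto simp: traceless_unit_off_diagonal)+
    finally show ?thesis using closed by (cases \<sigma>) (simp_all del: One_nat_def)
  qed
  have X_props: "X \<sigma> i 0 \<in> carrier D" "X \<sigma> i 1 \<in> carrier D" "embed D (X \<sigma> i 0) = U.X0 \<sigma> i" "embed D (X \<sigma> i 1) = U.X1 \<sigma> i"
    if i: "i \<in> {1..n-1}" for \<sigma> i
  proof -
    have iI: "i \<in> {1..n}" "Suc i \<in> {1..n}" using i by auto
    show "X \<sigma> i 0 \<in> carrier D" "X \<sigma> i 1 \<in> carrier D"
      using omega[OF iI] by (simp_all add: X0[OF i] X1[OF i, simplified] g_closed)
    show "embed D (X \<sigma> i 0) = U.X0 \<sigma> i" by (simp add: X0[OF i] emb \<gamma>_simple)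
    show "embed D (X \<sigma> i 1) = U.X1 \<sigma> i"
      using omega[OF iI] U.P_minus_omega[OF iI]
      by (simp add: X1[OF i, simplified] D.embed_operations D.embed_smult g_closed emb \<gamma>_simple)
  qed
  have H_props: "H i 0 \<in> carrier D" "H i 1 \<in> carrier D" "embed D (H i 0) = U.H0 i" "embed D (H i 1) = U.H1 i"
    if i: "i \<in> {1..n-1}" for i
  proof -
    have iI: "i \<in> {1..n}" "Suc i \<in> {1..n}" using i by auto
    have nu: "nu D (\<lambda>Y. g (GenX Y)) n i \<in> carrier D"
      using omega[OF iI] by (auto simp: nu_def intro!: D.bracket_closed g_closed)
    show "H i 0 \<in> carrier D" "H i 1 \<in> carrier D"
      using nu coroot_sl[OF iI] by (simp_all add: H0[OF i] H1[OF i, simplified] g_closed)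
    show "embed D (H i 0) = U.H0 i"
      by (simp add: H0[OF i] emb \<gamma>_coroot[OF GX iI] U.H0_def)
    have "embed D (H i 1) = \<gamma> (GenP (coroot n i)) - lam *\<^sub>C lie (U.omega_units Plus i) (U.X0 Minus i)"
      using nu omega[OF iI, of Plus] coroot_sl[OF iI]
      by (simp add: H1[OF i, simplified] D.embed_operations D.embed_smult g_closed emb nu_def D.embed_brackets \<gamma>_simple del: U.omega_units.simps U.X0.simps)
    also have "\<gamma> (GenP (coroot n i)) = lie (\<gamma> (GenP (traceless_unit n i (Suc i)))) (U.X0 Minus i)"
      using iI by (simp add: \<gamma>_coroot[OF GP iI] U.P_E)
    also have "\<dots> - lam *\<^sub>C lie (U.omega_units Plus i) (U.X0 Minus i) = lie (U.X1 Plus i) (U.X0 Minus i)"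
      using U.P_minus_omega[OF iI, of Plus, symmetric] by (simp del: U.omega_units.simps U.X0.simps)
    also have "\<dots> = U.H1 i" by (rule U.X1_X0_level_one[OF iI])
    finally show "embed D (H i 1) = U.H1 i" .
  qed
  have eqI: "y = z" if "y \<in> carrier D" "z \<in> carrier D" "embed D y = embed D z" for y z
    using that D.embed_eq_iff by blast
  show ?thesis
  proof (intro ballI)
    fix i j assume i: "i \<in> {1..n-1}" and j: "j \<in> {1..n-1}"
    have ij: "i \<in> {1..n}" "Suc i \<in> {1..n}" "j \<in> {1..n}" "Suc j \<in> {1..n}" using i j by auto
    note props = X_props[OF i] X_props[OF j] H_props[OF i] H_props[OF j]
    note embed = D.embed_operations D.embed_smult D.embed_brackets D.embed_zero
    have HH: "commutator D (H i r) (H j s) = \<zero>\<^bsub>D\<^esub>" if "r \<in> {0, 1}" "s \<in> {0, 1}" for r s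
      by (rule eqI) (use that in \<open>auto simp: embed props U.H0_H0[OF ij] U.H0_H1[OF ij] U.H1_H0[OF ij] U.H1_H1[OF ij] simp del: One_nat_def\<close>)
    have HX: "commutator D (H i 0) (X \<sigma> j s) = (sgn_val \<sigma> * of_int (cartan i j)) \<odot>\<^bsub>D\<^esub> X \<sigma> j s" if "s \<in> {0, 1}" for \<sigma> s
      by (rule eqI) (use that in \<open>auto simp: embed props U.H0_X0[OF ij] U.H0_X1[OF ij] simp del: U.X0.simps One_nat_def\<close>)
    have XX: "commutator D (X \<sigma> i 1) (X \<sigma> j 0) \<ominus>\<^bsub>D\<^esub> commutator D (X \<sigma> i 0) (X \<sigma> j 1) =
       (sgn_val \<sigma> * (lam * of_int (cartan i j) / 2)) \<odot>\<^bsub>D\<^esub> symm D (X \<sigma> i 0) (X \<sigma> j 0)" for \<sigma>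
      by (rule eqI) (use U.X1_X0_same[OF ij] in \<open>simp_all add: embed props del: U.X0.simps One_nat_def\<close>)
    have H1X: "commutator D (H i 1) (X \<sigma> j 0) \<ominus>\<^bsub>D\<^esub> commutator D (H i 0) (X \<sigma> j 1) =
       (sgn_val \<sigma> * (lam * of_int (cartan i j) / 2)) \<odot>\<^bsub>D\<^esub> symm D (H i 0) (X \<sigma> j 0)" for \<sigma>
      by (rule eqI) (use U.H1_X0[OF ij] in \<open>simp_all add: embed props del: U.X0.simps One_nat_def\<close>)
    have opposite: "commutator D (X Plus i r) (X Minus j s) = (if i = j then H i (r + s) else \<zero>\<^bsub>D\<^esub>)"
      if "r + s \<in> {0, 1}" for r s
    proof -
      have rs: "(r = 0 \<and> s = 0) \<or> (r = 1 \<and> s = 0) \<or> (r = 0 \<and> s = 1)" using that by auto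
      show ?thesis
        by (rule eqI) (use rs U.X0_X0_opposite[OF ij] U.X1_X0_opposite[OF ij] in \<open>auto simp: embed props simp del: U.X0.simps One_nat_def\<close>)
    qed
    have level_two: "commutator D (commutator D (X Plus i 1) (X Minus i 1)) (H i 1) = \<zero>\<^bsub>D\<^esub>"
      by (rule eqI) (use U.level_two_commutes[OF ij(1,2)] in \<open>simp_all add: embed props del: One_nat_def\<close>)
    have serre: "(commutator D (X \<sigma> i 0) ^^ nat (1 - cartan i j)) (X \<sigma> j 0) = \<zero>\<^bsub>D\<^esub>" if "i \<noteq> j" for \<sigma>
      by (rule eqI) (use U.serre[OF ij that] in \<open>simp_all add: embed props D.embed_funpow_commutator del: U.X0.simps\<close>)
    show "(\<forall>r \<in> {0, 1}. \<forall>s \<in> {0, 1}. commutator D (H i r) (H j s) = \<zero>\<^bsub>D\<^esub>) \<and>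
    (\<forall>\<sigma>. \<forall>s \<in> {0, 1}.
       commutator D (H i 0) (X \<sigma> j s) = (sgn_val \<sigma> * of_int (cartan i j)) \<odot>\<^bsub>D\<^esub> X \<sigma> j s) \<and>
    (\<forall>\<sigma>. commutator D (X \<sigma> i 1) (X \<sigma> j 0) \<ominus>\<^bsub>D\<^esub> commutator D (X \<sigma> i 0) (X \<sigma> j 1) =
       (sgn_val \<sigma> * (lam * of_int (cartan i j) / 2)) \<odot>\<^bsub>D\<^esub> symm D (X \<sigma> i 0) (X \<sigma> j 0)) \<and>
    (\<forall>\<sigma>. commutator D (H i 1) (X \<sigma> j 0) \<ominus>\<^bsub>D\<^esub> commutator D (H i 0) (X \<sigma> j 1) =
       (sgn_val \<sigma> * (lam * of_int (cartan i j) / 2)) \<odot>\<^bsub>D\<^esub> symm D (H i 0) (X \<sigma> j 0)) \<and>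
    (\<forall>r s. r + s \<in> {0, 1} \<longrightarrow>
       commutator D (X Plus i r) (X Minus j s) = (if i = j then H i (r + s) else \<zero>\<^bsub>D\<^esub>)) \<and>
    commutator D (commutator D (X Plus i 1) (X Minus i 1)) (H i 1) = \<zero>\<^bsub>D\<^esub> \<and>
    (\<forall>\<sigma>. i \<noteq> j \<longrightarrow>
       (commutator D (X \<sigma> i 0) ^^ nat (1 - cartan i j)) (X \<sigma> j 0) = \<zero>\<^bsub>D\<^esub>)"
      by (intro conjI ballI allI impI HH HX XX H1X opposite level_two serre; assumption)
  qed
qed

end
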